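(* Let $X$ and $Y$ be complex manifolds and let $k:X\to Y$ be a holomorphic map. If $k$ satisfies the parametric Oka property with interpolation (POPI), then $k$ satisfies the parametric Oka property with approximation (POPA).
   Context: Conventions: complex manifolds are second countable but not necessarily connected. Submanifolds are closed complex submanifolds. $I=[0,1]$. A finite polyhedron is (the geometric realization of) a finite simplicial complex; a subpolyhedron is (the realization of) a subcomplex; both may be a point, and the subpolyhedron may be empty. A compact subset $K$ of a Stein manifold $S$ is holomorphically convex if it equals its hull with respect to the holomorphic functions on $S$. POPI: A holomorphic map $k:X\to Y$ satisfies the parametric Oka property with interpolation if for every Stein manifold $S$ with a submanifold $T$, every finite polyhedron $P$ with a subpolyhedron $Q$, and every continuous map $h:S\times P\to X$ such that (a) $h(\cdot,p)$ is holomorphic on $T$ for all $p\in P$, (b) $h(\cdot,q)$ is holomorphic on $S$ for all $q\in Q$, and (c) $k\circ h(\cdot,p)$ is holomorphic on $S$ for all $p\in P$, there is a continuous map $H:S\times P\times I\to X$ such that (1) $H(\cdot,\cdot,0)=h$, (2) $H(\cdot,p,1)$ is holomorphic on $S$ for all $p\in P$, (3) $H(\cdot,q,t)=h(\cdot,q)$ for all $q\in Q$ and $t\in I$, (4) $k\circ H(\cdot,p,t)=k\circ h(\cdot,p)$ for all $p\in P$ and $t\in I$, and (5) $H(x,p,t)=h(x,p)$ for all $(x,p,t)\in T\times P\times I$. POPA: A holomorphic map $k:X\to Y$ satisfies the parametric Oka property with approximation if for every Stein manifold $S$, every holomorphically convex compact subset $K$ of $S$, every neighbourhood $U$ of $K$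 in $S$, every finite polyhedron $P$ with a subpolyhedron $Q$, every continuous map $h:S\times P\to X$ such that (a) $h(\cdot,p)$ is holomorphic on $U$ for all $p\in P$, (b) $h(\cdot,q)$ is holomorphic on $S$ for all $q\in Q$, and (c) $k\circ h(\cdot,p)$ is holomorphic on $S$ for all $p\in P$, every metric $d$ on $X$ compatible with the topology of $X$, and every $\epsilon>0$, there is a continuous map $H:S\times P\times I\to X$ such that (1) $H(\cdot,\cdot,0)=h$, (2) $H(\cdot,p,1)$ is holomorphic on $S$ for all $p\in P$, (3) $H(\cdot,q,t)=h(\cdot,q)$ for all $q\in Q$ and $t\in I$, (4) $k\circ H(\cdot,p,t)=k\circ h(\cdot,p)$ for all $p\in P$ and $t\in I$, and (5) $d(H(x,p,t),h(x,p))<\epsilon$ for all $(x,p,t)\in K\times P\times I$. *)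

theory Defs
  imports "HOL-Analysis.Analysis"
begin

section \<open>Holomorphic functions of several variables\<close>

text \<open>As in the library's \<^const>\<open>Euclidean_space\<close>, points of $\mathbb C^n$ are sequences vanishing from
  index $n$ on, so that literally $\mathbb C^m \subseteq \mathbb C^n$ for $m \le n$.\<close>

definition complex_space :: "nat \<Rightarrow> (nat \<Rightarrow> complex) topology"
  where "complex_space n = subtopology (product_topology (\<lambda>_. euclidean) UNIV) {z. \<forall>i\<ge>n. z i = 0}"

text \<open>Complex (Frechet) differentiability at every point; meant for \<open>W\<close> open in $\mathbb C^n$.\<close>

definition holomorphic_Cn :: "nat \<Rightarrow> ((nat \<Rightarrow> complex) \<Rightarrow> complex) \<Rightarrow> (nat \<Rightarrow> complex) set \<Rightarrow> bool"
  where "holomorphic_Cn n f W \<longleftrightarrow>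
    (\<forall>z\<in>W. \<exists>a :: nat \<Rightarrow> complex.
      ((\<lambda>w. (f w - f z - (\<Sum>i<n. a i * (w i - z i)))
              / complex_of_real (L2_set (\<lambda>i. cmod (w i - z i)) {..<n}))
        \<longlongrightarrow> 0) (at z within W))"


section \<open>Complex manifolds and holomorphic maps\<close>

type_synonym 'a chart = "nat \<times> 'a set \<times> ('a \<Rightarrow> nat \<Rightarrow> complex)"

record 'a cmanifold =
  mtop :: "'a topology"
  atlas :: "'a chart set"

definition is_chart :: "'a topology \<Rightarrow> 'a chart \<Rightarrow> bool"
  where "is_chart X = (\<lambda>(n, U, \<phi>).
    openin X U \<and> openin (complex_space n) (\<phi> ` U) \<and>
    homeomorphic_map (subtopology X U) (subtopology (complex_space n) (\<phi> ` U)) \<phi>)"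

definition holomorphic_transition :: "'a chart \<Rightarrow> 'a chart \<Rightarrow> bool"
  where "holomorphic_transition = (\<lambda>(n, U, \<phi>) (m, V, \<psi>).
    \<forall>i<m. holomorphic_Cn n (\<lambda>z. \<psi> (inv_into U \<phi> z) i) (\<phi> ` (U \<inter> V)))"

text \<open>The dimension may differ between connected components. The atlas need not be maximal.\<close>

definition complex_manifold :: "'a cmanifold \<Rightarrow> bool"
  where "complex_manifold M \<longleftrightarrow>
    Hausdorff_space (mtop M) \<and> second_countable (mtop M) \<and>
    (\<forall>c\<in>atlas M. is_chart (mtop M) c) \<and>
    (\<Union>(n, U, \<phi>)\<in>atlas M. U) = topspace (mtop M) \<and>
    (\<forall>c\<in>atlas M. \<forall>c'\<in>atlas M. holomorphic_transition c c')"

definition maximal_atlas :: "'a cmanifold \<Rightarrow> 'a chart set"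
  where "maximal_atlas M = {c. is_chart (mtop M) c \<and>
    (\<forall>c'\<in>atlas M. holomorphic_transition c c' \<and> holomorphic_transition c' c)}"

definition holomorphic_map :: "'a cmanifold \<Rightarrow> 'b cmanifold \<Rightarrow> ('a \<Rightarrow> 'b) \<Rightarrow> bool"
  where "holomorphic_map M N f \<longleftrightarrow>
    continuous_map (mtop M) (mtop N) f \<and>
    (\<forall>(n, U, \<phi>)\<in>atlas M. \<forall>(m, V, \<psi>)\<in>atlas N. \<forall>i<m.
      holomorphic_Cn n (\<lambda>z. \<psi> (f (inv_into U \<phi> z)) i) (\<phi> ` (U \<inter> f -` V)))"

definition holomorphic_function :: "'a cmanifold \<Rightarrow> ('a \<Rightarrow> complex) \<Rightarrow> bool"
  where "holomorphic_function M f \<longleftrightarrow>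
    continuous_map (mtop M) euclidean f \<and>
    (\<forall>(n, U, \<phi>)\<in>atlas M. holomorphic_Cn n (\<lambda>z. f (inv_into U \<phi> z)) (\<phi> ` U))"

definition closed_submanifold :: "'a cmanifold \<Rightarrow> 'a set \<Rightarrow> bool"
  where "closed_submanifold M T \<longleftrightarrow>
    closedin (mtop M) T \<and>
    (\<forall>x\<in>T. \<exists>(n, U, \<phi>)\<in>maximal_atlas M. x \<in> U \<and>
      (\<exists>m\<le>n. \<phi> ` (U \<inter> T) = \<phi> ` U \<inter> topspace (complex_space m)))"

text \<open>The induced complex structure, both on a closed submanifold and (with \<open>m = n\<close> in the
  nonempty charts) on an open subset \<open>A\<close>.\<close>

definition induced :: "'a cmanifold \<Rightarrow> 'a set \<Rightarrow> 'a cmanifold"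
  where "induced M A = \<lparr>mtop = subtopology (mtop M) A,
    atlas = {(m, U \<inter> A, \<phi>) | m n U \<phi>. (n, U, \<phi>) \<in> maximal_atlas M \<and> m \<le> n \<and>
               \<phi> ` (U \<inter> A) = \<phi> ` U \<inter> topspace (complex_space m)}\<rparr>"

abbreviation holomorphic_map_on :: "'a cmanifold \<Rightarrow> 'a set \<Rightarrow> 'b cmanifold \<Rightarrow> ('a \<Rightarrow> 'b) \<Rightarrow> bool"
  where "holomorphic_map_on M A N f \<equiv> holomorphic_map (induced M A) N f"


section \<open>Stein manifolds\<close>

text \<open>Quantifying over bounds \<open>c\<close> expresses $|f(x)| \le \sup_K |f|$, also for empty \<open>K\<close> (whose hull is
  empty).\<close>

definition holomorphic_hull :: "'a cmanifold \<Rightarrow> 'a set \<Rightarrow> 'a set"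
  where "holomorphic_hull M K = {x \<in> topspace (mtop M).
    \<forall>f c. holomorphic_function M f \<and> (\<forall>y\<in>K. cmod (f y) \<le> c) \<longrightarrow> cmod (f x) \<le> c}"

text \<open>The classical definition: holomorphic convexity, separation of points, and local coordinates
  by global holomorphic functions.\<close>

definition stein_manifold :: "'a cmanifold \<Rightarrow> bool"
  where "stein_manifold M \<longleftrightarrow>
    complex_manifold M \<and>
    (\<forall>K. compactin (mtop M) K \<longrightarrow> compactin (mtop M) (holomorphic_hull M K)) \<and>
    (\<forall>x\<in>topspace (mtop M). \<forall>y\<in>topspace (mtop M). x \<noteq> y \<longrightarrow>
      (\<exists>f. holomorphic_function M f \<and> f x \<noteq> f y)) \<and>
    (\<forall>x\<in>topspace (mtop M). \<exists>n U f. x \<in> U \<and> (\<forall>i<n. holomorphic_function M (f i)) \<and>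
      (n, U, \<lambda>y i. if i < n then f i y else 0) \<in> maximal_atlas M)"

definition holomorphically_convex_compact :: "'a cmanifold \<Rightarrow> 'a set \<Rightarrow> bool"
  where "holomorphically_convex_compact M K \<longleftrightarrow>
    compactin (mtop M) K \<and> holomorphic_hull M K = K"


section \<open>Finite polyhedra\<close>

text \<open>Abstract finite simplicial complexes with vertices in \<open>nat\<close>, realized by barycentric
  coordinates. This avoids fixing the dimension of an ambient Euclidean space.\<close>

definition finite_simplicial_complex :: "nat set set \<Rightarrow> bool"
  where "finite_simplicial_complex C \<longleftrightarrow>
    finite C \<and> (\<forall>\<sigma>\<in>C. finite \<sigma> \<and> \<sigma> \<noteq> {} \<and> (\<forall>\<tau>. \<tau> \<subseteq> \<sigma> \<and> \<tau> \<noteq> {} \<longrightarrow> \<tau> \<in> C))"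

definition realization :: "nat set set \<Rightarrow> (nat \<Rightarrow> real) set"
  where "realization C = {x. (\<forall>i. 0 \<le> x i) \<and> {i. x i \<noteq> 0} \<in> C \<and> (\<Sum>i | x i \<noteq> 0. x i) = 1}"

abbreviation polyhedron_top :: "nat set set \<Rightarrow> (nat \<Rightarrow> real) topology"
  where "polyhedron_top C \<equiv> subtopology (powertop_real UNIV) (realization C)"


section \<open>The parametric Oka properties\<close>

abbreviation unit_interval_top :: "real topology"
  where "unit_interval_top \<equiv> top_of_set {0..1}"

text \<open>HOL cannot quantify over types within a formula, so the type over which the Stein manifolds
  \<open>S\<close> are carried is a parameter. Second countable Hausdorff spaces have at most the cardinality of
  the continuum, so \<open>TYPE(real)\<close> already covers all Stein manifolds up to biholomorphism.\<close>

definition POPI :: "'s itself \<Rightarrow> 'x cmanifold \<Rightarrow> 'y cmanifold \<Rightarrow> ('x \<Rightarrow> 'y) \<Rightarrow> bool"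
  where "POPI (_ :: 's itself) X Y k \<longleftrightarrow>
    (\<forall>(S :: 's cmanifold) T C D (h :: 's \<times> (nat \<Rightarrow> real) \<Rightarrow> 'x).
      stein_manifold S \<and> closed_submanifold S T \<and>
      finite_simplicial_complex C \<and> finite_simplicial_complex D \<and> D \<subseteq> C \<and>
      continuous_map (prod_topology (mtop S) (polyhedron_top C)) (mtop X) h \<and>
      (\<forall>p\<in>realization C. holomorphic_map_on S T X (\<lambda>x. h (x, p))) \<and>
      (\<forall>q\<in>realization D. holomorphic_map S X (\<lambda>x. h (x, q))) \<and>
      (\<forall>p\<in>realization C. holomorphic_map S Y (\<lambda>x. k (h (x, p))))
      \<longrightarrow>
      (\<exists>H :: 's \<times> (nat \<Rightarrow> real) \<times> real \<Rightarrow> 'x.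
        continuous_map
          (prod_topology (mtop S) (prod_topology (polyhedron_top C) unit_interval_top)) (mtop X) H \<and>
        (\<forall>x\<in>topspace (mtop S). \<forall>p\<in>realization C. H (x, p, 0) = h (x, p)) \<and>
        (\<forall>p\<in>realization C. holomorphic_map S X (\<lambda>x. H (x, p, 1))) \<and>
        (\<forall>x\<in>topspace (mtop S). \<forall>q\<in>realization D. \<forall>t\<in>{0..1}. H (x, q, t) = h (x, q)) \<and>
        (\<forall>x\<in>topspace (mtop S). \<forall>p\<in>realization C. \<forall>t\<in>{0..1}. k (H (x, p, t)) = k (h (x, p))) \<and>
        (\<forall>x\<in>T. \<forall>p\<in>realization C. \<forall>t\<in>{0..1}. H (x, p, t) = h (x, p))))"

definition POPA :: "'s itself \<Rightarrow> 'x cmanifold \<Rightarrow> 'y cmanifold \<Rightarrow> ('x \<Rightarrow> 'y) \<Rightarrow> bool"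
  where "POPA (_ :: 's itself) X Y k \<longleftrightarrow>
    (\<forall>(S :: 's cmanifold) K U C D (h :: 's \<times> (nat \<Rightarrow> real) \<Rightarrow> 'x) d (\<epsilon> :: real).
      stein_manifold S \<and> holomorphically_convex_compact S K \<and> openin (mtop S) U \<and> K \<subseteq> U \<and>
      finite_simplicial_complex C \<and> finite_simplicial_complex D \<and> D \<subseteq> C \<and>
      continuous_map (prod_topology (mtop S) (polyhedron_top C)) (mtop X) h \<and>
      (\<forall>p\<in>realization C. holomorphic_map_on S U X (\<lambda>x. h (x, p))) \<and>
      (\<forall>q\<in>realization D. holomorphic_map S X (\<lambda>x. h (x, q))) \<and>
      (\<forall>p\<in>realization C. holomorphic_map S Y (\<lambda>x. k (h (x, p)))) \<and>
      Metric_space (topspace (mtop X)) d \<and>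
      Metric_space.mtopology (topspace (mtop X)) d = mtop X \<and>
      \<epsilon> > 0
      \<longrightarrow>
      (\<exists>H :: 's \<times> (nat \<Rightarrow> real) \<times> real \<Rightarrow> 'x.
        continuous_map
          (prod_topology (mtop S) (prod_topology (polyhedron_top C) unit_interval_top)) (mtop X) H \<and>
        (\<forall>x\<in>topspace (mtop S). \<forall>p\<in>realization C. H (x, p, 0) = h (x, p)) \<and>
        (\<forall>p\<in>realization C. holomorphic_map S X (\<lambda>x. H (x, p, 1))) \<and>
        (\<forall>x\<in>topspace (mtop S). \<forall>q\<in>realization D. \<forall>t\<in>{0..1}. H (x, q, t) = h (x, q)) \<and>
        (\<forall>x\<in>topspace (mtop S). \<forall>p\<in>realization C. \<forall>t\<in>{0..1}. k (H (x, p, t)) = k (h (x, p))) \<and>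
        (\<forall>x\<in>K. \<forall>p\<in>realization C. \<forall>t\<in>{0..1}. d (H (x, p, t)) (h (x, p)) < \<epsilon>)))"

end

theory Submission
  imports Defs "HOL-Complex_Analysis.Cauchy_Integral_Formula"
begin

text \<open>By holomorphic convexity, finitely many holomorphic functions $f_1, \dots, f_m$ on $S$ cut out an
  analytic polyhedron $U'$ with $K \subseteq U' \subseteq U$ and $|f_i| < 1$ on $U'$. Composing the $f_i$ with a proper
  holomorphic map from the unit disc to $\mathbb C^2$, given by two lacunary power series, yields a map
  $\varphi : U' \to \mathbb C^{2m}$ that blows up at the boundary of $U'$, so its graph $T$ is a closed
  submanifold of the Stein manifold $S \times \mathbb C^{2m}$. The pullback of $h$ to $S \times \mathbb C^{2m}$ is
  holomorphic on $T$, and POPI deforms it to holomorphic maps while keeping it fixed on $T$. Partial sums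
  of the power series give maps $\psi : S \to \mathbb C^{2m}$, holomorphic on all of $S$, that approximate $\varphi$
  uniformly on $K$; restricting the deformation to the graph of such a $\psi$ solves the approximation
  problem.\<close>

section \<open>Complex differentiability on subsets of complex Euclidean space\<close>

text \<open>POPI fixes a deformation only over a closed submanifold, whereas holomorphy of h is
  known on an open set, in general not closed. The auxiliary coordinates remedy this: over the
  polyhedron the graph is closed even though its base is not. Two new coordinates per function f_i
  are used because no holomorphic map from the disc to C is proper, so a single function of f_i
  cannot blow up along the whole unit circle. The f_i are already global on S and the new
  coordinates are power series in them, so truncating the series replaces an approximation theorem
  of Oka-Weil type. POPI says nothing about the size of the deformation off T. Closeness to h comes
  from continuity alone: the deformation equals h on T, and on a compact set of parameters a graph
  close enough to T stays within the prescribed error. The conditions of POPA that demand equality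
  need no limit, since the projection to S is the identity on every graph.\<close>

lemma complex_space_eq: "complex_space n = top_of_set {z. \<forall>i\<ge>n. z i = 0}"
  by (simp add: complex_space_def euclidean_product_topology)

lemma topspace_complex_space [simp]: "topspace (complex_space n) = {z. \<forall>i\<ge>n. z i = 0}"
  by (simp add: complex_space_eq)

lemma tendsto_funI:
  assumes "\<And>i. ((\<lambda>x. F x i) \<longlongrightarrow> l i) A"
  shows "(F \<longlongrightarrow> (l :: 'i \<Rightarrow> 'b::topological_space)) A"
  using assms limitin_componentwise[of "\<lambda>_. euclidean" UNIV F l A]
  by (simp add: euclidean_product_topology)

lemma tendsto_fun_apply: "((\<lambda>w. w i) \<longlongrightarrow> z i) (at (z :: 'i \<Rightarrow> 'b::topological_space) within W)"
proof -
  have "continuous_on UNIV (\<lambda>w :: 'i \<Rightarrow> 'b. w i)"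
    by (rule continuous_on_product_coordinates)
  then show ?thesis
    by (metis UNIV_I continuous_on tendsto_within_subset top_greatest)
qed

text \<open>Differentiability at one point, free of division and with the l^1 norm, which adds up
  directly in the chain rule. The set \<open>W\<close> need not be open; traces on coordinate
  subspaces are treated in the same way.\<close>

definition cdiff :: "nat \<Rightarrow> ((nat \<Rightarrow> complex) \<Rightarrow> complex) \<Rightarrow> (nat \<Rightarrow> complex) set \<Rightarrow> (nat \<Rightarrow> complex) \<Rightarrow> bool"
  where "cdiff n f W z \<longleftrightarrow> (\<exists>a :: nat \<Rightarrow> complex. \<forall>e>0. \<forall>\<^sub>F w in at z within W.
    cmod (f w - f z - (\<Sum>i<n. a i * (w i - z i))) \<le> e * (\<Sum>i<n. cmod (w i - z i)))"

text \<open>The Euclidean norm is at most the sum of the moduli, which is at most \<open>n\<close>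
  times the Euclidean norm. Inside C^n two distinct points differ in some coordinate below
  \<open>n\<close>, so the denominator in \<open>holomorphic_Cn\<close> does not vanish.\<close>

lemma holomorphic_Cn_iff_cdiff:
  assumes "W \<subseteq> topspace (complex_space n)"
  shows "holomorphic_Cn n f W \<longleftrightarrow> (\<forall>z\<in>W. cdiff n f W z)"
proof -
  have "((\<lambda>w. (f w - f z - (\<Sum>i<n. a i * (w i - z i)))
              / complex_of_real (L2_set (\<lambda>i. cmod (w i - z i)) {..<n})) \<longlongrightarrow> 0) (at z within W)
    \<longleftrightarrow> (\<forall>e>0. \<forall>\<^sub>F w in at z within W.
       cmod (f w - f z - (\<Sum>i<n. a i * (w i - z i))) \<le> e * (\<Sum>i<n. cmod (w i - z i)))"
    (is "?L \<longleftrightarrow> ?R") if "z \<in> W" for z and a :: "nat \<Rightarrow> complex"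
  proof -
    let ?E = "\<lambda>w. f w - f z - (\<Sum>i<n. a i * (w i - z i))"
    let ?N2 = "\<lambda>w. L2_set (\<lambda>i. cmod (w i - z i)) {..<n}"
    let ?N1 = "\<lambda>w. (\<Sum>i<n. cmod (w i - z i))"
    have N2pos: "0 < ?N2 w" if "w \<in> W" "w \<noteq> z" for w
    proof -
      obtain i where "w i \<noteq> z i" using \<open>w \<noteq> z\<close> by blast
      moreover from this have "i < n"
        using assms \<open>w \<in> W\<close> \<open>z \<in> W\<close> by (metis (mono_tags, lifting) mem_Collect_eq not_less subsetD topspace_complex_space)
      ultimately have "0 < cmod (w i - z i)" "cmod (w i - z i) \<le> ?N2 w"
        using member_le_L2_set[of "{..<n}" i "\<lambda>i. cmod (w i - z i)"] by auto
      then show ?thesis by linarith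
    qed
    have N21: "?N2 w \<le> ?N1 w" for w
      by (rule L2_set_le_sum) auto
    have N12: "?N1 w \<le> real n * ?N2 w" for w
      using sum_bounded_above[of "{..<n}" "\<lambda>i. cmod (w i - z i)" "?N2 w"]
        member_le_L2_set[of "{..<n}" _ "\<lambda>i. cmod (w i - z i)"] by auto
    have ne: "\<forall>\<^sub>F w in at z within W. w \<in> W \<and> w \<noteq> z"
      by (auto simp: eventually_at_topological)
    show ?thesis
    proof
      assume ?L
      show ?R
      proof (intro allI impI)
        fix e :: real assume "e > 0"
        have "\<forall>\<^sub>F w in at z within W. dist (?E w / complex_of_real (?N2 w)) 0 < e"
          using \<open>?L\<close> \<open>e > 0\<close> by (rule tendstoD)
        then show "\<forall>\<^sub>F w in at z within W. cmod (?E w) \<le> e * ?N1 w"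
          using ne
        proof eventually_elim
          case (elim w)
          then have "cmod (?E w) < e * ?N2 w"
            using N2pos[of w] by (simp add: norm_divide field_simps)
          also have "\<dots> \<le> e * ?N1 w" using N21 \<open>e > 0\<close> by simp
          finally show ?case by simp
        qed
      qed
    next
      assume R: ?R
      show ?L
      proof (rule tendstoI)
        fix e :: real assume "e > 0"
        \<comment> \<open>The factor absorbs the loss \<open>n\<close> in \<open>N12\<close> and
          leaves a strict inequality; adding 1 covers \<open>n = 0\<close>.\<close>
        define e' where "e' = e / (2 * (real n + 1))"
        have "e' > 0" using \<open>e > 0\<close> by (simp add: e'_def)
        then have "\<forall>\<^sub>F w in at z within W. cmod (?E w) \<le> e' * ?N1 w"
          using R by blast
        then show "\<forall>\<^sub>F w in at z within W. dist (?E w / complex_of_real (?N2 w)) 0 < e"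
          using ne
        proof eventually_elim
          case (elim w)
          have "cmod (?E w) \<le> e' * (real n * ?N2 w)"
            using elim N12[of w] \<open>e' > 0\<close> by (smt (verit) mult_left_mono)
          also have "\<dots> = (e' * real n) * ?N2 w" by simp
          also have "\<dots> < e * ?N2 w"
          proof (rule mult_strict_right_mono)
            have "e' * real n \<le> e / 2" using \<open>e > 0\<close> by (simp add: e'_def field_simps)
            then show "e' * real n < e" using \<open>e > 0\<close> by simp
          qed (use N2pos elim in auto)
          finally show ?case
            using N2pos[of w] elim by (simp add: norm_divide field_simps)
        qed
      qed
    qed
  qed
  then show ?thesis
    unfolding holomorphic_Cn_def cdiff_def by simp
qed

lemma cdiff_mono:
  assumes "cdiff n f W z" "W' \<subseteq> W"
  shows "cdiff n f W' z"
  using assms unfolding cdiff_def by (meson at_le eventually_mono filter_leD)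

lemma cdiff_local:
  assumes "cdiff n f (W \<inter> A) z" "open A" "z \<in> A"
  shows "cdiff n f W z"
proof -
  have "at z within W \<inter> A = at z within W"
    using assms by (intro at_within_nhd[of z A]) auto
  then show ?thesis using assms by (simp add: cdiff_def)
qed

lemma cdiff_cong:
  assumes "cdiff n f W z" "z \<in> W" "\<And>w. w \<in> W \<Longrightarrow> f w = g w"
  shows "cdiff n g W z"
proof -
  obtain a where a: "\<And>e. e > 0 \<Longrightarrow> \<forall>\<^sub>F w in at z within W.
    cmod (f w - f z - (\<Sum>i<n. a i * (w i - z i))) \<le> e * (\<Sum>i<n. cmod (w i - z i))"
    using assms(1) unfolding cdiff_def by blast
  have ne: "\<forall>\<^sub>F w in at z within W. w \<in> W"
    by (auto simp: eventually_at_topological)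
  show ?thesis unfolding cdiff_def
  proof (intro exI allI impI)
    fix e :: real assume "e > 0"
    show "\<forall>\<^sub>F w in at z within W.
      cmod (g w - g z - (\<Sum>i<n. a i * (w i - z i))) \<le> e * (\<Sum>i<n. cmod (w i - z i))"
      using a[OF \<open>e > 0\<close>] ne by eventually_elim (simp add: assms)
  qed
qed

text \<open>On a part of C^m the coordinates from \<open>m\<close> on vanish, so they contribute
  neither to the linear part nor to the norm. This is how charts of the ambient manifold restrict to
  a submanifold flattened to C^m.\<close>

lemma cdiff_restrict_dim:
  assumes "cdiff N f W z" "W' \<subseteq> W" "z \<in> W'" "W' \<subseteq> topspace (complex_space m)" "m \<le> N"
  shows "cdiff m f W' z"
proof -
  obtain a where a: "\<And>e. e > 0 \<Longrightarrow> \<forall>\<^sub>F w in at z within W'.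
    cmod (f w - f z - (\<Sum>i<N. a i * (w i - z i))) \<le> e * (\<Sum>i<N. cmod (w i - z i))"
    using cdiff_mono[OF assms(1,2)] unfolding cdiff_def by blast
  have ne: "\<forall>\<^sub>F w in at z within W'. w \<in> W'"
    by (auto simp: eventually_at_topological)
  show ?thesis unfolding cdiff_def
  proof (intro exI allI impI)
    fix e :: real assume "e > 0"
    show "\<forall>\<^sub>F w in at z within W'.
      cmod (f w - f z - (\<Sum>i<m. a i * (w i - z i))) \<le> e * (\<Sum>i<m. cmod (w i - z i))"
      using a[OF \<open>e > 0\<close>] ne
    proof eventually_elim
      case (elim w)
      have zero: "w i = 0" "z i = 0" if "i \<ge> m" for i
        using that assms elim by auto
      have "(\<Sum>i<m. a i * (w i - z i)) = (\<Sum>i<N. a i * (w i - z i))"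
        by (rule sum.mono_neutral_left) (use zero \<open>m \<le> N\<close> in auto)
      moreover have "(\<Sum>i<m. cmod (w i - z i)) = (\<Sum>i<N. cmod (w i - z i))"
        by (rule sum.mono_neutral_left) (use zero \<open>m \<le> N\<close> in auto)
      ultimately show ?case using elim by simp
    qed
  qed
qed

lemma cdiff_coordinate: "j < n \<Longrightarrow> cdiff n (\<lambda>w. w j) W z"
  unfolding cdiff_def
  by (rule exI[of _ "\<lambda>i. if i = j then 1 else 0"])
     (simp add: sum_nonneg if_distrib[of "\<lambda>x. x * _"] cong: if_cong)

lemma cdiff_const: "cdiff n (\<lambda>w. c) W z"
  unfolding cdiff_def by (rule exI[of _ "\<lambda>i. 0"]) (simp add: sum_nonneg)

lemma cdiff_lipschitz:
  assumes "cdiff n f W z"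
  obtains B where "B \<ge> 0" "\<forall>\<^sub>F w in at z within W. cmod (f w - f z) \<le> B * (\<Sum>i<n. cmod (w i - z i))"
proof -
  obtain a where a: "\<And>e. e > 0 \<Longrightarrow> \<forall>\<^sub>F w in at z within W.
    cmod (f w - f z - (\<Sum>i<n. a i * (w i - z i))) \<le> e * (\<Sum>i<n. cmod (w i - z i))"
    using assms unfolding cdiff_def by blast
  define B where "B = 1 + (\<Sum>i<n. cmod (a i))"
  show ?thesis
  proof
    show "B \<ge> 0" by (simp add: B_def sum_nonneg add_nonneg_nonneg)
    show "\<forall>\<^sub>F w in at z within W. cmod (f w - f z) \<le> B * (\<Sum>i<n. cmod (w i - z i))"
      using a[of 1, simplified]
    proof eventually_elim
      case (elim w)
      let ?N = "\<Sum>i<n. cmod (w i - z i)"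
      have "cmod (\<Sum>i<n. a i * (w i - z i)) \<le> (\<Sum>i<n. cmod (a i) * ?N)"
      proof (rule sum_norm_le)
        fix i assume "i \<in> {..<n}"
        then have "cmod (w i - z i) \<le> ?N" by (intro member_le_sum) auto
        then show "cmod (a i * (w i - z i)) \<le> cmod (a i) * ?N"
          by (simp add: norm_mult mult_left_mono)
      qed
      then have "cmod (\<Sum>i<n. a i * (w i - z i)) \<le> (\<Sum>i<n. cmod (a i)) * ?N"
        by (simp add: sum_distrib_right)
      then show ?case using elim norm_triangle_sub[of "f w - f z" "\<Sum>i<n. a i * (w i - z i)"]
        by (simp add: B_def algebra_simps)
    qed
  qed
qed

lemma cdiff_tendsto:
  assumes "cdiff n f W z"
  shows "(f \<longlongrightarrow> f z) (at z within W)"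
proof -
  obtain B where B: "\<forall>\<^sub>F w in at z within W. cmod (f w - f z) \<le> B * (\<Sum>i<n. cmod (w i - z i))"
    using cdiff_lipschitz[OF assms] by blast
  have "((\<lambda>w. B * (\<Sum>i<n. cmod (w i - z i))) \<longlongrightarrow> B * (\<Sum>i<n. cmod (z i - z i))) (at z within W)"
    by (intro tendsto_intros tendsto_fun_apply)
  then have "((\<lambda>w. B * (\<Sum>i<n. cmod (w i - z i))) \<longlongrightarrow> 0) (at z within W)" by simp
  then have "((\<lambda>w. f w - f z) \<longlongrightarrow> 0) (at z within W)"
    by (rule Lim_null_comparison[OF B])
  then show ?thesis by (simp add: LIM_zero_iff)
qed

text \<open>Chain rule: the error of \<open>g\<close> at \<open>F w\<close> becomes an error in
  \<open>w\<close> through Lipschitz bounds on the components of \<open>F\<close>, and the linear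
  part is the matrix product. Since \<open>V\<close> lies in C^m, the components of \<open>F\<close>
  from \<open>m\<close> on vanish, which gives continuity of \<open>F\<close> at \<open>z\<close> in
  the product topology.\<close>

lemma cdiff_compose:
  assumes g: "cdiff m g V (F z)" and F: "\<And>i. i < m \<Longrightarrow> cdiff n (\<lambda>w. F w i) W z"
    and FV: "\<And>w. w \<in> W \<Longrightarrow> F w \<in> V" and zW: "z \<in> W" and V: "V \<subseteq> topspace (complex_space m)"
  shows "cdiff n (\<lambda>w. g (F w)) W z"
proof -
  obtain a where a: "\<And>e. e > 0 \<Longrightarrow> \<forall>\<^sub>F v in at (F z) within V.
    cmod (g v - g (F z) - (\<Sum>i<m. a i * (v i - F z i))) \<le> e * (\<Sum>i<m. cmod (v i - F z i))"
    using g unfolding cdiff_def by blast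
  have "\<forall>i. \<exists>b. i < m \<longrightarrow> (\<forall>e>0. \<forall>\<^sub>F w in at z within W.
    cmod (F w i - F z i - (\<Sum>j<n. b j * (w j - z j))) \<le> e * (\<Sum>j<n. cmod (w j - z j)))"
    using F unfolding cdiff_def by blast
  from choice[OF this] obtain b where b: "\<And>i e. i < m \<Longrightarrow> e > 0 \<Longrightarrow> \<forall>\<^sub>F w in at z within W.
    cmod (F w i - F z i - (\<Sum>j<n. b i j * (w j - z j))) \<le> e * (\<Sum>j<n. cmod (w j - z j))"
    by blast
  have "\<exists>B. B \<ge> 0 \<and> (i < m \<longrightarrow> (\<forall>\<^sub>F w in at z within W. cmod (F w i - F z i) \<le> B * (\<Sum>j<n. cmod (w j - z j))))" for i
  proof (cases "i < m")
    case True
    then show ?thesis using cdiff_lipschitz[OF F[OF True]] by blast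
  qed (auto intro: exI[of _ 0])
  then have "\<forall>i. \<exists>B. B \<ge> 0 \<and> (i < m \<longrightarrow> (\<forall>\<^sub>F w in at z within W. cmod (F w i - F z i) \<le> B * (\<Sum>j<n. cmod (w j - z j))))"
    by blast
  from choice[OF this] obtain B where B0: "\<And>i. B i \<ge> 0" and B: "\<And>i. i < m \<Longrightarrow>
      \<forall>\<^sub>F w in at z within W. cmod (F w i - F z i) \<le> B i * (\<Sum>j<n. cmod (w j - z j))"
    by blast
  have inW: "\<forall>\<^sub>F w in at z within W. w \<in> W"
    by (auto simp: eventually_at_topological)
  have "(F \<longlongrightarrow> F z) (at z within W)"
  proof (rule tendsto_funI)
    fix i
    show "((\<lambda>w. F w i) \<longlongrightarrow> F z i) (at z within W)"
    proof (cases "i < m")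
      case True then show ?thesis by (rule cdiff_tendsto[OF F])
    next
      case False
      then have zero: "F w i = 0" if "w \<in> W" for w
        using FV[OF that] V by auto
      have "\<forall>\<^sub>F w in at z within W. F w i = F z i"
        using inW by eventually_elim (simp add: zero zW)
      then show ?thesis by (rule tendsto_eventually)
    qed
  qed
  note Ftend = this
  show ?thesis unfolding cdiff_def
  proof (intro exI allI impI)
    fix e :: real assume "e > 0"
    let ?N = "\<lambda>w. \<Sum>j<n. cmod (w j - z j)"
    define SB where "SB = (\<Sum>i<m. B i)"
    define SA where "SA = (\<Sum>i<m. cmod (a i))"
    have SB: "SB \<ge> 0" and SA: "SA \<ge> 0" using B0 by (auto simp: SB_def SA_def sum_nonneg)
    \<comment> \<open>\<open>e1\<close> bounds the error of \<open>g\<close>, later multiplied by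
      the Lipschitz constants \<open>SB\<close>; \<open>e2\<close> bounds the errors of
      \<open>F\<close>, later multiplied by the coefficients \<open>SA\<close>. Each product is at
      most \<open>e / 2\<close>.\<close>
    define e1 where "e1 = e / (2 * (SB + 1))"
    define e2 where "e2 = e / (2 * (SA + 1))"
    have "e1 > 0" "e2 > 0" using SA SB \<open>e > 0\<close> by (auto simp: e1_def e2_def)
    have e12: "e1 * SB + SA * e2 \<le> e"
    proof -
      have "e1 * SB \<le> e / 2" "SA * e2 \<le> e / 2"
        using SA SB \<open>e > 0\<close> by (auto simp: e1_def e2_def field_simps)
      then show ?thesis by simp
    qed
    obtain O' where O': "open O'" "F z \<in> O'" "\<And>v. v \<in> O' \<Longrightarrow> v \<noteq> F z \<Longrightarrow> v \<in> V \<Longrightarrow>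
      cmod (g v - g (F z) - (\<Sum>i<m. a i * (v i - F z i))) \<le> e1 * (\<Sum>i<m. cmod (v i - F z i))"
      using a[OF \<open>e1 > 0\<close>] unfolding eventually_at_topological by blast
    have ev1: "\<forall>\<^sub>F w in at z within W. F w \<in> O'"
      using topological_tendstoD[OF Ftend] O' by blast
    have ev2: "\<forall>\<^sub>F w in at z within W. \<forall>i\<in>{..<m}. cmod (F w i - F z i) \<le> B i * ?N w"
      by (intro eventually_ball_finite) (use B in auto)
    have ev3: "\<forall>\<^sub>F w in at z within W. \<forall>i\<in>{..<m}.
        cmod (F w i - F z i - (\<Sum>j<n. b i j * (w j - z j))) \<le> e2 * ?N w"
      by (intro eventually_ball_finite) (use b \<open>e2 > 0\<close> in auto)
    show "\<forall>\<^sub>F w in at z within W. cmod (g (F w) - g (F z) -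
        (\<Sum>j<n. (\<Sum>i<m. a i * b i j) * (w j - z j))) \<le> e * ?N w"
      using ev1 ev2 ev3 inW
    proof eventually_elim
      case (elim w)
      have Npos: "?N w \<ge> 0" by (simp add: sum_nonneg)
      \<comment> \<open>The filter at \<open>F z\<close> is punctured, so the case
        \<open>F w = F z\<close> is separate; there both sides are zero.\<close>
      have 1: "cmod (g (F w) - g (F z) - (\<Sum>i<m. a i * (F w i - F z i))) \<le> e1 * (\<Sum>i<m. cmod (F w i - F z i))"
        using O'(3)[of "F w"] elim FV by (cases "F w = F z") auto
      have "(\<Sum>i<m. cmod (F w i - F z i)) \<le> (\<Sum>i<m. B i * ?N w)"
        using elim by (intro sum_mono) auto
      also have "\<dots> = SB * ?N w" by (simp add: SB_def sum_distrib_right)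
      finally have 2: "e1 * (\<Sum>i<m. cmod (F w i - F z i)) \<le> e1 * (SB * ?N w)"
        using \<open>e1 > 0\<close> by simp
      have "cmod (\<Sum>i<m. a i * (F w i - F z i - (\<Sum>j<n. b i j * (w j - z j)))) \<le> (\<Sum>i<m. cmod (a i) * (e2 * ?N w))"
        using elim by (intro sum_norm_le) (auto simp: norm_mult intro!: mult_left_mono)
      also have "\<dots> = SA * (e2 * ?N w)" by (simp add: SA_def sum_distrib_right)
      finally have 3: "cmod (\<Sum>i<m. a i * (F w i - F z i - (\<Sum>j<n. b i j * (w j - z j)))) \<le> SA * (e2 * ?N w)" .
      have "(\<Sum>j<n. (\<Sum>i<m. a i * b i j) * (w j - z j)) = (\<Sum>i<m. a i * (\<Sum>j<n. b i j * (w j - z j)))"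
        unfolding sum_distrib_right sum_distrib_left mult.assoc by (rule sum.swap)
      then have "g (F w) - g (F z) - (\<Sum>j<n. (\<Sum>i<m. a i * b i j) * (w j - z j)) =
        (g (F w) - g (F z) - (\<Sum>i<m. a i * (F w i - F z i))) +
        (\<Sum>i<m. a i * (F w i - F z i - (\<Sum>j<n. b i j * (w j - z j))))"
        by (simp add: right_diff_distrib sum_subtractf)
      then have "cmod (g (F w) - g (F z) - (\<Sum>j<n. (\<Sum>i<m. a i * b i j) * (w j - z j)))
        \<le> e1 * (SB * ?N w) + SA * (e2 * ?N w)"
        using 1 2 3 norm_triangle_ineq
        by (smt (verit, best))
      also have "\<dots> = (e1 * SB + SA * e2) * ?N w" by (simp add: algebra_simps)
      also have "\<dots> \<le> e * ?N w" using e12 Npos by (rule mult_right_mono)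
      finally show ?case .
    qed
  qed
qed

lemma cdiff_linear_combination:
  assumes "cdiff n f W z" "cdiff n g W z"
  shows "cdiff n (\<lambda>w. c * f w + d * g w) W z"
proof -
  define F :: "(nat \<Rightarrow> complex) \<Rightarrow> nat \<Rightarrow> complex" where "F = (\<lambda>w i. if i = 0 then f w else if i = 1 then g w else 0)"
  have lin: "cdiff 2 (\<lambda>v. c * v 0 + d * v 1) V v" for V and v :: "nat \<Rightarrow> complex"
    unfolding cdiff_def
    by (rule exI[of _ "\<lambda>i. if i = 0 then c else d"]) (simp add: numeral_2_eq_2 algebra_simps add_nonneg_nonneg)
  \<comment> \<open>The chain rule wants the base point in the set. Inserting \<open>z\<close>
    provides this and leaves the punctured filter unchanged.\<close>
  have "cdiff n (\<lambda>w. c * F w 0 + d * F w 1) (insert z W) z"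
  proof (rule cdiff_compose[where g = "\<lambda>v. c * v 0 + d * v 1" and m = 2 and V = "topspace (complex_space 2)"])
    show "cdiff n (\<lambda>w. F w i) (insert z W) z" if "i < 2" for i
      using assms that unfolding cdiff_def at_within_def by (auto simp: F_def less_2_cases_iff)
  qed (use lin in \<open>auto simp: F_def\<close>)
  then show ?thesis by (simp add: F_def cdiff_def at_within_def)
qed

lemma cdiff_add: "cdiff n f W z \<Longrightarrow> cdiff n g W z \<Longrightarrow> cdiff n (\<lambda>w. f w + g w) W z"
  using cdiff_linear_combination[of n f W z g 1 1] by simp

lemma cdiff_diff: "cdiff n f W z \<Longrightarrow> cdiff n g W z \<Longrightarrow> cdiff n (\<lambda>w. f w - g w) W z"
  using cdiff_linear_combination[of n f W z g 1 "-1"] by simp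

text \<open>The one-variable function \<open>g\<close> is read as a function of coordinate 0 on C^1,
  so that the chain rule applies.\<close>

lemma cdiff_has_field_derivative_compose:
  assumes f: "cdiff n f W z" and g: "(g has_field_derivative g') (at (f z))"
  shows "cdiff n (\<lambda>w. g (f w)) W z"
proof -
  define F :: "(nat \<Rightarrow> complex) \<Rightarrow> nat \<Rightarrow> complex" where "F = (\<lambda>w i. if i = 0 then f w else 0)"
  define V :: "(nat \<Rightarrow> complex) set" where "V = topspace (complex_space 1)"
  have "cdiff 1 (\<lambda>v. g (v 0)) V (F z)" unfolding cdiff_def
  proof (intro exI allI impI)
    fix e :: real assume "e > 0"
    have "((\<lambda>y. (g y - g (f z)) / (y - f z)) \<longlongrightarrow> g') (at (f z))"
      using g by (simp add: has_field_derivative_iff)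
    then have "\<forall>\<^sub>F y in at (f z). dist ((g y - g (f z)) / (y - f z)) g' < e"
      using \<open>e > 0\<close> by (rule tendstoD)
    then have "\<forall>\<^sub>F y in nhds (f z). y \<noteq> f z \<longrightarrow> dist ((g y - g (f z)) / (y - f z)) g' < e"
      by (simp add: eventually_at_filter)
    then have "\<forall>\<^sub>F y in nhds (f z). norm (g y - g (f z) - g' * (y - f z)) \<le> e * norm (y - f z)"
    proof eventually_elim
      case (elim y)
      show ?case
      proof (cases "y = f z")
        case False
        have "g y - g (f z) - g' * (y - f z) = ((g y - g (f z)) / (y - f z) - g') * (y - f z)"
          using False by (subst left_diff_distrib) simp
        then have "norm (g y - g (f z) - g' * (y - f z)) = norm ((g y - g (f z)) / (y - f z) - g') * norm (y - f z)"
          by (simp add: norm_mult)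
        also have "\<dots> \<le> e * norm (y - f z)"
          using elim False by (intro mult_right_mono) (auto simp: dist_norm)
        finally show ?thesis .
      qed auto
    qed
    moreover have "((\<lambda>v. v 0) \<longlongrightarrow> f z) (at (F z) within V)"
      using tendsto_fun_apply[of 0 "F z" V] by (simp add: F_def)
    ultimately have "\<forall>\<^sub>F v in at (F z) within V. norm (g (v 0) - g (f z) - g' * (v 0 - f z)) \<le> e * norm (v 0 - f z)"
      by (rule eventually_compose_filterlim)
    then show "\<forall>\<^sub>F v in at (F z) within V. cmod (g (v 0) - g (F z 0) -
        (\<Sum>i<1. g' * (v i - F z i))) \<le> e * (\<Sum>i<1. cmod (v i - F z i))"
      by (simp add: F_def)
  qed
  then have "cdiff n (\<lambda>w. g (F w 0)) (insert z W) z"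
  proof (rule cdiff_compose)
    show "cdiff n (\<lambda>w. F w i) (insert z W) z" if "i < 1" for i
      using f that unfolding cdiff_def at_within_def by (auto simp: F_def)
  qed (auto simp: F_def V_def)
  then show ?thesis by (simp add: F_def cdiff_def at_within_def)
qed

section \<open>Charts, holomorphic maps and holomorphic functions\<close>

lemma holomorphic_Cn_subset:
  assumes "holomorphic_Cn n f W" "W' \<subseteq> W"
  shows "holomorphic_Cn n f W'"
  using assms unfolding holomorphic_Cn_def by (meson subsetD tendsto_within_subset)

lemma holomorphic_Cn_cong:
  assumes "holomorphic_Cn n f W" "\<And>w. w \<in> W \<Longrightarrow> f w = g w"
  shows "holomorphic_Cn n g W"
  unfolding holomorphic_Cn_def
proof
  fix z assume z: "z \<in> W"
  then obtain a where "((\<lambda>w. (f w - f z - (\<Sum>i<n. a i * (w i - z i)))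
              / complex_of_real (L2_set (\<lambda>i. cmod (w i - z i)) {..<n})) \<longlongrightarrow> 0) (at z within W)"
    using assms(1) unfolding holomorphic_Cn_def by blast
  then have "((\<lambda>w. (g w - g z - (\<Sum>i<n. a i * (w i - z i)))
              / complex_of_real (L2_set (\<lambda>i. cmod (w i - z i)) {..<n})) \<longlongrightarrow> 0) (at z within W)"
    by (rule Lim_cong_within[THEN iffD1, rotated -1]) (use assms(2) z in auto)
  then show "\<exists>a. ((\<lambda>w. (g w - g z - (\<Sum>i<n. a i * (w i - z i)))
              / complex_of_real (L2_set (\<lambda>i. cmod (w i - z i)) {..<n})) \<longlongrightarrow> 0) (at z within W)"
    by blast
qed

text \<open>The continuous inverse of a chart is identified with \<open>inv_into U \<phi>\<close>,
  the form in which all notions of holomorphy are written.\<close>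

lemma is_chartD:
  assumes "is_chart X (n, U, \<phi>)"
  shows "openin X U" "inj_on \<phi> U" "\<phi> ` U \<subseteq> topspace (complex_space n)"
    "openin (complex_space n) (\<phi> ` U)"
    "continuous_map (subtopology X U) (complex_space n) \<phi>"
    "\<And>A. openin X A \<Longrightarrow> A \<subseteq> U \<Longrightarrow> openin (complex_space n) (\<phi> ` A)"
    "continuous_map (subtopology (complex_space n) (\<phi> ` U)) (subtopology X U) (inv_into U \<phi>)"
proof -
  have U: "openin X U" and im: "openin (complex_space n) (\<phi> ` U)"
    and hom: "homeomorphic_map (subtopology X U) (subtopology (complex_space n) (\<phi> ` U)) \<phi>"
    using assms by (auto simp: is_chart_def)
  have top: "topspace (subtopology X U) = U"
    using openin_subset[OF U] by auto
  show "openin X U" "openin (complex_space n) (\<phi> ` U)" by fact+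
  show "\<phi> ` U \<subseteq> topspace (complex_space n)" using openin_subset[OF im] .
  show inj: "inj_on \<phi> U"
    using homeomorphic_imp_injective_map[OF hom] top by simp
  show "continuous_map (subtopology X U) (complex_space n) \<phi>"
    using homeomorphic_imp_continuous_map[OF hom] continuous_map_in_subtopology by blast
  show "openin (complex_space n) (\<phi> ` A)" if "openin X A" "A \<subseteq> U" for A
  proof -
    have "openin (subtopology X U) A"
      using that by (metis openin_subset_topspace_eq openin_subtopology inf.absorb1)
    then have "openin (subtopology (complex_space n) (\<phi> ` U)) (\<phi> ` A)"
      using homeomorphic_imp_open_map[OF hom] by (simp add: open_map_def)
    then show ?thesis using im openin_trans_full by blast
  qed
  obtain g where g: "homeomorphic_maps (subtopology X U) (subtopology (complex_space n) (\<phi> ` U)) \<phi> g"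
    using hom homeomorphic_map_maps by blast
  then have "continuous_map (subtopology (complex_space n) (\<phi> ` U)) (subtopology X U) g"
    by (simp add: homeomorphic_maps_def)
  moreover have "g z = inv_into U \<phi> z" if "z \<in> topspace (subtopology (complex_space n) (\<phi> ` U))" for z
  proof -
    have "z \<in> \<phi> ` U" using that by auto
    then obtain x where x: "x \<in> U" "z = \<phi> x" by blast
    then have "g z = x" using g top by (auto simp: homeomorphic_maps_def)
    then show ?thesis using x inj by simp
  qed
  ultimately show "continuous_map (subtopology (complex_space n) (\<phi> ` U)) (subtopology X U) (inv_into U \<phi>)"
    using continuous_map_eq by blast
qed

lemma is_chartI:
  assumes "openin X U" "openin (complex_space n) (\<phi> ` U)"
    "continuous_map (subtopology X U) (complex_space n) \<phi>"
    "continuous_map (subtopology (complex_space n) (\<phi> ` U)) X g"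
    "\<And>x. x \<in> U \<Longrightarrow> g (\<phi> x) = x"
  shows "is_chart X (n, U, \<phi>)"
proof -
  have "homeomorphic_maps (subtopology X U) (subtopology (complex_space n) (\<phi> ` U)) \<phi> g"
    unfolding homeomorphic_maps_def
    using assms by (auto simp: continuous_map_in_subtopology)
  then show ?thesis
    using assms(1,2) unfolding is_chart_def by (auto simp: homeomorphic_map_maps)
qed

lemma is_chart_restrict:
  assumes "is_chart X (n, U, \<phi>)" "openin X A"
  shows "is_chart X (n, U \<inter> A, \<phi>)"
proof (rule is_chartI[where g = "inv_into U \<phi>"])
  note c = is_chartD[OF assms(1)]
  show op: "openin X (U \<inter> A)" using c(1) assms(2) by blast
  show "openin (complex_space n) (\<phi> ` (U \<inter> A))" by (rule c(6)[OF op]) auto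
  show "continuous_map (subtopology X (U \<inter> A)) (complex_space n) \<phi>"
    using continuous_map_from_subtopology[OF c(5), of A] by (simp add: subtopology_subtopology)
  have "continuous_map (subtopology (complex_space n) (\<phi> ` U)) X (inv_into U \<phi>)"
    using c(7) continuous_map_in_subtopology by blast
  then show "continuous_map (subtopology (complex_space n) (\<phi> ` (U \<inter> A))) X (inv_into U \<phi>)"
    by (rule continuous_map_from_subtopology_mono) auto
  show "inv_into U \<phi> (\<phi> x) = x" if "x \<in> U \<inter> A" for x
    using that c(2) by simp
qed

lemma inv_into_restrict:
  assumes "inj_on \<phi> U" "z \<in> \<phi> ` (U \<inter> A)"
  shows "inv_into (U \<inter> A) \<phi> z = inv_into U \<phi> z"
proof -
  obtain x where "x \<in> U" "x \<in> A" "z = \<phi> x" using assms(2) by blast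
  moreover have "inj_on \<phi> (U \<inter> A)" using assms(1) by (auto intro: inj_on_subset)
  ultimately show ?thesis using assms(1) by (simp add: inv_into_f_f)
qed

text \<open>The common core of composing maps, changing charts (with \<open>f\<close> the identity)
  and passing from an atlas to the maximal atlas. Differentiability is local, so each point may use
  its own chart from \<open>A\<close> around its image; \<open>G\<close> is an arbitrary function on
  the target, considered on \<open>D\<close>.\<close>

lemma holomorphic_Cn_compose_chart:
  assumes c: "is_chart TM (n, U, \<phi>)" and f: "continuous_map TM TN f"
    and A: "\<And>m V \<psi>. (m, V, \<psi>) \<in> A \<Longrightarrow> is_chart TN (m, V, \<psi>)"
    and cover: "\<And>x. x \<in> U \<Longrightarrow> f x \<in> D \<Longrightarrow> \<exists>m V \<psi>. (m, V, \<psi>) \<in> A \<and> f x \<in> V"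
    and fA: "\<And>m V \<psi> i. (m, V, \<psi>) \<in> A \<Longrightarrow> i < m \<Longrightarrow>
      holomorphic_Cn n (\<lambda>z. \<psi> (f (inv_into U \<phi> z)) i) (\<phi> ` (U \<inter> f -` V))"
    and G: "\<And>m V \<psi>. (m, V, \<psi>) \<in> A \<Longrightarrow> holomorphic_Cn m (\<lambda>z. G (inv_into V \<psi> z)) (\<psi> ` (V \<inter> D))"
  shows "holomorphic_Cn n (\<lambda>z. G (f (inv_into U \<phi> z))) (\<phi> ` (U \<inter> f -` D))"
proof -
  note cD = is_chartD[OF c]
  let ?W = "\<phi> ` (U \<inter> f -` D)"
  have W: "?W \<subseteq> topspace (complex_space n)" using cD(3) by blast
  have "cdiff n (\<lambda>z. G (f (inv_into U \<phi> z))) ?W z" if "z \<in> ?W" for z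
  proof -
    obtain x where x: "x \<in> U" "f x \<in> D" "z = \<phi> x" using \<open>z \<in> ?W\<close> by blast
    obtain m V \<psi> where V: "(m, V, \<psi>) \<in> A" "f x \<in> V" using cover x by blast
    note vD = is_chartD[OF A[OF V(1)]]
    have "openin TM {x \<in> topspace TM. f x \<in> V}"
      using f vD(1) openin_continuous_map_preimage by blast
    then have "openin TM (U \<inter> {x \<in> topspace TM. f x \<in> V})" using cD(1) by blast
    moreover have "U \<inter> {x \<in> topspace TM. f x \<in> V} = U \<inter> f -` V"
      using openin_subset[OF cD(1)] by auto
    ultimately have "openin (complex_space n) (\<phi> ` (U \<inter> f -` V))" using cD(6) by auto
    then obtain O' where O': "open O'" "\<phi> ` (U \<inter> f -` V) = topspace (complex_space n) \<inter> O'"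
      by (auto simp: complex_space_eq openin_open)
    have zO: "z \<in> O'" using O'(2) x V by blast
    have WO: "?W \<inter> O' = \<phi> ` (U \<inter> f -` (D \<inter> V))"
    proof -
      have "?W \<inter> O' = ?W \<inter> \<phi> ` (U \<inter> f -` V)" using W O'(2) by blast
      also have "\<dots> = \<phi> ` ((U \<inter> f -` D) \<inter> (U \<inter> f -` V))"
        by (rule inj_on_image_Int[symmetric, OF cD(2)]) auto
      finally show ?thesis by (simp add: Int_ac vimage_Int)
    qed
    let ?F = "\<lambda>z. \<psi> (f (inv_into U \<phi> z))"
    have Fin: "?F w \<in> \<psi> ` (V \<inter> D)" if "w \<in> ?W \<inter> O'" for w
      using that cD(2) unfolding WO by auto
    have VD: "\<psi> ` (V \<inter> D) \<subseteq> topspace (complex_space m)" using vD(3) by blast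
    have "cdiff n (\<lambda>w. (\<lambda>v. G (inv_into V \<psi> v)) (?F w)) (?W \<inter> O') z"
    proof (rule cdiff_compose[where g = "\<lambda>v. G (inv_into V \<psi> v)" and F = ?F and V = "\<psi> ` (V \<inter> D)"])
      show "cdiff m (\<lambda>v. G (inv_into V \<psi> v)) (\<psi> ` (V \<inter> D)) (?F z)"
        using G[OF V(1)] Fin[of z] \<open>z \<in> ?W\<close> zO unfolding holomorphic_Cn_iff_cdiff[OF VD] by blast
      show "cdiff n (\<lambda>w. ?F w i) (?W \<inter> O') z" if "i < m" for i
      proof -
        have "\<phi> ` (U \<inter> f -` V) \<subseteq> topspace (complex_space n)" using cD(3) by blast
        then have "cdiff n (\<lambda>w. ?F w i) (\<phi> ` (U \<inter> f -` V)) z"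
          using fA[OF V(1) that] holomorphic_Cn_iff_cdiff x V by auto
        then show ?thesis by (rule cdiff_mono) (use WO in auto)
      qed
    qed (use Fin VD zO \<open>z \<in> ?W\<close> in auto)
    then have "cdiff n (\<lambda>z. G (f (inv_into U \<phi> z))) (?W \<inter> O') z"
    proof (rule cdiff_cong)
      show "z \<in> ?W \<inter> O'" using zO \<open>z \<in> ?W\<close> by blast
      show "G (inv_into V \<psi> (?F w)) = G (f (inv_into U \<phi> w))" if "w \<in> ?W \<inter> O'" for w
        using that cD(2) vD(2) unfolding WO by auto
    qed
    then show ?thesis using O'(1) zO by (rule cdiff_local)
  qed
  then show ?thesis using holomorphic_Cn_iff_cdiff[OF W] by blast
qed

lemma holomorphic_mapD:
  assumes "holomorphic_map M N f"
  shows "continuous_map (mtop M) (mtop N) f"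
    "\<And>n U \<phi> m V \<psi> i. (n, U, \<phi>) \<in> atlas M \<Longrightarrow> (m, V, \<psi>) \<in> atlas N \<Longrightarrow> i < m \<Longrightarrow>
      holomorphic_Cn n (\<lambda>z. \<psi> (f (inv_into U \<phi> z)) i) (\<phi> ` (U \<inter> f -` V))"
  using assms unfolding holomorphic_map_def by fast+

text \<open>Only charts and a cover of the middle space are assumed, so the lemma applies to
  \<open>induced\<close> structures without a proof that these are complex manifolds.\<close>

lemma holomorphic_map_compose:
  assumes M: "\<And>c. c \<in> atlas M \<Longrightarrow> is_chart (mtop M) c" and N: "\<And>c. c \<in> atlas N \<Longrightarrow> is_chart (mtop N) c"
    and cov: "topspace (mtop N) \<subseteq> (\<Union>(n, U, \<phi>)\<in>atlas N. U)"
    and f: "holomorphic_map M N f" and g: "holomorphic_map N L g"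
  shows "holomorphic_map M L (\<lambda>x. g (f x))"
proof -
  have fc: "continuous_map (mtop M) (mtop N) f" and gc: "continuous_map (mtop N) (mtop L) g"
    using f g by (auto simp: holomorphic_map_def)
  have fx: "\<exists>m V \<psi>. (m, V, \<psi>) \<in> atlas N \<and> f x \<in> V" if "(n, U, \<phi>) \<in> atlas M" "x \<in> U" for n U \<phi> x
  proof -
    have "x \<in> topspace (mtop M)"
      using that is_chartD(1)[OF M[OF that(1)]] openin_subset by blast
    then have "f x \<in> topspace (mtop N)" using fc by (auto simp: continuous_map_def)
    then show ?thesis using cov by blast
  qed
  have "holomorphic_Cn n (\<lambda>z. \<psi> (g (f (inv_into U \<phi> z))) i) (\<phi> ` (U \<inter> (\<lambda>x. g (f x)) -` V))"
    if "(n, U, \<phi>) \<in> atlas M" "(m, V, \<psi>) \<in> atlas L" "i < m" for n U \<phi> m V \<psi> i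
  proof -
    have "holomorphic_Cn n (\<lambda>z. (\<lambda>y. \<psi> (g y) i) (f (inv_into U \<phi> z))) (\<phi> ` (U \<inter> f -` (g -` V)))"
    proof (rule holomorphic_Cn_compose_chart[where A = "atlas N", OF M[OF that(1)] fc N])
      show "\<exists>m V \<psi>. (m, V, \<psi>) \<in> atlas N \<and> f x \<in> V" if "x \<in> U" for x
        using fx[OF \<open>(n, U, \<phi>) \<in> atlas M\<close> that] .
      show "holomorphic_Cn n (\<lambda>z. \<psi>' (f (inv_into U \<phi> z)) j) (\<phi> ` (U \<inter> f -` V'))"
        if "(m', V', \<psi>') \<in> atlas N" "j < m'" for m' V' \<psi>' j
        by (rule holomorphic_mapD(2)[OF f \<open>(n, U, \<phi>) \<in> atlas M\<close> that])
      show "holomorphic_Cn m' (\<lambda>z. \<psi> (g (inv_into V' \<psi>' z)) i) (\<psi>' ` (V' \<inter> g -` V))"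
        if "(m', V', \<psi>') \<in> atlas N" for m' V' \<psi>'
        by (rule holomorphic_mapD(2)[OF g that \<open>(m, V, \<psi>) \<in> atlas L\<close> \<open>i < m\<close>])
    qed
    then show ?thesis by (simp add: vimage_def)
  qed
  then show ?thesis using continuous_map_compose[OF fc gc] unfolding holomorphic_map_def
    by (auto simp: o_def)
qed

lemma complex_manifoldD:
  assumes "complex_manifold M"
  shows "Hausdorff_space (mtop M)" "second_countable (mtop M)"
    "\<And>c. c \<in> atlas M \<Longrightarrow> is_chart (mtop M) c"
    "topspace (mtop M) = (\<Union>(n, U, \<phi>)\<in>atlas M. U)"
    "\<And>c c'. c \<in> atlas M \<Longrightarrow> c' \<in> atlas M \<Longrightarrow> holomorphic_transition c c'"
    "\<And>x. x \<in> topspace (mtop M) \<Longrightarrow> \<exists>n U \<phi>. (n, U, \<phi>) \<in> atlas M \<and> x \<in> U"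
    "atlas M \<subseteq> maximal_atlas M"
proof -
  note M = assms[unfolded complex_manifold_def]
  show "Hausdorff_space (mtop M)" "second_countable (mtop M)" using M by simp_all
  show 1: "is_chart (mtop M) c" if "c \<in> atlas M" for c using M that by blast
  show 2: "topspace (mtop M) = (\<Union>(n, U, \<phi>)\<in>atlas M. U)" using M by simp
  show 3: "holomorphic_transition c c'" if "c \<in> atlas M" "c' \<in> atlas M" for c c'
    using M that by blast
  show "\<exists>n U \<phi>. (n, U, \<phi>) \<in> atlas M \<and> x \<in> U" if "x \<in> topspace (mtop M)" for x
    using that unfolding 2 by auto
  show "atlas M \<subseteq> maximal_atlas M"
    using 1 3 unfolding maximal_atlas_def by auto
qed

lemma maximal_atlasD:
  assumes "(n, U, \<phi>) \<in> maximal_atlas M"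
  shows "is_chart (mtop M) (n, U, \<phi>)"
    "\<And>m V \<psi> i. (m, V, \<psi>) \<in> atlas M \<Longrightarrow> i < m \<Longrightarrow> holomorphic_Cn n (\<lambda>z. \<psi> (inv_into U \<phi> z) i) (\<phi> ` (U \<inter> V))"
    "\<And>m V \<psi> i. (m, V, \<psi>) \<in> atlas M \<Longrightarrow> i < n \<Longrightarrow> holomorphic_Cn m (\<lambda>z. \<phi> (inv_into V \<psi> z) i) (\<psi> ` (V \<inter> U))"
  using assms unfolding maximal_atlas_def holomorphic_transition_def by fastforce+

text \<open>An atlas need not contain the restrictions of its charts; the maximal atlas does, and
  shrinking charts is essential for open subsets and for functions that are only locally
  defined.\<close>

lemma maximal_atlas_restrict:
  assumes "(n, U, \<phi>) \<in> maximal_atlas M" "openin (mtop M) A"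
  shows "(n, U \<inter> A, \<phi>) \<in> maximal_atlas M"
proof -
  note m = maximal_atlasD[OF assms(1)]
  note inj = is_chartD(2)[OF m(1)]
  have "holomorphic_Cn n (\<lambda>z. \<psi> (inv_into (U \<inter> A) \<phi> z) i) (\<phi> ` (U \<inter> A \<inter> V))"
    if "(m, V, \<psi>) \<in> atlas M" "i < m" for m V \<psi> i
  proof (rule holomorphic_Cn_cong)
    show "holomorphic_Cn n (\<lambda>z. \<psi> (inv_into U \<phi> z) i) (\<phi> ` (U \<inter> A \<inter> V))"
      by (rule holomorphic_Cn_subset[OF m(2)[OF that]]) auto
    show "\<psi> (inv_into U \<phi> w) i = \<psi> (inv_into (U \<inter> A) \<phi> w) i" if "w \<in> \<phi> ` (U \<inter> A \<inter> V)" for w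
      using inv_into_restrict[OF inj, of w A] that by auto
  qed
  moreover have "holomorphic_Cn m (\<lambda>z. \<phi> (inv_into V \<psi> z) i) (\<psi> ` (V \<inter> (U \<inter> A)))"
    if "(m, V, \<psi>) \<in> atlas M" "i < n" for m V \<psi> i
    by (rule holomorphic_Cn_subset[OF m(3)[OF that]]) auto
  moreover have "is_chart (mtop M) (n, U \<inter> A, \<phi>)"
    by (rule is_chart_restrict) fact+
  ultimately show ?thesis
    unfolding maximal_atlas_def holomorphic_transition_def by fastforce
qed

text \<open>Holomorphy on a part of the manifold is expressed in charts of the whole, which avoids
  the induced structure; the maximal atlas makes shrunken charts available at once.\<close>

definition hol_fun_on :: "'a cmanifold \<Rightarrow> 'a set \<Rightarrow> ('a \<Rightarrow> complex) \<Rightarrow> bool"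
  where "hol_fun_on M D f \<longleftrightarrow> continuous_map (subtopology (mtop M) D) euclidean f \<and>
    (\<forall>(n, U, \<phi>)\<in>maximal_atlas M. holomorphic_Cn n (\<lambda>z. f (inv_into U \<phi> z)) (\<phi> ` (U \<inter> D)))"

lemma hol_fun_on_subset:
  assumes "hol_fun_on M D f" "D' \<subseteq> D"
  shows "hol_fun_on M D' f"
proof -
  have "continuous_map (subtopology (mtop M) D') euclidean f"
    using assms continuous_map_from_subtopology_mono unfolding hol_fun_on_def by blast
  moreover have "holomorphic_Cn n (\<lambda>z. f (inv_into U \<phi> z)) (\<phi> ` (U \<inter> D'))"
    if "(n, U, \<phi>) \<in> maximal_atlas M" for n U \<phi>
  proof (rule holomorphic_Cn_subset)
    show "holomorphic_Cn n (\<lambda>z. f (inv_into U \<phi> z)) (\<phi> ` (U \<inter> D))"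
      using assms that unfolding hol_fun_on_def by blast
  qed (use assms in auto)
  ultimately show ?thesis unfolding hol_fun_on_def by blast
qed

text \<open>A change of chart, that is, the composition lemma with the identity map, carries the
  condition from the atlas to the maximal atlas.\<close>

lemma hol_fun_onI:
  assumes "complex_manifold M" "continuous_map (subtopology (mtop M) D) euclidean f"
    and "\<And>n U \<phi>. (n, U, \<phi>) \<in> atlas M \<Longrightarrow> holomorphic_Cn n (\<lambda>z. f (inv_into U \<phi> z)) (\<phi> ` (U \<inter> D))"
  shows "hol_fun_on M D f"
  unfolding hol_fun_on_def
proof (intro conjI ballI, fact, clarify)
  fix n U \<phi> assume U: "(n, U, \<phi>) \<in> maximal_atlas M"
  note m = maximal_atlasD[OF U] and M = complex_manifoldD[OF assms(1)]
  have "holomorphic_Cn n (\<lambda>z. f (id (inv_into U \<phi> z))) (\<phi> ` (U \<inter> id -` D))"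
  proof (rule holomorphic_Cn_compose_chart[where A = "atlas M", OF m(1)])
    show "\<exists>m V \<psi>. (m, V, \<psi>) \<in> atlas M \<and> id x \<in> V" if "x \<in> U" for x
      using that M(6)[of x] openin_subset[OF is_chartD(1)[OF m(1)]] by auto
    show "continuous_map (mtop M) (mtop M) id" by (rule continuous_map_id)
    show "is_chart (mtop M) (m, V, \<psi>)" if "(m, V, \<psi>) \<in> atlas M" for m V \<psi>
      by (rule M(3)[OF that])
    show "holomorphic_Cn n (\<lambda>z. \<psi> (id (inv_into U \<phi> z)) i) (\<phi> ` (U \<inter> id -` V))"
      if "(m, V, \<psi>) \<in> atlas M" "i < m" for m V \<psi> i
      using m(2)[OF that] by simp
  qed (rule assms(3))
  then show "holomorphic_Cn n (\<lambda>z. f (inv_into U \<phi> z)) (\<phi> ` (U \<inter> D))" by simp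
qed

lemma holomorphic_function_imp_hol_fun_on:
  assumes "complex_manifold M" "holomorphic_function M f"
  shows "hol_fun_on M D f"
proof (rule hol_fun_onI[OF assms(1)])
  show "continuous_map (subtopology (mtop M) D) euclidean f"
    using assms(2) by (simp add: holomorphic_function_def continuous_map_from_subtopology)
  show "holomorphic_Cn n (\<lambda>z. f (inv_into U \<phi> z)) (\<phi> ` (U \<inter> D))" if "(n, U, \<phi>) \<in> atlas M" for n U \<phi>
    by (rule holomorphic_Cn_subset[of _ _ "\<phi> ` U"]) (use assms(2) that in \<open>auto simp: holomorphic_function_def\<close>)
qed

lemma hol_fun_on_imp_holomorphic_function:
  assumes "complex_manifold M" "hol_fun_on M UNIV f"
  shows "holomorphic_function M f"
proof -
  have "holomorphic_Cn n (\<lambda>z. f (inv_into U \<phi> z)) (\<phi> ` U)" if "(n, U, \<phi>) \<in> atlas M" for n U \<phi>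
  proof -
    have "(n, U, \<phi>) \<in> maximal_atlas M" using that complex_manifoldD(7)[OF assms(1)] by blast
    then have "holomorphic_Cn n (\<lambda>z. f (inv_into U \<phi> z)) (\<phi> ` (U \<inter> UNIV))"
      using assms(2) unfolding hol_fun_on_def by blast
    then show ?thesis by simp
  qed
  then show ?thesis using assms(2) by (auto simp: hol_fun_on_def holomorphic_function_def)
qed

lemma hol_fun_on_chart_coordinate:
  assumes "complex_manifold M" "(n, U, \<phi>) \<in> maximal_atlas M" "i < n"
  shows "hol_fun_on M U (\<lambda>x. \<phi> x i)"
proof (rule hol_fun_onI[OF assms(1)])
  note m = maximal_atlasD[OF assms(2)]
  have "continuous_map (subtopology (mtop M) U) (product_topology (\<lambda>_. euclidean) UNIV) \<phi>"
    using is_chartD(5)[OF m(1)] unfolding complex_space_def continuous_map_in_subtopology by blast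
  then show "continuous_map (subtopology (mtop M) U) euclidean (\<lambda>x. \<phi> x i)"
    by (simp add: continuous_map_componentwise_UNIV)
  show "holomorphic_Cn m (\<lambda>z. \<phi> (inv_into V \<psi> z) i) (\<psi> ` (V \<inter> U))" if "(m, V, \<psi>) \<in> atlas M" for m V \<psi>
    by (rule m(3)[OF that assms(3)])
qed

lemma hol_fun_on_cdiff:
  assumes "hol_fun_on M D f" "(n, U, \<phi>) \<in> maximal_atlas M" "z \<in> \<phi> ` (U \<inter> D)"
  shows "cdiff n (\<lambda>z. f (inv_into U \<phi> z)) (\<phi> ` (U \<inter> D)) z"
proof -
  have "\<phi> ` (U \<inter> D) \<subseteq> topspace (complex_space n)"
    using is_chartD(3)[OF maximal_atlasD(1)[OF assms(2)]] by blast
  then show ?thesis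
    using assms holomorphic_Cn_iff_cdiff unfolding hol_fun_on_def by blast
qed

lemma hol_fun_on_cdiffI:
  assumes "continuous_map (subtopology (mtop M) D) euclidean f"
    and "\<And>n U \<phi> z. (n, U, \<phi>) \<in> maximal_atlas M \<Longrightarrow> z \<in> \<phi> ` (U \<inter> D) \<Longrightarrow>
      cdiff n (\<lambda>z. f (inv_into U \<phi> z)) (\<phi> ` (U \<inter> D)) z"
  shows "hol_fun_on M D f"
proof -
  have "\<phi> ` (U \<inter> D) \<subseteq> topspace (complex_space n)" if "(n, U, \<phi>) \<in> maximal_atlas M" for n U \<phi>
    using is_chartD(3)[OF maximal_atlasD(1)[OF that]] by blast
  then show ?thesis
    using assms unfolding hol_fun_on_def by (auto simp: holomorphic_Cn_iff_cdiff)
qed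

lemma hol_fun_on_compose_holomorphic:
  assumes f: "hol_fun_on M D f" and g: "g holomorphic_on B" "open B"
    and fB: "\<And>x. x \<in> D \<Longrightarrow> f x \<in> B"
  shows "hol_fun_on M D (\<lambda>x. g (f x))"
proof (rule hol_fun_on_cdiffI)
  have "continuous_map (subtopology (mtop M) D) (top_of_set B) f"
    using f fB by (auto simp: hol_fun_on_def continuous_map_in_subtopology)
  moreover have "continuous_map (top_of_set B) euclidean g"
    using holomorphic_on_imp_continuous_on[OF g(1)] by simp
  ultimately show "continuous_map (subtopology (mtop M) D) euclidean (\<lambda>x. g (f x))"
    by (rule continuous_map_compose[unfolded o_def])
  fix n U \<phi> z assume U: "(n, U, \<phi>) \<in> maximal_atlas M" and z: "z \<in> \<phi> ` (U \<inter> D)"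
  have "inv_into U \<phi> z \<in> D"
    using z is_chartD(2)[OF maximal_atlasD(1)[OF U]] by auto
  then obtain g' where "(g has_field_derivative g') (at (f (inv_into U \<phi> z)))"
    using g fB holomorphic_on_open by metis
  then show "cdiff n (\<lambda>z. g (f (inv_into U \<phi> z))) (\<phi> ` (U \<inter> D)) z"
    by (rule cdiff_has_field_derivative_compose[OF hol_fun_on_cdiff[OF f U z]])
qed

lemma hol_fun_on_diff:
  assumes "hol_fun_on M D f" "hol_fun_on M D g"
  shows "hol_fun_on M D (\<lambda>x. f x - g x)"
proof (rule hol_fun_on_cdiffI)
  show "continuous_map (subtopology (mtop M) D) euclidean (\<lambda>x. f x - g x)"
    using assms by (auto simp: hol_fun_on_def intro!: continuous_map_diff)
  fix n U \<phi> z assume "(n, U, \<phi>) \<in> maximal_atlas M" "z \<in> \<phi> ` (U \<inter> D)"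
  then show "cdiff n (\<lambda>z. f (inv_into U \<phi> z) - g (inv_into U \<phi> z)) (\<phi> ` (U \<inter> D)) z"
    by (intro cdiff_diff hol_fun_on_cdiff[OF assms(1)] hol_fun_on_cdiff[OF assms(2)])
qed

text \<open>Two changes of chart, one on each side: the outer composition passes through atlas
  charts of \<open>N\<close>, the inner one, along the identity, through atlas charts of
  \<open>M\<close>.\<close>

lemma holomorphic_map_maximal_charts:
  assumes M: "complex_manifold M" and N: "complex_manifold N" and f: "holomorphic_map M N f"
    and U: "(n, U, \<phi>) \<in> maximal_atlas M" and V: "(m, V, \<psi>) \<in> maximal_atlas N" and i: "i < m"
  shows "holomorphic_Cn n (\<lambda>z. \<psi> (f (inv_into U \<phi> z)) i) (\<phi> ` (U \<inter> f -` V))"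
proof (rule holomorphic_Cn_compose_chart[where G = "\<lambda>y. \<psi> y i" and A = "atlas N"])
  note MD = complex_manifoldD[OF M] and ND = complex_manifoldD[OF N]
  note u = maximal_atlasD[OF U] and v = maximal_atlasD[OF V]
  have fc: "continuous_map (mtop M) (mtop N) f" using f by (simp add: holomorphic_map_def)
  show "is_chart (mtop M) (n, U, \<phi>)" by fact
  show "continuous_map (mtop M) (mtop N) f" by fact
  have UM: "U \<subseteq> topspace (mtop M)" using openin_subset[OF is_chartD(1)[OF u(1)]] .
  show "\<exists>m V \<psi>. (m, V, \<psi>) \<in> atlas N \<and> f x \<in> V" if "x \<in> U" for x
  proof (rule ND(6))
    show "f x \<in> topspace (mtop N)" using fc that UM by (auto simp: continuous_map_def)
  qed
  show "holomorphic_Cn m' (\<lambda>z. \<psi> (inv_into V' \<psi>' z) i) (\<psi>' ` (V' \<inter> V))"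
    if "(m', V', \<psi>') \<in> atlas N" for m' V' \<psi>'
    using v(3)[OF that i] .
  show "holomorphic_Cn n (\<lambda>z. \<psi>' (f (inv_into U \<phi> z)) j) (\<phi> ` (U \<inter> f -` V'))"
    if "(m', V', \<psi>') \<in> atlas N" "j < m'" for m' V' \<psi>' j
  proof -
    have "holomorphic_Cn n (\<lambda>z. \<psi>' (f (id (inv_into U \<phi> z))) j) (\<phi> ` (U \<inter> id -` (f -` V')))"
    proof (rule holomorphic_Cn_compose_chart[where G = "\<lambda>x. \<psi>' (f x) j" and A = "atlas M", OF u(1)])
      show "\<exists>m V \<psi>. (m, V, \<psi>) \<in> atlas M \<and> id x \<in> V" if "x \<in> U" for x
        using that MD(6)[of x] UM by auto
      show "continuous_map (mtop M) (mtop M) id" by (rule continuous_map_id)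
      show "is_chart (mtop M) (m, V, \<psi>)" if "(m, V, \<psi>) \<in> atlas M" for m V \<psi>
        by (rule MD(3)[OF that])
      show "holomorphic_Cn n (\<lambda>z. \<psi> (id (inv_into U \<phi> z)) i) (\<phi> ` (U \<inter> id -` V))"
        if "(m, V, \<psi>) \<in> atlas M" "i < m" for m V \<psi> i
        using u(2)[OF that] by simp
      show "holomorphic_Cn m (\<lambda>z. \<psi>' (f (inv_into V \<psi> z)) j) (\<psi> ` (V \<inter> f -` V'))"
        if "(m, V, \<psi>) \<in> atlas M" for m V \<psi>
        by (rule holomorphic_mapD(2)[OF f that \<open>(m', V', \<psi>') \<in> atlas N\<close> \<open>j < m'\<close>])
    qed
    then show ?thesis by simp
  qed
qed (rule complex_manifoldD(3)[OF N])

section \<open>Induced structures on submanifolds and open subsets\<close>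

lemma is_chart_induced:
  assumes "c \<in> atlas (induced M A)"
  shows "is_chart (mtop (induced M A)) c"
proof -
  obtain m n U \<phi> where c: "c = (m, U \<inter> A, \<phi>)" and U: "(n, U, \<phi>) \<in> maximal_atlas M" and "m \<le> n"
    and im: "\<phi> ` (U \<inter> A) = \<phi> ` U \<inter> topspace (complex_space m)"
    using assms by (auto simp: induced_def)
  note cD = is_chartD[OF maximal_atlasD(1)[OF U]]
  have sub: "topspace (complex_space m) \<subseteq> topspace (complex_space n)" using \<open>m \<le> n\<close> by auto
  \<comment> \<open>In the encoding by sequences C^m is literally a subspace of C^n, so the trace of
    an open subset of C^n is open in C^m.\<close>
  have cm: "complex_space m = subtopology (complex_space n) (topspace (complex_space m))"
    using sub by (simp add: complex_space_eq subtopology_subtopology Int_absorb1 del: topspace_complex_space)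
  have "is_chart (subtopology (mtop M) A) (m, U \<inter> A, \<phi>)"
  proof (rule is_chartI[where g = "inv_into U \<phi>"])
    show "openin (subtopology (mtop M) A) (U \<inter> A)"
      using cD(1) by (auto simp: openin_subtopology)
    show "openin (complex_space m) (\<phi> ` (U \<inter> A))"
      unfolding im using cD(4) by (subst cm) (auto simp: openin_subtopology simp del: topspace_complex_space)
    have "continuous_map (subtopology (mtop M) (U \<inter> A)) (complex_space n) \<phi>"
      by (rule continuous_map_from_subtopology_mono[OF cD(5)]) auto
    moreover have "\<phi> ` (U \<inter> A) \<subseteq> topspace (complex_space m)" using im by blast
    ultimately have "continuous_map (subtopology (mtop M) (U \<inter> A)) (complex_space m) \<phi>"
      by (subst cm) (auto simp: continuous_map_in_subtopology simp del: topspace_complex_space)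
    then show "continuous_map (subtopology (subtopology (mtop M) A) (U \<inter> A)) (complex_space m) \<phi>"
      by (simp add: subtopology_subtopology Int_commute Int_left_commute)
    have "continuous_map (subtopology (complex_space n) (\<phi> ` U)) (mtop M) (inv_into U \<phi>)"
      using cD(7) continuous_map_in_subtopology by blast
    then have "continuous_map (subtopology (complex_space n) (\<phi> ` (U \<inter> A))) (mtop M) (inv_into U \<phi>)"
      by (rule continuous_map_from_subtopology_mono) auto
    moreover have "subtopology (complex_space m) (\<phi> ` (U \<inter> A)) =
        subtopology (complex_space n) (topspace (complex_space m) \<inter> \<phi> ` (U \<inter> A))"
      by (subst cm) (simp only: subtopology_subtopology)
    moreover have "topspace (complex_space m) \<inter> \<phi> ` (U \<inter> A) = \<phi> ` (U \<inter> A)" using im by blast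
    moreover have "inv_into U \<phi> z \<in> A" if "z \<in> \<phi> ` (U \<inter> A)" for z
      using that cD(2) by auto
    ultimately show "continuous_map (subtopology (complex_space m) (\<phi> ` (U \<inter> A))) (subtopology (mtop M) A) (inv_into U \<phi>)"
      by (auto simp: continuous_map_in_subtopology)
    show "inv_into U \<phi> (\<phi> x) = x" if "x \<in> U \<inter> A" for x using that cD(2) by simp
  qed
  then show ?thesis by (simp add: c induced_def)
qed

text \<open>Once a chart is shrunk to lie inside the open set, the flattening condition holds
  trivially with \<open>m = n\<close>.\<close>

lemma induced_open_cover:
  assumes "complex_manifold M" "openin (mtop M) A"
  shows "topspace (mtop (induced M A)) \<subseteq> (\<Union>(n, U, \<phi>)\<in>atlas (induced M A). U)"
proof
  fix x assume "x \<in> topspace (mtop (induced M A))"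
  then have x: "x \<in> topspace (mtop M)" "x \<in> A" by (auto simp: induced_def)
  then obtain n U \<phi> where U: "(n, U, \<phi>) \<in> atlas M" "x \<in> U"
    using complex_manifoldD(6)[OF assms(1)] by blast
  then have "(n, U, \<phi>) \<in> maximal_atlas M" using complex_manifoldD(7)[OF assms(1)] by blast
  then have V: "(n, U \<inter> A, \<phi>) \<in> maximal_atlas M" using assms(2) by (rule maximal_atlas_restrict)
  then have "\<phi> ` (U \<inter> A \<inter> A) = \<phi> ` (U \<inter> A) \<inter> topspace (complex_space n)"
    using is_chartD(3)[OF maximal_atlasD(1)[OF V]] by auto
  then have "(n, U \<inter> A \<inter> A, \<phi>) \<in> atlas (induced M A)"
    using V unfolding induced_def by (simp del: topspace_complex_space) blast
  then show "x \<in> (\<Union>(n, U, \<phi>)\<in>atlas (induced M A). U)" by (rule UN_I) (use x U in auto)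
qed

text \<open>On the source side \<open>cdiff_restrict_dim\<close> drops the coordinates that vanish
  on \<open>A\<close>; on the target side the coordinates below \<open>m'\<close> are among those
  below \<open>n'\<close>.\<close>

lemma holomorphic_map_induced:
  assumes M: "complex_manifold M" and N: "complex_manifold N" and f: "holomorphic_map M N f"
    and AB: "\<And>x. x \<in> A \<Longrightarrow> f x \<in> B"
  shows "holomorphic_map (induced M A) (induced N B) f"
proof -
  have "continuous_map (mtop (induced M A)) (mtop (induced N B)) f"
    using holomorphic_mapD(1)[OF f] AB
    by (auto simp: induced_def continuous_map_in_subtopology continuous_map_from_subtopology)
  moreover have "holomorphic_Cn m (\<lambda>z. \<psi> (f (inv_into (U \<inter> A) \<phi> z)) i) (\<phi> ` (U \<inter> A \<inter> f -` (V \<inter> B)))"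
    if U: "(n, U, \<phi>) \<in> maximal_atlas M" "m \<le> n" "\<phi> ` (U \<inter> A) = \<phi> ` U \<inter> topspace (complex_space m)"
      and V: "(n', V, \<psi>) \<in> maximal_atlas N" "m' \<le> n'" "i < m'"
    for m n U \<phi> m' n' V \<psi> i
  proof -
    let ?W = "\<phi> ` (U \<inter> A \<inter> f -` (V \<inter> B))"
    note inj = is_chartD(2)[OF maximal_atlasD(1)[OF U(1)]]
    have W: "?W \<subseteq> topspace (complex_space m)" using U(3) by blast
    have W0: "\<phi> ` (U \<inter> f -` V) \<subseteq> topspace (complex_space n)"
      using is_chartD(3)[OF maximal_atlasD(1)[OF U(1)]] by blast
    have "holomorphic_Cn n (\<lambda>z. \<psi> (f (inv_into U \<phi> z)) i) (\<phi> ` (U \<inter> f -` V))"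
      by (rule holomorphic_map_maximal_charts[OF M N f U(1) V(1)]) (use V in simp)
    then have "cdiff n (\<lambda>z. \<psi> (f (inv_into U \<phi> z)) i) (\<phi> ` (U \<inter> f -` V)) z" if "z \<in> ?W" for z
      using holomorphic_Cn_iff_cdiff[OF W0] that by blast
    then have "cdiff m (\<lambda>z. \<psi> (f (inv_into U \<phi> z)) i) ?W z" if "z \<in> ?W" for z
      by (rule cdiff_restrict_dim) (use that W U in auto)
    then have "holomorphic_Cn m (\<lambda>z. \<psi> (f (inv_into U \<phi> z)) i) ?W"
      using holomorphic_Cn_iff_cdiff[OF W] by blast
    then show ?thesis
      by (rule holomorphic_Cn_cong) (use inv_into_restrict[OF inj] in auto)
  qed
  ultimately show ?thesis
    unfolding holomorphic_map_def by (auto simp: induced_def simp del: topspace_complex_space)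
qed

section \<open>Local compactness of complex manifolds\<close>

lemma locally_compact_complex_space: "locally_compact_space (complex_space n)"
  unfolding locally_compact_space_def
proof
  fix z assume z: "z \<in> topspace (complex_space n)"
  \<comment> \<open>Radius 0 from index \<open>n\<close> on pins those coordinates to 0, so the
    product of discs is compact by Tychonoff and lies in C^n.\<close>
  define K where "K = (\<Pi>\<^sub>E i\<in>UNIV. cball (z i) (if i < n then 1 else 0 :: real))"
  define B where "B = topspace (complex_space n) \<inter> (\<Inter>i\<in>{..<n}. {w. w i \<in> ball (z i) 1})"
  have "compactin (product_topology (\<lambda>_. euclidean) UNIV) K"
    unfolding K_def compactin_PiE by (intro disjI2 ballI) (simp only: compactin_euclidean_iff compact_cball)
  moreover have "K \<subseteq> topspace (complex_space n)"
  proof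
    fix w assume "w \<in> K"
    then have wi: "w i \<in> cball (z i) (if i < n then 1 else 0)" for i
      using PiE_mem[of w UNIV "\<lambda>i. cball (z i) (if i < n then 1 else 0)" i] by (simp add: K_def)
    have "w i = z i" if "i \<ge> n" for i using wi[of i] that by auto
    then show "w \<in> topspace (complex_space n)" using z by simp
  qed
  ultimately have "compactin (complex_space n) K"
    by (simp add: complex_space_def compactin_subtopology)
  moreover have "open (\<Inter>i\<in>{..<n}. {w. w i \<in> ball (z i) 1})"
  proof (intro open_INT ballI)
    fix i
    show "open {w. w i \<in> ball (z i) 1}"
      using open_vimage[OF open_ball continuous_on_product_coordinates[of i]] by (simp add: vimage_def)
  qed auto
  then have "openin (complex_space n) B"
    by (auto simp: B_def complex_space_eq openin_open_Int)
  moreover have "z \<in> B" using z by (auto simp: B_def)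
  moreover have "B \<subseteq> K"
  proof
    fix w assume w: "w \<in> B"
    have "w i \<in> cball (z i) (if i < n then 1 else 0)" for i
      using w z by (cases "i < n") (auto simp: B_def intro: less_imp_le)
    then show "w \<in> K" unfolding K_def by (intro PiE_I) auto
  qed
  ultimately show "\<exists>U K. openin (complex_space n) U \<and> compactin (complex_space n) K \<and> z \<in> U \<and> U \<subseteq> K"
    by blast
qed

lemma Hausdorff_complex_space: "Hausdorff_space (complex_space n)"
  by (simp add: complex_space_eq Hausdorff_space_subtopology)

lemma complex_manifold_locally_compact:
  assumes "complex_manifold M"
  shows "locally_compact_space (mtop M)"
  unfolding locally_compact_space_def
proof
  fix x assume "x \<in> topspace (mtop M)"
  then obtain n U \<phi> where U: "(n, U, \<phi>) \<in> atlas M" "x \<in> U"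
    using complex_manifoldD(6)[OF assms] by blast
  then have c: "is_chart (mtop M) (n, U, \<phi>)" using complex_manifoldD(3)[OF assms] by blast
  note cD = is_chartD[OF c]
  have "locally_compact_space (subtopology (complex_space n) (\<phi> ` U))"
    by (rule locally_compact_space_open_subset)
      (use Hausdorff_complex_space locally_compact_complex_space cD in auto)
  moreover have "(subtopology (mtop M) U) homeomorphic_space (subtopology (complex_space n) (\<phi> ` U))"
    using c homeomorphic_map_imp_homeomorphic_space unfolding is_chart_def by blast
  ultimately have "locally_compact_space (subtopology (mtop M) U)"
    using homeomorphic_locally_compact_space by blast
  moreover have "x \<in> topspace (subtopology (mtop M) U)"
    using U openin_subset[OF cD(1)] by auto
  ultimately obtain A K where "openin (subtopology (mtop M) U) A" "compactin (subtopology (mtop M) U) K" "x \<in> A" "A \<subseteq> K"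
    unfolding locally_compact_space_def by blast
  then show "\<exists>A K. openin (mtop M) A \<and> compactin (mtop M) K \<and> x \<in> A \<and> A \<subseteq> K"
    using openin_trans_full[OF _ cD(1)] by (auto simp: compactin_subtopology)
qed

section \<open>The product of a Stein manifold with complex Euclidean space\<close>

lemma second_countable_prod_topology:
  assumes "second_countable X" "second_countable Y"
  shows "second_countable (prod_topology X Y)"
proof -
  obtain A where A: "countable A" "\<And>V. V \<in> A \<Longrightarrow> openin X V"
    "\<And>U x. openin X U \<Longrightarrow> x \<in> U \<Longrightarrow> \<exists>V\<in>A. x \<in> V \<and> V \<subseteq> U"
    using assms(1) unfolding second_countable_def by metis
  obtain B where B: "countable B" "\<And>V. V \<in> B \<Longrightarrow> openin Y V"
    "\<And>U x. openin Y U \<Longrightarrow> x \<in> U \<Longrightarrow> \<exists>V\<in>B. x \<in> V \<and> V \<subseteq> U"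
    using assms(2) unfolding second_countable_def by metis
  let ?C = "(\<lambda>(V, W). V \<times> W) ` (A \<times> B)"
  have "\<exists>V\<in>?C. z \<in> V \<and> V \<subseteq> U" if U: "openin (prod_topology X Y) U" "z \<in> U" for U z
  proof -
    obtain x y where z: "z = (x, y)" by fastforce
    obtain V W where VW: "openin X V" "openin Y W" "x \<in> V" "y \<in> W" "V \<times> W \<subseteq> U"
      using U unfolding openin_prod_topology_alt z by metis
    obtain V' where "V' \<in> A" "x \<in> V'" "V' \<subseteq> V" using A(3) VW by metis
    moreover obtain W' where "W' \<in> B" "y \<in> W'" "W' \<subseteq> W" using B(3) VW by metis
    ultimately have "V' \<times> W' \<in> ?C" "z \<in> V' \<times> W'" "V' \<times> W' \<subseteq> U" using VW z by auto
    then show ?thesis by blast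
  qed
  moreover have "countable ?C" using A(1) B(1) by blast
  moreover have "openin (prod_topology X Y) V" if "V \<in> ?C" for V
    using that A(2) B(2) by (auto simp: openin_prod_Times_iff)
  ultimately show ?thesis unfolding second_countable_def
    by (intro exI[of _ ?C]) simp
qed

lemma second_countable_complex_space: "second_countable (complex_space n)"
proof -
  obtain B :: "(nat \<Rightarrow> complex) set set" where B: "countable B" "topological_basis B"
    using ex_countable_basis by blast
  have "second_countable (euclidean :: (nat \<Rightarrow> complex) topology)"
    unfolding second_countable_def
  proof (intro exI[of _ B] conjI allI impI)
    show "\<forall>V\<in>B. openin euclidean V" using B(2) by (simp add: topological_basis_open)
    show "\<exists>V\<in>B. x \<in> V \<and> V \<subseteq> U" if "openin euclidean U \<and> x \<in> U" for U x
      using that topological_basisE[OF B(2)] by (metis open_openin)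
  qed fact
  then show ?thesis unfolding complex_space_eq by (rule second_countable_subtopology)
qed

definition trunc_coords :: "nat \<Rightarrow> (nat \<Rightarrow> complex) \<Rightarrow> nat \<Rightarrow> complex"
  where "trunc_coords n w = (\<lambda>i. if i < n then w i else 0)"

lemma trunc_coords_in [simp]: "trunc_coords n w \<in> topspace (complex_space n)"
  by (simp add: trunc_coords_def)

lemma trunc_coords_apply [simp]: "i < n \<Longrightarrow> trunc_coords n w i = w i"
  by (simp add: trunc_coords_def)

lemma continuous_map_into_complex_space:
  assumes "\<And>i. i < n \<Longrightarrow> continuous_map Z euclidean (\<lambda>z. g z i)"
    and "\<And>z i. z \<in> topspace Z \<Longrightarrow> i \<ge> n \<Longrightarrow> g z i = 0"
  shows "continuous_map Z (complex_space n) g"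
  unfolding complex_space_def continuous_map_in_subtopology
proof
  show "continuous_map Z (product_topology (\<lambda>_. euclidean) UNIV) g"
    unfolding continuous_map_componentwise_UNIV
  proof
    fix i
    show "continuous_map Z euclidean (\<lambda>z. g z i)"
    proof (cases "i < n")
      case False
      have "continuous_map Z euclidean (\<lambda>z. 0 :: complex)" by simp
      then show ?thesis by (rule continuous_map_eq) (use assms(2) False in auto)
    qed (rule assms(1))
  qed
qed (use assms(2) in auto)

lemma continuous_map_complex_space_coordinate:
  assumes "continuous_map Z (complex_space n) g"
  shows "continuous_map Z euclidean (\<lambda>z. g z i)"
  using assms unfolding complex_space_def continuous_map_in_subtopology
  by (simp add: continuous_map_componentwise_UNIV)

lemma continuous_map_trunc_coords: "continuous_map (complex_space n) (complex_space m) (trunc_coords m)"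
proof (rule continuous_map_into_complex_space)
  show "continuous_map (complex_space n) euclidean (\<lambda>z. trunc_coords m z i)" if "i < m" for i
    using continuous_map_complex_space_coordinate[OF continuous_map_id, of n i] that by (simp add: id_def)
qed (simp add: trunc_coords_def)

text \<open>The hull is an intersection of closed sets |f| \<le> c; the whole space is added to the
  family so that the intersection is nonempty-indexed and stays inside the carrier.\<close>

lemma closedin_holomorphic_hull: "closedin (mtop N) (holomorphic_hull N K)"
proof -
  have "closedin (mtop N) {x \<in> topspace (mtop N). cmod (f x) \<in> {..c}}" if "holomorphic_function N f" for f c
  proof (rule closedin_continuous_map_preimage)
    show "continuous_map (mtop N) euclideanreal (\<lambda>x. cmod (f x))"
      using that by (auto simp: holomorphic_function_def intro: continuous_map_norm)
  qed auto
  then have "closedin (mtop N) (\<Inter> (insert (topspace (mtop N))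
      {{x \<in> topspace (mtop N). cmod (f x) \<in> {..c}} | f c. holomorphic_function N f \<and> (\<forall>y\<in>K. cmod (f y) \<le> c)}))"
    by (intro closedin_Inter) auto
  also have "\<Inter> (insert (topspace (mtop N))
      {{x \<in> topspace (mtop N). cmod (f x) \<in> {..c}} | f c. holomorphic_function N f \<and> (\<forall>y\<in>K. cmod (f y) \<le> c)})
      = holomorphic_hull N K"
    by (auto simp: holomorphic_hull_def)
  finally show ?thesis .
qed

text \<open>The product lives on an arbitrary homeomorphic copy \<open>R\<close> of the product space, because POPI is
  only available for Stein manifolds carried by the reals.\<close>

locale stein_times_Cn =
  fixes S :: "'a cmanifold" and n :: nat and R :: "'b topology"
    and e :: "'a \<times> (nat \<Rightarrow> complex) \<Rightarrow> 'b" and q :: "'b \<Rightarrow> 'a \<times> (nat \<Rightarrow> complex)"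
  assumes stein: "stein_manifold S"
    and homeo: "homeomorphic_maps (prod_topology (mtop S) (complex_space n)) R e q"
begin

definition p1 :: "'b \<Rightarrow> 'a" where "p1 y = fst (q y)"
definition p2 :: "'b \<Rightarrow> nat \<Rightarrow> complex" where "p2 y = snd (q y)"

lemma S: "complex_manifold S" using stein by (simp add: stein_manifold_def)

lemma cont_q: "continuous_map R (prod_topology (mtop S) (complex_space n)) q"
  using homeo by (simp add: homeomorphic_maps_def)

lemma cont_e: "continuous_map (prod_topology (mtop S) (complex_space n)) R e"
  using homeo by (simp add: homeomorphic_maps_def)

lemma cont_p1: "continuous_map R (mtop S) p1"
  using continuous_map_fst_of[OF cont_q] by (simp add: o_def p1_def[abs_def])

lemma cont_p2: "continuous_map R (complex_space n) p2"
  using continuous_map_snd_of[OF cont_q] by (simp add: o_def p2_def[abs_def])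

lemma cont_p2_coordinate: "continuous_map R euclidean (\<lambda>y. p2 y j)"
  by (rule continuous_map_complex_space_coordinate[OF cont_p2])

lemma p1_in: "y \<in> topspace R \<Longrightarrow> p1 y \<in> topspace (mtop S)"
  using cont_p1 by (auto simp: continuous_map_def)

lemma p2_in: "y \<in> topspace R \<Longrightarrow> p2 y \<in> topspace (complex_space n)"
  using cont_p2 by (auto simp: continuous_map_def)

lemma e_p: "y \<in> topspace R \<Longrightarrow> e (p1 y, p2 y) = y"
  using homeo by (auto simp: homeomorphic_maps_def p1_def p2_def)

lemma e_in: "x \<in> topspace (mtop S) \<Longrightarrow> w \<in> topspace (complex_space n) \<Longrightarrow> e (x, w) \<in> topspace R"
  using cont_e by (auto simp: continuous_map_def)

lemma p_e:
  assumes "x \<in> topspace (mtop S)" "w \<in> topspace (complex_space n)"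
  shows "p1 (e (x, w)) = x" "p2 (e (x, w)) = w"
proof -
  have "(x, w) \<in> topspace (prod_topology (mtop S) (complex_space n))" using assms by auto
  then have "q (e (x, w)) = (x, w)" using homeo unfolding homeomorphic_maps_def by blast
  then show "p1 (e (x, w)) = x" "p2 (e (x, w)) = w" by (auto simp: p1_def p2_def)
qed

lemma cont_pair:
  assumes "continuous_map Z (mtop S) f" "\<And>j. j < n \<Longrightarrow> continuous_map Z euclidean (\<lambda>z. g z j)"
  shows "continuous_map Z R (\<lambda>z. e (f z, trunc_coords n (g z)))"
proof -
  have "continuous_map Z (complex_space n) (\<lambda>z. trunc_coords n (g z))"
    by (rule continuous_map_into_complex_space) (use assms(2) in \<open>auto simp: trunc_coords_def\<close>)
  then have "continuous_map Z (prod_topology (mtop S) (complex_space n)) (\<lambda>z. (f z, trunc_coords n (g z)))"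
    using assms(1) by (simp add: continuous_map_paired)
  from continuous_map_compose[OF this cont_e] show ?thesis by (simp add: o_def)
qed

section \<open>Sheared charts of the product\<close>

definition pdom :: "'a set \<Rightarrow> 'b set" where "pdom V = {y \<in> topspace R. p1 y \<in> V}"

text \<open>Subtracting \<open>f\<close> turns the graph of \<open>f\<close> into the zero set of
  the last \<open>n\<close> coordinates. The base coordinates come first, so that this zero set is
  literally a part of C^n0, as \<open>closed_submanifold\<close> demands.\<close>

definition pchart :: "nat \<Rightarrow> ('a \<Rightarrow> nat \<Rightarrow> complex) \<Rightarrow> (nat \<Rightarrow> 'a \<Rightarrow> complex) \<Rightarrow> 'b \<Rightarrow> nat \<Rightarrow> complex"
  where "pchart n0 \<phi> f y = (\<lambda>i. if i < n0 then \<phi> (p1 y) i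
    else if i < n0 + n then p2 y (i - n0) - f (i - n0) (p1 y) else 0)"

definition pinv :: "nat \<Rightarrow> 'a set \<Rightarrow> ('a \<Rightarrow> nat \<Rightarrow> complex) \<Rightarrow> (nat \<Rightarrow> 'a \<Rightarrow> complex) \<Rightarrow> (nat \<Rightarrow> complex) \<Rightarrow> 'b"
  where "pinv n0 V \<phi> f z = (let x = inv_into V \<phi> (trunc_coords n0 z)
    in e (x, trunc_coords n (\<lambda>j. z (n0 + j) + f j x)))"

definition adapted :: "nat \<Rightarrow> 'a set \<Rightarrow> ('a \<Rightarrow> nat \<Rightarrow> complex) \<Rightarrow> (nat \<Rightarrow> 'a \<Rightarrow> complex) \<Rightarrow> bool"
  where "adapted n0 V \<phi> f \<longleftrightarrow> (n0, V, \<phi>) \<in> maximal_atlas S \<and> (\<forall>j<n. hol_fun_on S V (f j))"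

text \<open>Charts sheared along arbitrary holomorphic maps to $\mathbb C^n$ are included from the start, so
  that graphs of such maps are flattened by charts of the atlas itself.\<close>

definition M :: "'b cmanifold" where
  "M = \<lparr>mtop = R, atlas = {(n0 + n, pdom V, pchart n0 \<phi> f) | n0 V \<phi> f. adapted n0 V \<phi> f}\<rparr>"

lemma mtop_M [simp]: "mtop M = R" by (simp add: M_def)

lemma atlas_M: "c \<in> atlas M \<longleftrightarrow> (\<exists>n0 V \<phi> f. c = (n0 + n, pdom V, pchart n0 \<phi> f) \<and> adapted n0 V \<phi> f)"
  by (simp add: M_def)

context
  fixes n0 V \<phi> f assumes ad: "adapted n0 V \<phi> f"
begin

lemma V_max: "(n0, V, \<phi>) \<in> maximal_atlas S" using ad by (simp add: adapted_def)

lemma f_hol: "j < n \<Longrightarrow> hol_fun_on S V (f j)" using ad by (simp add: adapted_def)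

lemmas VD = is_chartD[OF maximal_atlasD(1)[OF V_max]]

lemma V_sub: "V \<subseteq> topspace (mtop S)" using VD(1) by (rule openin_subset)

lemma openin_pdom: "openin R (pdom V)"
  unfolding pdom_def using openin_continuous_map_preimage[OF cont_p1 VD(1)] .

lemma trunc_coords_pchart:
  assumes "y \<in> pdom V" shows "trunc_coords n0 (pchart n0 \<phi> f y) = \<phi> (p1 y)"
proof -
  have "\<phi> (p1 y) \<in> topspace (complex_space n0)" using assms VD(3) by (auto simp: pdom_def)
  then show ?thesis by (auto simp: trunc_coords_def pchart_def)
qed

lemma pinv_pchart:
  assumes y: "y \<in> pdom V" shows "pinv n0 V \<phi> f (pchart n0 \<phi> f y) = y"
proof -
  have x: "inv_into V \<phi> (trunc_coords n0 (pchart n0 \<phi> f y)) = p1 y"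
    using trunc_coords_pchart[OF y] y VD(2) by (auto simp: pdom_def)
  have "trunc_coords n (\<lambda>j. pchart n0 \<phi> f y (n0 + j) + f j (p1 y)) = p2 y"
    using p2_in[of y] y by (auto simp: trunc_coords_def pchart_def pdom_def)
  then show ?thesis using x y e_p[of y] by (simp add: pinv_def pdom_def)
qed

lemma inv_pchart_in: "trunc_coords n0 z \<in> \<phi> ` V \<Longrightarrow> inv_into V \<phi> (trunc_coords n0 z) \<in> V"
  by (rule inv_into_into)

lemma p_pinv:
  assumes "trunc_coords n0 z \<in> \<phi> ` V"
  shows "p1 (pinv n0 V \<phi> f z) = inv_into V \<phi> (trunc_coords n0 z)"
    "j < n \<Longrightarrow> p2 (pinv n0 V \<phi> f z) j = z (n0 + j) + f j (inv_into V \<phi> (trunc_coords n0 z))"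
    "pinv n0 V \<phi> f z \<in> pdom V"
proof -
  have "inv_into V \<phi> (trunc_coords n0 z) \<in> topspace (mtop S)" using inv_pchart_in[OF assms] V_sub by blast
  note * = p_e[OF this trunc_coords_in] e_in[OF this trunc_coords_in]
  show "p1 (pinv n0 V \<phi> f z) = inv_into V \<phi> (trunc_coords n0 z)"
    "j < n \<Longrightarrow> p2 (pinv n0 V \<phi> f z) j = z (n0 + j) + f j (inv_into V \<phi> (trunc_coords n0 z))"
    "pinv n0 V \<phi> f z \<in> pdom V"
    using * inv_pchart_in[OF assms] by (simp_all add: pinv_def Let_def pdom_def)
qed

lemma pchart_pinv:
  assumes "trunc_coords n0 z \<in> \<phi> ` V" "z \<in> topspace (complex_space (n0 + n))"
  shows "pchart n0 \<phi> f (pinv n0 V \<phi> f z) = z"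
proof
  fix i
  have "\<phi> (inv_into V \<phi> (trunc_coords n0 z)) = trunc_coords n0 z" using assms(1) by (rule f_inv_into_f)
  then show "pchart n0 \<phi> f (pinv n0 V \<phi> f z) i = z i"
    using assms(2) p_pinv(1)[OF assms(1)] p_pinv(2)[OF assms(1), of "i - n0"] by (auto simp: pchart_def)
qed

lemma pchart_image: "pchart n0 \<phi> f ` pdom V = {z \<in> topspace (complex_space (n0 + n)). trunc_coords n0 z \<in> \<phi> ` V}"
proof
  show "pchart n0 \<phi> f ` pdom V \<subseteq> {z \<in> topspace (complex_space (n0 + n)). trunc_coords n0 z \<in> \<phi> ` V}"
  proof
    fix z assume "z \<in> pchart n0 \<phi> f ` pdom V"
    then obtain y where y: "y \<in> pdom V" "z = pchart n0 \<phi> f y" by blast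
    then show "z \<in> {z \<in> topspace (complex_space (n0 + n)). trunc_coords n0 z \<in> \<phi> ` V}"
      using trunc_coords_pchart[OF y(1)] by (auto simp: pchart_def pdom_def)
  qed
  show "{z \<in> topspace (complex_space (n0 + n)). trunc_coords n0 z \<in> \<phi> ` V} \<subseteq> pchart n0 \<phi> f ` pdom V"
  proof
    fix z assume z: "z \<in> {z \<in> topspace (complex_space (n0 + n)). trunc_coords n0 z \<in> \<phi> ` V}"
    then have "z = pchart n0 \<phi> f (pinv n0 V \<phi> f z)" using pchart_pinv[of z] by simp
    then show "z \<in> pchart n0 \<phi> f ` pdom V" using p_pinv(3)[of z] z by blast
  qed
qed

lemma cont_pchart: "continuous_map (subtopology R (pdom V)) (complex_space (n0 + n)) (pchart n0 \<phi> f)"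
proof (rule continuous_map_into_complex_space)
  have p1V: "continuous_map (subtopology R (pdom V)) (subtopology (mtop S) V) p1"
    using cont_p1 by (auto simp: continuous_map_in_subtopology continuous_map_from_subtopology pdom_def)
  fix i assume "i < n0 + n"
  show "continuous_map (subtopology R (pdom V)) euclidean (\<lambda>y. pchart n0 \<phi> f y i)"
  proof (cases "i < n0")
    case True
    have "continuous_map (subtopology (mtop S) V) euclidean (\<lambda>x. \<phi> x i)"
      by (rule continuous_map_complex_space_coordinate[OF VD(5)])
    from continuous_map_compose[OF p1V this] show ?thesis using True by (simp add: o_def pchart_def)
  next
    case False
    have "continuous_map (subtopology (mtop S) V) euclidean (f (i - n0))"
      using f_hol[of "i - n0"] False \<open>i < n0 + n\<close> by (simp add: hol_fun_on_def)
    from continuous_map_compose[OF p1V this]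
    have "continuous_map (subtopology R (pdom V)) euclidean (\<lambda>y. p2 y (i - n0) - f (i - n0) (p1 y))"
      using continuous_map_from_subtopology[OF cont_p2_coordinate]
      by (intro continuous_map_diff) (auto simp: o_def)
    then show ?thesis using False \<open>i < n0 + n\<close> by (simp add: pchart_def)
  qed
qed (simp add: pchart_def)

lemma cont_pinv: "continuous_map (subtopology (complex_space (n0 + n)) (pchart n0 \<phi> f ` pdom V)) R (pinv n0 V \<phi> f)"
proof -
  let ?Z = "subtopology (complex_space (n0 + n)) (pchart n0 \<phi> f ` pdom V)"
  have t: "continuous_map ?Z (subtopology (complex_space n0) (\<phi> ` V)) (trunc_coords n0)"
    unfolding continuous_map_in_subtopology
    using continuous_map_from_subtopology[OF continuous_map_trunc_coords] by (auto simp: pchart_image)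
  from continuous_map_compose[OF t VD(7)]
  have x: "continuous_map ?Z (subtopology (mtop S) V) (\<lambda>z. inv_into V \<phi> (trunc_coords n0 z))"
    by (simp add: o_def)
  have "continuous_map ?Z R (\<lambda>z. e (inv_into V \<phi> (trunc_coords n0 z),
      trunc_coords n (\<lambda>j. z (n0 + j) + f j (inv_into V \<phi> (trunc_coords n0 z)))))"
  proof (rule cont_pair)
    show "continuous_map ?Z (mtop S) (\<lambda>z. inv_into V \<phi> (trunc_coords n0 z))"
      using x continuous_map_in_subtopology by blast
    fix j assume "j < n"
    have "continuous_map (subtopology (mtop S) V) euclidean (f j)"
      using f_hol[OF \<open>j < n\<close>] by (simp add: hol_fun_on_def)
    from continuous_map_compose[OF x this]
    have "continuous_map ?Z euclidean (\<lambda>z. f j (inv_into V \<phi> (trunc_coords n0 z)))" by (simp add: o_def)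
    moreover have "continuous_map ?Z euclidean (\<lambda>z. z (n0 + j))"
      using continuous_map_complex_space_coordinate[OF continuous_map_from_subtopology[OF continuous_map_id]]
      by (simp add: id_def)
    ultimately show "continuous_map ?Z euclidean (\<lambda>z. z (n0 + j) + f j (inv_into V \<phi> (trunc_coords n0 z)))"
      by (intro continuous_map_add)
  qed
  then show ?thesis by (simp add: pinv_def[abs_def] Let_def)
qed

lemma is_chart_pchart: "is_chart R (n0 + n, pdom V, pchart n0 \<phi> f)"
proof (rule is_chartI[OF openin_pdom _ cont_pchart cont_pinv pinv_pchart])
  show "openin (complex_space (n0 + n)) (pchart n0 \<phi> f ` pdom V)"
    unfolding pchart_image by (rule openin_continuous_map_preimage[OF continuous_map_trunc_coords VD(4)])
qed

lemma pchart_image_sub: "A \<subseteq> pdom V \<Longrightarrow> pchart n0 \<phi> f ` A \<subseteq> topspace (complex_space (n0 + n))"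
  using pchart_image by blast

lemma inv_pchart: "z \<in> pchart n0 \<phi> f ` pdom V \<Longrightarrow> inv_into (pdom V) (pchart n0 \<phi> f) z = pinv n0 V \<phi> f z"
  using is_chartD(2)[OF is_chart_pchart] pinv_pchart by auto

text \<open>In a sheared chart the projection \<open>p1\<close> is truncation to the first
  \<open>n0\<close> coordinates, whatever the shear; the claim is the chain rule with that linear
  map.\<close>

lemma cdiff_base:
  assumes G: "hol_fun_on S D G" and z: "z \<in> pchart n0 \<phi> f ` (pdom V \<inter> p1 -` D)"
  shows "cdiff (n0 + n) (\<lambda>z. G (p1 (inv_into (pdom V) (pchart n0 \<phi> f) z))) (pchart n0 \<phi> f ` (pdom V \<inter> p1 -` D)) z"
proof (rule cdiff_cong[OF _ z])
  let ?W = "pchart n0 \<phi> f ` (pdom V \<inter> p1 -` D)"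
  have tr: "trunc_coords n0 w \<in> \<phi> ` (V \<inter> D)" if "w \<in> ?W" for w
    using that by (auto simp: trunc_coords_pchart) (auto simp: pdom_def)
  show "cdiff (n0 + n) (\<lambda>z. G (inv_into V \<phi> (trunc_coords n0 z))) ?W z"
  proof (rule cdiff_compose[where g = "\<lambda>v. G (inv_into V \<phi> v)" and F = "trunc_coords n0" and V = "\<phi> ` (V \<inter> D)"])
    show "cdiff n0 (\<lambda>v. G (inv_into V \<phi> v)) (\<phi> ` (V \<inter> D)) (trunc_coords n0 z)"
      by (rule hol_fun_on_cdiff[OF G V_max tr[OF z]])
    show "cdiff (n0 + n) (\<lambda>w. trunc_coords n0 w i) ?W z" if "i < n0" for i
      using that by (simp add: cdiff_coordinate)
  qed (use tr z VD(3) in blast)+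
  fix w assume w: "w \<in> ?W"
  then have "w \<in> pchart n0 \<phi> f ` pdom V" by blast
  then show "G (inv_into V \<phi> (trunc_coords n0 w)) = G (p1 (inv_into (pdom V) (pchart n0 \<phi> f) w))"
    using p_pinv(1)[of w] tr[OF w] by (auto simp: inv_pchart)
qed

text \<open>The shear is undone by adding \<open>f j\<close> of the base point to the chart
  coordinate \<open>n0 + j\<close>; the added function is covered by
  \<open>cdiff_base\<close>.\<close>

lemma cdiff_fibre:
  assumes j: "j < n" and z: "z \<in> pchart n0 \<phi> f ` pdom V"
  shows "cdiff (n0 + n) (\<lambda>z. p2 (inv_into (pdom V) (pchart n0 \<phi> f) z) j) (pchart n0 \<phi> f ` pdom V) z"
proof (rule cdiff_cong[OF _ z])
  let ?I = "inv_into (pdom V) (pchart n0 \<phi> f)"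
  have V: "pdom V \<inter> p1 -` V = pdom V" by (auto simp: pdom_def)
  show "cdiff (n0 + n) (\<lambda>z. z (n0 + j) + f j (p1 (?I z))) (pchart n0 \<phi> f ` pdom V) z"
    using cdiff_base[OF f_hol[OF j], of z] z j unfolding V by (intro cdiff_add cdiff_coordinate) auto
  fix w assume w: "w \<in> pchart n0 \<phi> f ` pdom V"
  then have "trunc_coords n0 w \<in> \<phi> ` V" by (simp add: pchart_image)
  then show "w (n0 + j) + f j (p1 (?I w)) = p2 (?I w) j"
    using p_pinv(1)[of w] p_pinv(2)[of w j] j by (simp add: inv_pchart[OF w])
qed

end

lemma pchart_in_atlas: "adapted n0 V \<phi> f \<Longrightarrow> (n0 + n, pdom V, pchart n0 \<phi> f) \<in> atlas M"
  unfolding atlas_M by (intro exI[of _ n0] exI[of _ V] exI[of _ \<phi>] exI[of _ f]) simp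

text \<open>Charts with different shears are compatible: a coordinate of the second chart is either
  a base coordinate or a fibre coordinate minus a function of the base point, and both are
  differentiable in any sheared chart.\<close>

lemma holomorphic_Cn_coordinate:
  assumes ad: "adapted n0 V \<phi> f" and ad': "adapted n1 V' \<phi>' f'" and i: "i < n1 + n"
  shows "holomorphic_Cn (n0 + n) (\<lambda>z. pchart n1 \<phi>' f' (inv_into (pdom V) (pchart n0 \<phi> f) z) i)
    (pchart n0 \<phi> f ` (pdom V \<inter> pdom V'))"
proof -
  let ?I = "inv_into (pdom V) (pchart n0 \<phi> f)"
  let ?W = "pchart n0 \<phi> f ` (pdom V \<inter> pdom V')"
  have dom: "pdom V \<inter> pdom V' = pdom V \<inter> p1 -` V'" by (auto simp: pdom_def)
  have "cdiff (n0 + n) (\<lambda>z. pchart n1 \<phi>' f' (?I z) i) ?W z" if z: "z \<in> ?W" for z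
  proof (cases "i < n1")
    case True
    have "hol_fun_on S V' (\<lambda>x. \<phi>' x i)"
      by (rule hol_fun_on_chart_coordinate[OF S V_max[OF ad'] True])
    from cdiff_base[OF ad this] show ?thesis using z True by (simp add: pchart_def dom)
  next
    case False
    have j: "i - n1 < n" using i False by simp
    have "cdiff (n0 + n) (\<lambda>z. p2 (?I z) (i - n1)) ?W z"
      by (rule cdiff_mono[OF cdiff_fibre[OF ad j]]) (use z in auto)
    moreover have "cdiff (n0 + n) (\<lambda>z. f' (i - n1) (p1 (?I z))) ?W z"
      using cdiff_base[OF ad f_hol[OF ad' j]] z by (simp add: dom)
    ultimately have "cdiff (n0 + n) (\<lambda>z. p2 (?I z) (i - n1) - f' (i - n1) (p1 (?I z))) ?W z"
      by (rule cdiff_diff)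
    then show ?thesis using False i by (simp add: pchart_def)
  qed
  moreover have "?W \<subseteq> topspace (complex_space (n0 + n))" by (rule pchart_image_sub[OF ad]) auto
  ultimately show ?thesis by (simp add: holomorphic_Cn_iff_cdiff)
qed

lemma adapted_around:
  assumes "x \<in> topspace (mtop S)"
  shows "\<exists>n0 V \<phi>. x \<in> V \<and> (n0, V, \<phi>) \<in> maximal_atlas S \<and> adapted n0 V \<phi> (\<lambda>_ _. 0)"
proof -
  obtain n0 V \<phi> where V: "(n0, V, \<phi>) \<in> atlas S" "x \<in> V" using complex_manifoldD(6)[OF S assms] by blast
  then have mx: "(n0, V, \<phi>) \<in> maximal_atlas S" using complex_manifoldD(7)[OF S] by blast
  have "hol_fun_on S V (\<lambda>_. 0)"
    by (rule hol_fun_on_cdiffI) (simp_all add: cdiff_const)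
  then have "adapted n0 V \<phi> (\<lambda>_ _. 0)" using mx by (simp add: adapted_def)
  then show ?thesis using mx V(2) by (intro exI[of _ n0] exI[of _ V] exI[of _ \<phi>] conjI)
qed

lemma complex_manifold_M: "complex_manifold M"
  unfolding complex_manifold_def
proof (intro conjI ballI)
  have hom: "prod_topology (mtop S) (complex_space n) homeomorphic_space R"
    using homeo homeomorphic_space_def by blast
  show "Hausdorff_space (mtop M)"
    using homeomorphic_Hausdorff_space[OF hom] complex_manifoldD(1)[OF S] Hausdorff_complex_space
    by (simp add: Hausdorff_space_prod_topology)
  have "second_countable (prod_topology (mtop S) (complex_space n))"
    by (rule second_countable_prod_topology[OF complex_manifoldD(2)[OF S] second_countable_complex_space])
  then show "second_countable (mtop M)"
    using homeomorphic_space_second_countability[OF hom] by simp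
  show "is_chart (mtop M) c" if cM: "c \<in> atlas M" for c
  proof -
    obtain n0 V \<phi> f where "c = (n0 + n, pdom V, pchart n0 \<phi> f)" "adapted n0 V \<phi> f"
      using cM unfolding atlas_M by blast
    then show ?thesis using is_chart_pchart by simp
  qed
  show "(\<Union>(n, U, \<phi>)\<in>atlas M. U) = topspace (mtop M)"
  proof
    show "(\<Union>(n, U, \<phi>)\<in>atlas M. U) \<subseteq> topspace (mtop M)"
    proof
      fix y assume "y \<in> (\<Union>(n, U, \<phi>)\<in>atlas M. U)"
      then obtain c where "c \<in> atlas M" "y \<in> fst (snd c)" by force
      then show "y \<in> topspace (mtop M)" unfolding atlas_M by (auto simp: pdom_def)
    qed
    show "topspace (mtop M) \<subseteq> (\<Union>(n, U, \<phi>)\<in>atlas M. U)"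
    proof
      fix y assume y: "y \<in> topspace (mtop M)"
      then have "p1 y \<in> topspace (mtop S)" using p1_in by simp
      from adapted_around[OF this] obtain n0 V \<phi>
        where V: "p1 y \<in> V" "(n0, V, \<phi>) \<in> maximal_atlas S" "adapted n0 V \<phi> (\<lambda>_ _. 0)"
        by (elim exE conjE)
      have "(n0 + n, pdom V, pchart n0 \<phi> (\<lambda>_ _. 0)) \<in> atlas M" by (rule pchart_in_atlas[OF V(3)])
      then show "y \<in> (\<Union>(n, U, \<phi>)\<in>atlas M. U)"
        by (rule UN_I) (use V y in \<open>simp add: pdom_def\<close>)
    qed
  qed
  show "holomorphic_transition c c'" if cM: "c \<in> atlas M" "c' \<in> atlas M" for c c'
  proof -
    obtain n0 V \<phi> f n1 V' \<phi>' f' where c: "c = (n0 + n, pdom V, pchart n0 \<phi> f)" "adapted n0 V \<phi> f"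
      "c' = (n1 + n, pdom V', pchart n1 \<phi>' f')" "adapted n1 V' \<phi>' f'"
      using cM unfolding atlas_M by blast
    show ?thesis unfolding c(1,3) holomorphic_transition_def
      using holomorphic_Cn_coordinate[OF c(2,4)] by simp
  qed
qed

lemma holomorphic_map_p1: "holomorphic_map M S p1"
proof -
  have "holomorphic_Cn (n0 + n) (\<lambda>z. \<psi> (p1 (inv_into (pdom V) (pchart n0 \<phi> f) z)) i) (pchart n0 \<phi> f ` (pdom V \<inter> p1 -` U))"
    if ad: "adapted n0 V \<phi> f" and U: "(m, U, \<psi>) \<in> atlas S" and i: "i < m" for n0 V \<phi> f m U \<psi> i
  proof -
    have "(m, U, \<psi>) \<in> maximal_atlas S" using U complex_manifoldD(7)[OF S] by (rule subsetD[rotated])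
    then have "hol_fun_on S U (\<lambda>x. \<psi> x i)" by (rule hol_fun_on_chart_coordinate[OF S _ i])
    note * = cdiff_base[OF ad this]
    have W: "pchart n0 \<phi> f ` (pdom V \<inter> p1 -` U) \<subseteq> topspace (complex_space (n0 + n))"
      by (rule pchart_image_sub[OF ad]) auto
    show ?thesis unfolding holomorphic_Cn_iff_cdiff[OF W] by (intro ballI *)
  qed
  then show ?thesis
    using cont_p1 unfolding holomorphic_map_def by (auto simp: atlas_M)
qed

lemma holomorphic_function_p1:
  assumes "holomorphic_function S g"
  shows "holomorphic_function M (\<lambda>y. g (p1 y))"
proof -
  have "continuous_map (mtop M) euclidean (\<lambda>y. g (p1 y))"
    using continuous_map_compose[OF cont_p1, of euclidean g] assms
    by (simp add: holomorphic_function_def o_def)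
  moreover have "holomorphic_Cn (n0 + n) (\<lambda>z. g (p1 (inv_into (pdom V) (pchart n0 \<phi> f) z))) (pchart n0 \<phi> f ` pdom V)"
    if ad: "adapted n0 V \<phi> f" for n0 V \<phi> f
    using cdiff_base[OF ad holomorphic_function_imp_hol_fun_on[OF S assms, of UNIV]]
      holomorphic_Cn_iff_cdiff[OF pchart_image_sub[OF ad order_refl]] by simp
  ultimately show ?thesis unfolding holomorphic_function_def by (auto simp: atlas_M)
qed

lemma holomorphic_function_p2:
  assumes "j < n"
  shows "holomorphic_function M (\<lambda>y. p2 y j)"
proof -
  have "holomorphic_Cn (n0 + n) (\<lambda>z. p2 (inv_into (pdom V) (pchart n0 \<phi> f) z) j) (pchart n0 \<phi> f ` pdom V)"
    if ad: "adapted n0 V \<phi> f" for n0 V \<phi> f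
    using cdiff_fibre[OF ad assms]
      holomorphic_Cn_iff_cdiff[OF pchart_image_sub[OF ad order_refl]] by simp
  then show ?thesis unfolding holomorphic_function_def using cont_p2_coordinate by (auto simp: atlas_M)
qed

section \<open>Graphs of maps to complex Euclidean space\<close>

definition graph_map :: "(nat \<Rightarrow> 'a \<Rightarrow> complex) \<Rightarrow> 'a \<Rightarrow> 'b"
  where "graph_map \<psi> x = e (x, trunc_coords n (\<lambda>j. \<psi> j x))"

lemma graph_map_in: "x \<in> topspace (mtop S) \<Longrightarrow> graph_map \<psi> x \<in> topspace R"
  unfolding graph_map_def by (rule e_in[OF _ trunc_coords_in])

lemma p1_graph_map: "x \<in> topspace (mtop S) \<Longrightarrow> p1 (graph_map \<psi> x) = x"
  unfolding graph_map_def by (rule p_e(1)[OF _ trunc_coords_in])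

lemma p2_graph_map: "x \<in> topspace (mtop S) \<Longrightarrow> p2 (graph_map \<psi> x) = trunc_coords n (\<lambda>j. \<psi> j x)"
  unfolding graph_map_def by (rule p_e(2)[OF _ trunc_coords_in])

lemma graph_map_eqI:
  assumes "y \<in> topspace R" "\<And>j. j < n \<Longrightarrow> p2 y j = \<psi> j (p1 y)"
  shows "y = graph_map \<psi> (p1 y)"
proof -
  have "trunc_coords n (\<lambda>j. \<psi> j (p1 y)) = p2 y"
    using assms p2_in[OF assms(1)] by (auto simp: trunc_coords_def)
  then show ?thesis using e_p[OF assms(1)] by (simp add: graph_map_def)
qed

lemma holomorphic_map_graph_map:
  assumes \<psi>: "\<And>j. j < n \<Longrightarrow> holomorphic_function S (\<psi> j)"
  shows "holomorphic_map S M (graph_map \<psi>)"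
proof -
  have "continuous_map (mtop S) (mtop M) (graph_map \<psi>)"
    unfolding graph_map_def[abs_def] mtop_M
    using cont_pair[OF continuous_map_id, of "\<lambda>x j. \<psi> j x"] \<psi>
    by (simp add: holomorphic_function_def id_def)
  moreover have "holomorphic_Cn m (\<lambda>z. pchart n0 \<phi> f (graph_map \<psi> (inv_into U \<psi>' z)) i) (\<psi>' ` (U \<inter> graph_map \<psi> -` pdom V))"
    if U: "(m, U, \<psi>') \<in> atlas S" and ad: "adapted n0 V \<phi> f" and i: "i < n0 + n" for m U \<psi>' n0 V \<phi> f i
  proof -
    have mx: "(m, U, \<psi>') \<in> maximal_atlas S" using U complex_manifoldD(7)[OF S] by blast
    note UD = is_chartD[OF maximal_atlasD(1)[OF mx]]
    have US: "U \<subseteq> topspace (mtop S)" by (rule openin_subset[OF UD(1)])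
    have dom: "U \<inter> graph_map \<psi> -` pdom V = U \<inter> V"
      using US p1_graph_map graph_map_in by (fastforce simp: pdom_def)
    let ?W = "\<psi>' ` (U \<inter> V)"
    let ?g = "\<lambda>x. if i < n0 then \<phi> x i else \<psi> (i - n0) x - f (i - n0) x"
    have "hol_fun_on S V ?g"
    proof (cases "i < n0")
      case True
      then show ?thesis using hol_fun_on_chart_coordinate[OF S V_max[OF ad] True] by simp
    next
      case False
      then show ?thesis
        using hol_fun_on_diff[OF holomorphic_function_imp_hol_fun_on[OF S \<psi>] f_hol[OF ad], of "i - n0" "i - n0"] i by simp
    qed
    then have "holomorphic_Cn m (\<lambda>z. ?g (inv_into U \<psi>' z)) ?W"
      using mx unfolding hol_fun_on_def by blast
    then show ?thesis unfolding dom
    proof (rule holomorphic_Cn_cong)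
      fix w assume "w \<in> ?W"
      then have "inv_into U \<psi>' w \<in> topspace (mtop S)" using US UD(2) by auto
      then show "?g (inv_into U \<psi>' w) = pchart n0 \<phi> f (graph_map \<psi> (inv_into U \<psi>' w)) i"
        using i by (auto simp: pchart_def p1_graph_map p2_graph_map)
    qed
  qed
  ultimately show ?thesis unfolding holomorphic_map_def by (auto simp: atlas_M)
qed

text \<open>Near a point of the graph, the chart sheared along \<open>f\<close> itself sends exactly
  the graph into C^n0.\<close>

lemma closed_submanifold_graph:
  assumes U: "openin (mtop S) U" and f: "\<And>j. j < n \<Longrightarrow> hol_fun_on S U (f j)"
    and cl: "closedin R (graph_map f ` U)"
  shows "closed_submanifold M (graph_map f ` U)"
  unfolding closed_submanifold_def
proof (intro conjI ballI)
  show "closedin (mtop M) (graph_map f ` U)" using cl by simp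
  fix y assume "y \<in> graph_map f ` U"
  then obtain x where x: "x \<in> U" "y = graph_map f x" by blast
  have US: "U \<subseteq> topspace (mtop S)" using U by (rule openin_subset)
  have "x \<in> topspace (mtop S)" using x US by blast
  from adapted_around[OF this] obtain n0 V \<phi> where V: "x \<in> V" "(n0, V, \<phi>) \<in> maximal_atlas S"
    by (elim exE conjE)
  \<comment> \<open>\<open>f\<close> is holomorphic only on \<open>U\<close>, so the base chart is
    shrunk before shearing.\<close>
  have ad: "adapted n0 (V \<inter> U) \<phi> f"
    unfolding adapted_def using maximal_atlas_restrict[OF V(2) U] hol_fun_on_subset[OF f] by blast
  let ?V = "pdom (V \<inter> U)" and ?\<psi> = "pchart n0 \<phi> f"
  have "(n0 + n, ?V, ?\<psi>) \<in> maximal_atlas M"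
    using pchart_in_atlas[OF ad] complex_manifoldD(7)[OF complex_manifold_M] by blast
  moreover have "y \<in> ?V" using x V US by (auto simp: pdom_def graph_map_in p1_graph_map)
  moreover have "?\<psi> ` (?V \<inter> graph_map f ` U) = ?\<psi> ` ?V \<inter> topspace (complex_space n0)"
  proof
    show "?\<psi> ` (?V \<inter> graph_map f ` U) \<subseteq> ?\<psi> ` ?V \<inter> topspace (complex_space n0)"
      using US by (auto simp: pchart_def p1_graph_map p2_graph_map subsetD)
    show "?\<psi> ` ?V \<inter> topspace (complex_space n0) \<subseteq> ?\<psi> ` (?V \<inter> graph_map f ` U)"
    proof
      fix z assume z: "z \<in> ?\<psi> ` ?V \<inter> topspace (complex_space n0)"
      then obtain y where y: "y \<in> ?V" "z = ?\<psi> y" by blast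
      have "p2 y j = f j (p1 y)" if "j < n" for j
      proof -
        have "?\<psi> y (n0 + j) = 0" using z y by auto
        then show ?thesis using that by (simp add: pchart_def)
      qed
      then have "y = graph_map f (p1 y)" using graph_map_eqI y by (auto simp: pdom_def)
      then show "z \<in> ?\<psi> ` (?V \<inter> graph_map f ` U)" using y by (auto simp: pdom_def)
    qed
  qed
  ultimately show "\<exists>(n, U', \<phi>)\<in>maximal_atlas M. y \<in> U' \<and>
      (\<exists>m\<le>n. \<phi> ` (U' \<inter> graph_map f ` U) = \<phi> ` U' \<inter> topspace (complex_space m))"
    by (intro bexI[of _ "(n0 + n, ?V, ?\<psi>)"]) (auto simp del: topspace_complex_space intro!: exI[of _ n0])
qed

section \<open>Steinness of the product\<close>

lemma compactin_holomorphic_hull: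
  assumes K: "compactin R K"
  shows "compactin R (holomorphic_hull M K)"
proof -
  have KR: "K \<subseteq> topspace R" using K by (rule compactin_subset_topspace)
  \<comment> \<open>Functions pulled back from \<open>S\<close> confine the hull to points over
    \<open>K1\<close>, and the fibre coordinates confine it to a polydisc. The hull is thus a closed
    subset of a compact product.\<close>
  define K1 where "K1 = holomorphic_hull S (p1 ` K)"
  have "compactin (mtop S) (p1 ` K)" by (rule image_compactin[OF K cont_p1])
  then have K1: "compactin (mtop S) K1" using stein by (auto simp: K1_def stein_manifold_def)
  have "\<exists>c. \<forall>y\<in>K. cmod (p2 y j) \<le> c" for j
  proof -
    have "compactin euclidean ((\<lambda>y. p2 y j) ` K)" by (rule image_compactin[OF K cont_p2_coordinate])
    then have "bounded ((\<lambda>y. p2 y j) ` K)" by (simp add: compact_imp_bounded compactin_euclidean_iff)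
    then show ?thesis by (auto simp: bounded_iff)
  qed
  then obtain c where c: "\<And>j y. y \<in> K \<Longrightarrow> cmod (p2 y j) \<le> c j" by metis
  define B where "B = (\<Pi>\<^sub>E j\<in>UNIV. if j < n then cball (0::complex) (c j) else {0})"
  have "compactin (product_topology (\<lambda>_. euclidean) UNIV) B"
    unfolding B_def compactin_PiE by (intro disjI2 ballI) (simp add: compactin_euclidean_iff)
  moreover have "B \<subseteq> topspace (complex_space n)"
  proof
    fix w assume w: "w \<in> B"
    have "w j = 0" if "j \<ge> n" for j
      using PiE_mem[OF w[unfolded B_def], of j] that by simp
    then show "w \<in> topspace (complex_space n)" by simp
  qed
  ultimately have "compactin (complex_space n) B"
    by (simp add: complex_space_def compactin_subtopology)
  then have "compactin (prod_topology (mtop S) (complex_space n)) (K1 \<times> B)"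
    using K1 by (simp add: compactin_Times)
  then have "compactin R (e ` (K1 \<times> B))" by (rule image_compactin[OF _ cont_e])
  moreover have "holomorphic_hull M K \<subseteq> e ` (K1 \<times> B)"
  proof
    fix y assume y: "y \<in> holomorphic_hull M K"
    then have yR: "y \<in> topspace R" by (simp add: holomorphic_hull_def)
    have hull: "cmod (g y) \<le> d" if "holomorphic_function M g" "\<And>y. y \<in> K \<Longrightarrow> cmod (g y) \<le> d" for g d
      using y that by (auto simp: holomorphic_hull_def)
    have "p1 y \<in> K1" unfolding K1_def holomorphic_hull_def
      using p1_in[OF yR] hull[OF holomorphic_function_p1] by auto
    moreover have "p2 y \<in> B" unfolding B_def
    proof (rule PiE_I)
      show "p2 y j \<in> (if j < n then cball 0 (c j) else {0})" for j
        using hull[OF holomorphic_function_p2 c] p2_in[OF yR] by auto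
    qed simp
    ultimately show "y \<in> e ` (K1 \<times> B)" using e_p[OF yR] by force
  qed
  ultimately show ?thesis
    using closedin_holomorphic_hull[of M K] closed_compactin by fastforce
qed

lemma stein_manifold_M: "stein_manifold M"
  unfolding stein_manifold_def
proof (intro conjI allI impI ballI)
  show "complex_manifold M" by (rule complex_manifold_M)
  show "compactin (mtop M) (holomorphic_hull M K)" if "compactin (mtop M) K" for K
    using that compactin_holomorphic_hull by simp
  show "\<exists>f. holomorphic_function M f \<and> f x \<noteq> f y"
    if x: "x \<in> topspace (mtop M)" and y: "y \<in> topspace (mtop M)" and "x \<noteq> y" for x y
  proof (cases "p1 x = p1 y")
    case False
    moreover have "p1 x \<in> topspace (mtop S)" "p1 y \<in> topspace (mtop S)" using x y p1_in by auto
    ultimately obtain g where "holomorphic_function S g" "g (p1 x) \<noteq> g (p1 y)"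
      using stein unfolding stein_manifold_def by metis
    then show ?thesis using holomorphic_function_p1 by blast
  next
    case True
    have "p2 x \<noteq> p2 y" using True \<open>x \<noteq> y\<close> e_p x y by (metis mtop_M)
    then obtain j where j: "p2 x j \<noteq> p2 y j" by blast
    then have "j < n" using p2_in x y by (metis (mono_tags, lifting) mem_Collect_eq mtop_M not_less topspace_complex_space)
    then show ?thesis using holomorphic_function_p2 j by blast
  qed
  fix y assume y: "y \<in> topspace (mtop M)"
  then have "p1 y \<in> topspace (mtop S)" using p1_in by simp
  moreover have "\<forall>x\<in>topspace (mtop S). \<exists>n U f. x \<in> U \<and> (\<forall>i<n. holomorphic_function S (f i)) \<and>
      (n, U, \<lambda>y i. if i < n then f i y else 0) \<in> maximal_atlas S"
    using stein unfolding stein_manifold_def by (elim conjE)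
  ultimately have "\<exists>n U f. p1 y \<in> U \<and> (\<forall>i<n. holomorphic_function S (f i)) \<and>
      (n, U, \<lambda>y i. if i < n then f i y else 0) \<in> maximal_atlas S"
    by (rule bspec[rotated])
  then obtain n0 U f where U: "p1 y \<in> U" "\<forall>i<n0. holomorphic_function S (f i)"
    "(n0, U, \<lambda>x i. if i < n0 then f i x else 0) \<in> maximal_atlas S"
    by (elim exE conjE)
  let ?F = "\<lambda>i y. if i < n0 then f i (p1 y) else p2 y (i - n0)"
  let ?\<phi> = "\<lambda>x i. if i < n0 then f i x else 0"
  have "hol_fun_on S U (\<lambda>_. 0)"
    by (rule hol_fun_on_cdiffI) (simp_all add: cdiff_const)
  \<comment> \<open>With zero shear over a chart of global functions on \<open>S\<close>, all
    coordinates on the product are global: the functions composed with \<open>p1\<close>, and the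
    fibre coordinates.\<close>
  then have ad: "adapted n0 U ?\<phi> (\<lambda>_ _. 0)" using U by (simp add: adapted_def)
  have "(\<lambda>y i. if i < n0 + n then ?F i y else 0) = pchart n0 ?\<phi> (\<lambda>_ _. 0)"
    by (auto simp: pchart_def fun_eq_iff)
  moreover have "(n0 + n, pdom U, pchart n0 ?\<phi> (\<lambda>_ _. 0)) \<in> maximal_atlas M"
    using pchart_in_atlas[OF ad] complex_manifoldD(7)[OF complex_manifold_M] by blast
  moreover have "holomorphic_function M (?F i)" if "i < n0 + n" for i
    using that U(2) holomorphic_function_p1[of "f i"] holomorphic_function_p2[of "i - n0"] by (cases "i < n0") auto
  moreover have "y \<in> pdom U" using y U by (simp add: pdom_def)
  ultimately show "\<exists>n U f. y \<in> U \<and> (\<forall>i<n. holomorphic_function M (f i)) \<and>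
      (n, U, \<lambda>y i. if i < n then f i y else 0) \<in> maximal_atlas M"
    by (intro exI[of _ "n0 + n"] exI[of _ "pdom U"] exI[of _ ?F]) simp
qed

end

section \<open>A proper holomorphic map from the disc to complex 2-space\<close>

text \<open>The lacunary exponents make a single term dominate on each annulus, alternately in the series
  with \<open>b = 0\<close> and with \<open>b = 1\<close>; so \<open>(gap_series 0, gap_series 1)\<close> maps the unit disc properly to
  $\mathbb C^2$.\<close>

definition gap_term :: "nat \<Rightarrow> complex \<Rightarrow> nat \<Rightarrow> complex"
  where "gap_term b z i = 3 ^ (2 * i + b) * z ^ (8 ^ (2 * i + b))"

definition gap_series :: "nat \<Rightarrow> complex \<Rightarrow> complex"
  where "gap_series b z = (\<Sum>i. gap_term b z i)"

lemma norm_gap_term: "norm (gap_term b z i) = 3 ^ (2 * i + b) * norm z ^ (8 ^ (2 * i + b))"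
  by (simp add: gap_term_def norm_mult norm_power)

lemma summable_gap_bound:
  assumes "0 \<le> r" "r < (1::real)"
  shows "summable (\<lambda>i. 3 ^ (2 * i + b) * r ^ (8 ^ (2 * i + b)))"
proof -
  have "(\<lambda>k. r ^ k) \<longlonglongrightarrow> 0" using assms by (intro LIMSEQ_realpow_zero) auto
  \<comment> \<open>Consecutive bounds have ratio \<open>9 * r ^ (63 * k)\<close> with
    \<open>k = 8 ^ (2 * i + b)\<close>, since the exponent grows from \<open>k\<close> to
    \<open>64 * k\<close>. The threshold 1/18 makes this ratio at most 1/2.\<close>
  then have "\<forall>\<^sub>F k in sequentially. r ^ k < 1 / 18" by (rule order_tendstoD(2)) simp
  then obtain N where N: "\<And>k. k \<ge> N \<Longrightarrow> r ^ k < 1 / 18" unfolding eventually_sequentially by blast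
  show ?thesis
  proof (rule summable_ratio_test[where c = "1/2" and N = N])
    fix i assume "i \<ge> N"
    define k where "k = (8 :: nat) ^ (2 * i + b)"
    have "i < 8 ^ i" by (rule less_exp[of i, THEN order_less_le_trans]) (simp add: power_mono)
    moreover have "(8::nat) ^ i \<le> k" unfolding k_def by (rule power_increasing) auto
    ultimately have kN: "63 * k \<ge> N" using \<open>i \<ge> N\<close> by linarith
    have e: "(8 :: nat) ^ (2 * Suc i + b) = 63 * k + k" by (simp add: k_def)
    have "3 ^ (2 * Suc i + b) * r ^ (8 ^ (2 * Suc i + b)) = (9 * r ^ (63 * k)) * (3 ^ (2 * i + b) * r ^ k)"
      unfolding e power_add[of r] by simp
    also have "\<dots> \<le> (1/2) * (3 ^ (2 * i + b) * r ^ k)"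
      using N[OF kN] assms by (intro mult_right_mono) auto
    finally show "norm (3 ^ (2 * Suc i + b) * r ^ (8 ^ (2 * Suc i + b)))
        \<le> 1/2 * norm (3 ^ (2 * i + b) * r ^ (8 ^ (2 * i + b)))"
      using assms by (simp add: k_def)
  qed simp
qed

lemma summable_norm_gap_term: "norm z < 1 \<Longrightarrow> summable (\<lambda>i. norm (gap_term b z i))"
  unfolding norm_gap_term by (rule summable_gap_bound) auto

text \<open>Weierstrass M-test on a disc of radius below 1. The partial sums are polynomials, hence
  usable beyond the unit disc, and later supply the maps defined on all of \<open>S\<close>.\<close>

lemma gap_series_uniform_limit:
  assumes "r < 1"
  shows "uniform_limit {z. norm z \<le> r} (\<lambda>N z. \<Sum>i<N. gap_term b z i) (gap_series b) sequentially"
proof (cases "r \<ge> 0")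
  case True
  show ?thesis unfolding gap_series_def[abs_def]
  proof (rule Weierstrass_m_test[OF _ summable_gap_bound[OF True assms]])
    fix i z assume "z \<in> {z::complex. norm z \<le> r}"
    then show "norm (gap_term b z i) \<le> 3 ^ (2 * i + b) * r ^ (8 ^ (2 * i + b))"
      unfolding norm_gap_term by (intro mult_left_mono power_mono) auto
  qed
next
  case False
  then have "{z::complex. norm z \<le> r} = {}" by (auto dest: order_trans[OF norm_ge_zero])
  then show ?thesis by (simp add: uniform_limit_iff)
qed

lemma holomorphic_gap_partial_sum: "(\<lambda>z. \<Sum>i<N. gap_term b z i) holomorphic_on A"
  unfolding gap_term_def by (intro holomorphic_intros)

lemma holomorphic_gap_series: "gap_series b holomorphic_on ball 0 1"
proof (rule holomorphic_uniform_sequence[OF open_ball])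
  show "(\<lambda>z. \<Sum>i<N. gap_term b z i) holomorphic_on ball 0 1" for N
    by (rule holomorphic_gap_partial_sum)
  fix z :: complex assume z: "z \<in> ball 0 1"
  define d where "d = (1 - norm z) / 2"
  have d: "d > 0" "norm z + d < 1" using z by (auto simp: d_def field_simps)
  have sub: "cball z d \<subseteq> {w. norm w \<le> norm z + d}"
  proof
    fix w assume "w \<in> cball z d"
    then have "norm (w - z) \<le> d" by (simp add: dist_norm norm_minus_commute)
    then show "w \<in> {w. norm w \<le> norm z + d}" using norm_triangle_sub[of w z] by simp
  qed
  have "uniform_limit (cball z d) (\<lambda>N z. \<Sum>i<N. gap_term b z i) (gap_series b) sequentially"
    by (rule uniform_limit_on_subset[OF gap_series_uniform_limit[OF d(2)] sub])
  moreover have "cball z d \<subseteq> ball 0 1" using sub d by auto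
  ultimately show "\<exists>d>0. cball z d \<subseteq> ball 0 1 \<and>
      uniform_limit (cball z d) (\<lambda>N z. \<Sum>i<N. gap_term b z i) (gap_series b) sequentially"
    using d by blast
qed

lemma sum_nine_power: "8 * (\<Sum>i<m. (9::real) ^ i) = 9 ^ m - 1"
  by (induction m) (auto simp: algebra_simps)

text \<open>On this annulus the term of exponent \<open>8 ^ k\<close> has modulus at least
  \<open>3 ^ k / 2\<close>, while the earlier terms and the later terms of the same series each sum
  to at most \<open>3 ^ k / 8\<close>. The term of index \<open>k + 1\<close> could be of comparable
  size and cancel it; separating the parities puts that term into the other series.\<close>

lemma gap_series_lower_bound:
  assumes z: "norm z < 1" and k: "k = 2 * m + b"
    and lo: "norm z ^ (8 ^ k) \<ge> 1/2" and hi: "norm z ^ (8 ^ Suc k) < 1/2"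
  shows "norm (gap_series b z) \<ge> 3 ^ k / 4"
proof -
  let ?t = "gap_term b z"
  note sm = summable_norm_gap_term[OF z, of b]
  have sm': "summable ?t" using sm by (rule summable_norm_cancel)
  have "gap_series b z = (\<Sum>i. ?t (i + Suc m)) + (\<Sum>i<Suc m. ?t i)"
    unfolding gap_series_def by (rule suminf_split_initial_segment[OF sm'])
  then have split: "?t m = gap_series b z - (\<Sum>i. ?t (i + Suc m)) - (\<Sum>i<m. ?t i)" by simp
  have main: "norm (?t m) \<ge> 3 ^ k / 2"
    using lo by (simp add: norm_gap_term k)
  \<comment> \<open>Inside the disc the earlier terms are bounded by their coefficients, a geometric
    progression with ratio 9.\<close>
  have "norm (\<Sum>i<m. ?t i) \<le> (\<Sum>i<m. 3 ^ b * 9 ^ i)"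
  proof (rule sum_norm_le)
    fix i
    have "norm (?t i) \<le> 3 ^ (2 * i + b) * 1"
      unfolding norm_gap_term using z by (intro mult_left_mono power_le_one) auto
    also have "\<dots> = 3 ^ b * 9 ^ i" by (simp add: power_add power_mult)
    finally show "norm (?t i) \<le> 3 ^ b * 9 ^ i" .
  qed
  also have "\<dots> = 3 ^ b * (\<Sum>i<m. 9 ^ i)" by (simp add: sum_distrib_left)
  also have "\<dots> \<le> 3 ^ b * (9 ^ m / 8)" using sum_nine_power[of m] by (intro mult_left_mono) auto
  also have "\<dots> = 3 ^ k / 8" by (simp add: k power_add power_mult)
  finally have low: "norm (\<Sum>i<m. ?t i) \<le> 3 ^ k / 8" .
  \<comment> \<open>The exponent is \<open>8 ^ Suc k\<close> times \<open>8 ^ Suc (2 * i)\<close>,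
    and the latter is at least \<open>8 * Suc i\<close>. As |z| to the power
    \<open>8 ^ Suc k\<close> is below 1/2, each step costs (1/2)^8 = 1/256 against a growth of 9 in
    the coefficient.\<close>
  have tail_le: "norm (?t (i + Suc m)) \<le> 3 ^ k * (9/256) ^ Suc i" for i
  proof -
    have e: "2 * (i + Suc m) + b = Suc k + Suc (2 * i)" by (simp add: k)
    have "8 * Suc i \<le> (8::nat) ^ Suc (2 * i)"
    proof -
      have "Suc i \<le> 2 ^ i" by (induction i) auto
      also have "\<dots> \<le> (64::nat) ^ i" by (rule power_mono) auto
      finally show ?thesis by (simp add: power_mult)
    qed
    then have "norm z ^ (8 ^ (Suc k + Suc (2 * i))) \<le> (norm z ^ (8 ^ Suc k)) ^ (8 * Suc i)"
      unfolding power_add power_mult[symmetric]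
      by (intro power_decreasing mult_left_mono) (use z in auto)
    also have "\<dots> \<le> (1/2) ^ (8 * Suc i)" using hi by (intro power_mono) auto
    also have "\<dots> = (1/256) ^ Suc i" unfolding power_mult by (simp add: power_divide)
    finally have "norm (?t (i + Suc m)) \<le> 3 ^ (Suc k + Suc (2 * i)) * (1/256) ^ Suc i"
      unfolding norm_gap_term e by (intro mult_left_mono) auto
    also have "(3::real) ^ (Suc k + Suc (2 * i)) = 3 ^ k * 9 ^ Suc i"
      by (simp add: power_add power_mult)
    finally show ?thesis by (simp add: power_mult_distrib power_divide)
  qed
  have geo: "(\<lambda>i. 3 ^ k * (9/256 :: real) ^ Suc i) sums (3 ^ k * (9/256 * (1 / (1 - 9/256))))"
    using sums_mult[OF sums_mult[OF geometric_sums[of "9/256::real"], of "9/256"], of "3^k"] by simp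
  have "norm (\<Sum>i. ?t (i + Suc m)) \<le> (\<Sum>i. norm (?t (i + Suc m)))"
    by (rule summable_norm) (use sm summable_iff_shift[of "\<lambda>i. norm (?t i)" "Suc m"] in simp)
  also have "\<dots> \<le> (\<Sum>i. 3 ^ k * (9/256 :: real) ^ Suc i)"
    by (rule suminf_le[OF tail_le]) (use sm summable_iff_shift[of "\<lambda>i. norm (?t i)" "Suc m"] geo in \<open>auto simp: sums_iff\<close>)
  also have "\<dots> = 3 ^ k * (9/256 * (1 / (1 - 9/256)))" using geo by (simp add: sums_iff)
  also have "\<dots> \<le> 3 ^ k / 8" by simp
  finally have high: "norm (\<Sum>i. ?t (i + Suc m)) \<le> 3 ^ k / 8" .
  have "norm (?t m) \<le> norm (gap_series b z) + norm (\<Sum>i. ?t (i + Suc m)) + norm (\<Sum>i<m. ?t i)"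
    unfolding split by (smt (verit) norm_triangle_ineq4)
  then show ?thesis using main low high by linarith
qed

text \<open>The annuli of \<open>gap_series_lower_bound\<close> exhaust the disc near the circle:
  \<open>k + 1\<close> is the first index at which |z| to the power \<open>8 ^ (k + 1)\<close> drops
  below 1/2. Closeness to the circle makes \<open>k\<close> large, and the parity of
  \<open>k\<close> selects the series.\<close>

lemma gap_series_proper:
  obtains r where "r < 1" "\<And>z. r < norm z \<Longrightarrow> norm z < 1 \<Longrightarrow> \<exists>b<2. norm (gap_series b z) > B"
proof -
  obtain k0 :: nat where k0: "4 * B + 1 < 3 ^ k0" using real_arch_pow[of 3 "4 * B + 1"] by auto
  \<comment> \<open>With this radius |z| > r forces the power of exponent \<open>8 ^ k0\<close> to
    be at least 1/2, so the drop happens after \<open>k0\<close>, where \<open>3 ^ k / 4\<close>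
    already exceeds \<open>B\<close>.\<close>
  define r where "r = root (8 ^ k0) (1/2 :: real)"
  have r: "0 < r" "r < 1" by (auto simp: r_def real_root_lt_1_iff)
  have rk: "r ^ (8 ^ k0) = 1/2" by (simp add: r_def)
  show ?thesis
  proof (rule that[OF r(2)])
    fix z :: complex assume z: "r < norm z" "norm z < 1"
    let ?P = "\<lambda>k. norm z ^ (8 ^ k) < 1/2"
    have dec: "norm z ^ (8 ^ k) \<ge> 1/2" if "k \<le> k0" for k
    proof -
      have "1/2 \<le> norm z ^ (8 ^ k0)" unfolding rk[symmetric] using r z by (intro power_mono) auto
      also have "\<dots> \<le> norm z ^ (8 ^ k)" by (rule power_decreasing) (use that z in \<open>auto intro: power_increasing\<close>)
      finally show ?thesis .
    qed
    have "(\<lambda>k. norm z ^ k) \<longlonglongrightarrow> 0" using z by (intro LIMSEQ_realpow_zero) auto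
    then have "\<forall>\<^sub>F k in sequentially. norm z ^ k < 1/2" by (rule order_tendstoD(2)) simp
    then obtain N where N: "\<And>k. k \<ge> N \<Longrightarrow> norm z ^ k < 1/2" unfolding eventually_sequentially by blast
    have "N < 8 ^ N" by (rule less_exp[of N, THEN order_less_le_trans]) (simp add: power_mono)
    then have PN: "?P N" using N[of "8 ^ N"] by simp
    define k' where "k' = (LEAST k. ?P k)"
    have Pk': "?P k'" unfolding k'_def by (rule LeastI[of ?P, OF PN])
    have "k' > k0" using dec[of k'] Pk' by (cases "k' \<le> k0") auto
    then obtain k where k: "k' = Suc k" by (cases k') auto
    have nP: "norm z ^ (8 ^ k) \<ge> 1/2" using not_less_Least[of k ?P] k by (simp add: k'_def not_less)
    have "k = 2 * (k div 2) + k mod 2" by simp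
    from gap_series_lower_bound[OF z(2) this nP] Pk'
    have "norm (gap_series (k mod 2) z) \<ge> 3 ^ k / 4" by (simp add: k)
    moreover have "(3::real) ^ k0 \<le> 3 ^ k" using \<open>k' > k0\<close> k by (intro power_increasing) auto
    ultimately have "norm (gap_series (k mod 2) z) > B" using k0 by linarith
    then show "\<exists>b<2. norm (gap_series b z) > B" by (intro exI[of _ "k mod 2"]) simp
  qed
qed

section \<open>Polyhedra and spaces of continuum cardinality\<close>

text \<open>The realization is the finite union of the closed simplices \<open>F \<sigma>\<close>,
  each a compact cube cut by a closed hyperplane. That these stay inside the realization uses
  closure under faces: the support of a point of \<open>F \<sigma>\<close> is a nonempty face of
  \<open>\<sigma>\<close>.\<close>

lemma compactin_realization:
  assumes "finite_simplicial_complex C"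
  shows "compactin (powertop_real UNIV) (realization C)"
proof -
  define F where "F \<sigma> = {x :: nat \<Rightarrow> real. (\<forall>i. x i \<in> (if i \<in> \<sigma> then {0..1} else {0})) \<and> (\<Sum>i\<in>\<sigma>. x i) = 1}" for \<sigma>
  have C: "finite C" "\<And>\<sigma>. \<sigma> \<in> C \<Longrightarrow> finite \<sigma>" "\<And>\<sigma> \<tau>. \<sigma> \<in> C \<Longrightarrow> \<tau> \<subseteq> \<sigma> \<Longrightarrow> \<tau> \<noteq> {} \<Longrightarrow> \<tau> \<in> C"
    using assms unfolding finite_simplicial_complex_def by blast+
  have eq: "realization C = (\<Union>\<sigma>\<in>C. F \<sigma>)"
  proof
    show "realization C \<subseteq> (\<Union>\<sigma>\<in>C. F \<sigma>)"
    proof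
      fix x assume x: "x \<in> realization C"
      let ?s = "{i. x i \<noteq> 0}"
      have s: "?s \<in> C" "\<And>i. 0 \<le> x i" "(\<Sum>i\<in>?s. x i) = 1" using x by (auto simp: realization_def)
      have "x i \<le> 1" for i
      proof (cases "i \<in> ?s")
        case True
        then have "x i \<le> (\<Sum>i\<in>?s. x i)" using s C by (intro member_le_sum) auto
        then show ?thesis using s by simp
      qed auto
      then have "x \<in> F ?s" using s by (auto simp: F_def)
      then show "x \<in> (\<Union>\<sigma>\<in>C. F \<sigma>)" using s by blast
    qed
    show "(\<Union>\<sigma>\<in>C. F \<sigma>) \<subseteq> realization C"
    proof
      fix x assume "x \<in> (\<Union>\<sigma>\<in>C. F \<sigma>)"
      then obtain \<sigma> where \<sigma>: "\<sigma> \<in> C" "x \<in> F \<sigma>" by blast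
      have xi: "x i \<in> (if i \<in> \<sigma> then {0..1} else {0})" for i using \<sigma> by (simp add: F_def)
      have nn: "0 \<le> x i" for i using xi[of i] by (auto split: if_splits)
      have "i \<in> \<sigma>" if "x i \<noteq> 0" for i using xi[of i] that by (auto split: if_splits)
      then have sub: "{i. x i \<noteq> 0} \<subseteq> \<sigma>" by blast
      have "(\<Sum>i | x i \<noteq> 0. x i) = (\<Sum>i\<in>\<sigma>. x i)"
        by (rule sum.mono_neutral_left) (use sub C(2) \<sigma> in auto)
      then have sum1: "(\<Sum>i | x i \<noteq> 0. x i) = 1" using \<sigma> by (simp add: F_def)
      then have "{i. x i \<noteq> 0} \<noteq> {}" by (metis sum.empty zero_neq_one)
      then have "{i. x i \<noteq> 0} \<in> C" using C(3)[OF \<sigma>(1) sub] by blast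
      then show "x \<in> realization C" using nn sum1 by (simp add: realization_def)
    qed
  qed
  have "compactin (powertop_real UNIV) (F \<sigma>)" for \<sigma>
  proof -
    let ?B = "\<Pi>\<^sub>E i\<in>UNIV. (if i \<in> \<sigma> then {0..1} else {0::real})"
    have "compactin (powertop_real UNIV) ?B"
      unfolding compactin_PiE by (intro disjI2 ballI) (simp add: compactin_euclidean_iff)
    moreover have "closedin (powertop_real UNIV) {x \<in> topspace (powertop_real UNIV). (\<Sum>i\<in>\<sigma>. x i) \<in> {1}}"
    proof (rule closedin_continuous_map_preimage)
      show "continuous_map (powertop_real UNIV) euclideanreal (\<lambda>x. \<Sum>i\<in>\<sigma>. x i)"
        by (cases "finite \<sigma>") (auto intro!: continuous_map_sum continuous_map_product_projection)
    qed simp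
    moreover have "F \<sigma> = ?B \<inter> {x \<in> topspace (powertop_real UNIV). (\<Sum>i\<in>\<sigma>. x i) \<in> {1}}"
      unfolding F_def by (simp add: PiE_UNIV_domain Pi_def set_eq_iff)
    ultimately show ?thesis by (simp add: compact_Int_closedin)
  qed
  then show ?thesis unfolding eq using C(1) by (intro compactin_Union[of "F ` C"]) auto
qed

text \<open>A point is determined by the set of basic open sets containing it, by the Hausdorff
  property; for a countable basis this is a set of natural numbers, encoded by a real.\<close>

lemma second_countable_Hausdorff_lepoll_real:
  assumes "second_countable X" "Hausdorff_space X"
  obtains e :: "'a \<Rightarrow> real" where "inj_on e (topspace X)"
proof -
  obtain B where B: "countable B" "\<And>U x. openin X U \<Longrightarrow> x \<in> U \<Longrightarrow> \<exists>V\<in>B. x \<in> V \<and> V \<subseteq> U"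
    using assms(1) unfolding second_countable_def by metis
  obtain g :: "nat set \<Rightarrow> real" where g: "inj g"
    using nat_sets_eqpoll_reals unfolding eqpoll_def bij_betw_def by blast
  define s where "s x = to_nat_on B ` {V \<in> B. x \<in> V}" for x
  have "inj_on s (topspace X)"
  proof (rule inj_onI, rule ccontr)
    fix x y assume xy: "x \<in> topspace X" "y \<in> topspace X" "s x = s y" "x \<noteq> y"
    then obtain U V where "openin X U" "x \<in> U" "openin X V" "y \<in> V" "disjnt U V"
      using assms(2) unfolding Hausdorff_space_def by metis
    then obtain W where W: "W \<in> B" "x \<in> W" "y \<notin> W" using B(2) unfolding disjnt_iff by blast
    then have "to_nat_on B W \<in> s y" using xy by (auto simp: s_def)
    then obtain W' where "W' \<in> B" "y \<in> W'" "to_nat_on B W = to_nat_on B W'" by (auto simp: s_def)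
    then have "W = W'" using W B(1) by simp
    then show False using W \<open>y \<in> W'\<close> by simp
  qed
  then have "inj_on (g \<circ> s) (topspace X)" using g by (intro comp_inj_on) (auto intro: inj_on_subset)
  then show ?thesis using that by blast
qed

lemma homeomorphic_copy:
  assumes "inj_on e (topspace X)"
  obtains R q where "homeomorphic_maps X R e q"
proof -
  define q where "q = inv_into (topspace X) e"
  define R where "R = pullback_topology (e ` topspace X) q X"
  have qe: "q (e x) = x" if "x \<in> topspace X" for x using that assms by (simp add: q_def)
  have top: "topspace R = e ` topspace X"
    using qe by (auto simp: R_def topspace_pullback_topology)
  have "continuous_map R X q"
    using continuous_map_pullback[OF continuous_map_id, of "e ` topspace X" q X] by (simp add: R_def)
  moreover have "continuous_map X R e"
    unfolding continuous_map_def
  proof (intro conjI allI impI)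
    show "e \<in> topspace X \<rightarrow> topspace R" using top by auto
    fix U assume "openin R U"
    then obtain V where V: "openin X V" "U = q -` V \<inter> e ` topspace X"
      by (auto simp: R_def openin_pullback_topology)
    have "e x \<in> U \<longleftrightarrow> x \<in> V" if "x \<in> topspace X" for x
      using that qe[OF that] by (simp add: V(2))
    then have "{x \<in> topspace X. e x \<in> U} = V" using openin_subset[OF V(1)] by blast
    then show "openin X {x \<in> topspace X. e x \<in> U}" using V by simp
  qed
  ultimately have "homeomorphic_maps X R e q"
    unfolding homeomorphic_maps_def using qe top by auto
  then show ?thesis using that by blast
qed

section \<open>Approximation\<close>

text \<open>Points of C^n agree from index \<open>n\<close> on, so only the first \<open>n\<close>
  radii of a product neighbourhood matter and they have a positive minimum.\<close>

lemma openin_complex_space_box: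
  assumes "openin (complex_space n) B" "w \<in> B"
  shows "\<exists>\<delta>>0. \<forall>w'\<in>topspace (complex_space n). (\<forall>j<n. cmod (w' j - w j) < \<delta>) \<longrightarrow> w' \<in> B"
proof -
  obtain A where A: "openin (product_topology (\<lambda>_. euclidean) UNIV) A" "B = A \<inter> topspace (complex_space n)"
    using assms(1) unfolding complex_space_def openin_subtopology by auto
  have wn: "w \<in> topspace (complex_space n)" and "w \<in> A" using assms(2) A(2) by auto
  then obtain U where U: "\<And>j. open (U j)" "w \<in> Pi\<^sub>E UNIV U" "Pi\<^sub>E UNIV U \<subseteq> A"
    using A(1) unfolding openin_product_topology_alt by (metis UNIV_I open_openin)
  have "\<exists>r>0. ball (w j) r \<subseteq> U j" for j
    using U(1,2) by (metis PiE_mem UNIV_I open_contains_ball)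
  then obtain r where r: "\<And>j. r j > 0" "\<And>j. ball (w j) (r j) \<subseteq> U j" by metis
  define \<delta> where "\<delta> = Min (insert 1 (r ` {..<n}))"
  have \<delta>: "\<delta> > 0" "\<And>j. j < n \<Longrightarrow> \<delta> \<le> r j" using r(1) by (auto simp: \<delta>_def)
  show ?thesis
  proof (intro exI[of _ \<delta>] conjI ballI impI, fact \<delta>(1))
    fix w' assume w': "w' \<in> topspace (complex_space n)" "\<forall>j<n. cmod (w' j - w j) < \<delta>"
    have "w' j \<in> U j" for j
    proof (cases "j < n")
      case True
      then have "w' j \<in> ball (w j) (r j)"
        using w'(2)[rule_format, OF True] \<delta>(2)[OF True] by (simp add: dist_norm norm_minus_commute)
      then show ?thesis using r(2) by blast
    next
      case False
      then have "w' j = w j" using w'(1) wn by simp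
      then show ?thesis using r by (metis centre_in_ball subsetD)
    qed
    then have "w' \<in> A" using U(3) by blast
    then show "w' \<in> B" using A(2) w'(1) by blast
  qed
qed

text \<open>Continuity of \<open>f\<close> absorbs the move from \<open>x\<close> to
  \<open>x'\<close>, uniform convergence on \<open>K\<close> the change from \<open>f\<close> to
  \<open>g N\<close>, each at a cost of \<delta>/2. \<open>N0\<close> serves all points of
  \<open>B\<close> in \<open>K\<close> at once, as the later compactness argument needs.\<close>

lemma (in stein_times_Cn) graph_map_nearby:
  assumes U: "openin (mtop S) U" "x \<in> U" and f: "\<And>j. j < n \<Longrightarrow> hol_fun_on S U (f j)"
    and lim: "\<And>\<delta>. \<delta> > 0 \<Longrightarrow> \<exists>N0. \<forall>N\<ge>N0. \<forall>j<n. \<forall>x\<in>K. cmod (g N j x - f j x) < \<delta>"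
    and A: "openin R A" "graph_map f x \<in> A"
  obtains B N0 where "openin (mtop S) B" "x \<in> B" "\<And>N x'. N \<ge> N0 \<Longrightarrow> x' \<in> B \<Longrightarrow> x' \<in> K \<Longrightarrow> graph_map (g N) x' \<in> A"
proof -
  let ?P = "prod_topology (mtop S) (complex_space n)"
  have US: "U \<subseteq> topspace (mtop S)" using U(1) by (rule openin_subset)
  have "openin ?P {z \<in> topspace ?P. e z \<in> A}" using cont_e A(1) by (rule openin_continuous_map_preimage)
  moreover have "(x, trunc_coords n (\<lambda>j. f j x)) \<in> {z \<in> topspace ?P. e z \<in> A}"
    using A(2) U US trunc_coords_in[of n "\<lambda>j. f j x"]
    by (auto simp: graph_map_def simp del: topspace_complex_space)
  ultimately have "\<exists>B1 B2. openin (mtop S) B1 \<and> openin (complex_space n) B2 \<and> x \<in> B1 \<and>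
      trunc_coords n (\<lambda>j. f j x) \<in> B2 \<and> B1 \<times> B2 \<subseteq> {z \<in> topspace ?P. e z \<in> A}"
    unfolding openin_prod_topology_alt by (elim allE impE)
  then obtain B1 B2 where B: "openin (mtop S) B1" "openin (complex_space n) B2" "x \<in> B1"
    "trunc_coords n (\<lambda>j. f j x) \<in> B2" "B1 \<times> B2 \<subseteq> {z \<in> topspace ?P. e z \<in> A}"
    by (elim exE conjE)
  obtain \<delta> where \<delta>: "\<delta> > 0" "\<forall>w'\<in>topspace (complex_space n).
      (\<forall>j<n. cmod (w' j - trunc_coords n (\<lambda>j. f j x) j) < \<delta>) \<longrightarrow> w' \<in> B2"
    using openin_complex_space_box[OF B(2,4)] by (elim exE conjE)
  obtain N0 where N0: "\<And>N j x. N \<ge> N0 \<Longrightarrow> j < n \<Longrightarrow> x \<in> K \<Longrightarrow> cmod (g N j x - f j x) < \<delta>/2"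
    using lim[of "\<delta>/2"] \<delta>(1) by auto
  define B3 where "B3 j = {x' \<in> U. f j x' \<in> ball (f j x) (\<delta>/2)}" for j
  have "openin (mtop S) (B3 j)" if "j < n" for j
  proof -
    have "continuous_map (subtopology (mtop S) U) euclidean (f j)" using f[OF that] by (simp add: hol_fun_on_def)
    then have "openin (subtopology (mtop S) U) {x' \<in> topspace (subtopology (mtop S) U). f j x' \<in> ball (f j x) (\<delta>/2)}"
      by (rule openin_continuous_map_preimage) simp
    moreover have "{x' \<in> topspace (subtopology (mtop S) U). f j x' \<in> ball (f j x) (\<delta>/2)} = B3 j"
      using US by (auto simp: B3_def)
    ultimately show ?thesis using U(1) by (simp add: openin_open_subtopology)
  qed
  then have "openin (mtop S) (\<Inter> (insert B1 (B3 ` {..<n})))"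
    using B(1) by (intro openin_Inter) auto
  moreover have "x \<in> \<Inter> (insert B1 (B3 ` {..<n}))" using B(3) U \<delta>(1) by (auto simp: B3_def)
  moreover have "graph_map (g N) x' \<in> A" if N: "N \<ge> N0" and x': "x' \<in> \<Inter> (insert B1 (B3 ` {..<n}))" "x' \<in> K" for N x'
  proof -
    have "trunc_coords n (\<lambda>j. g N j x') \<in> B2"
    proof (intro \<delta>(2)[rule_format, OF trunc_coords_in])
      fix j assume j: "j < n"
      then have "dist (f j x) (f j x') < \<delta>/2" using x' by (auto simp: B3_def)
      moreover have "dist (g N j x') (f j x') < \<delta>/2" using N0[OF N j x'(2)] by (simp add: dist_norm)
      ultimately have "dist (g N j x') (f j x) < \<delta>" by (metis dist_commute dist_triangle_half_l)
      then show "cmod (trunc_coords n (\<lambda>j. g N j x') j - trunc_coords n (\<lambda>j. f j x) j) < \<delta>"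
        using j by (simp add: dist_norm)
    qed
    then have "(x', trunc_coords n (\<lambda>j. g N j x')) \<in> B1 \<times> B2" using x' by blast
    then show ?thesis using B(5) unfolding graph_map_def by blast
  qed
  ultimately show ?thesis using that by blast
qed

lemma holomorphic_function_compose_entire:
  assumes "complex_manifold M" "holomorphic_function M f" "g holomorphic_on UNIV"
  shows "holomorphic_function M (\<lambda>x. g (f x))"
  by (rule hol_fun_on_imp_holomorphic_function[OF assms(1)],
      rule hol_fun_on_compose_holomorphic[OF holomorphic_function_imp_hol_fun_on[OF assms(1,2)] assms(3)]) auto

section \<open>Analytic polyhedra around holomorphically convex compact sets\<close>

lemma separating_function_off_hull:
  assumes M: "complex_manifold M" and y: "y \<in> topspace (mtop M)" "y \<notin> holomorphic_hull M K"
  obtains g \<rho> where "holomorphic_function M g" "cmod (g y) > 1" "\<rho> < 1" "\<And>x. x \<in> K \<Longrightarrow> cmod (g x) \<le> \<rho>"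
proof -
  obtain f c where f: "holomorphic_function M f" "\<And>x. x \<in> K \<Longrightarrow> cmod (f x) \<le> c" "c < cmod (f y)"
    using y unfolding holomorphic_hull_def by force
  show ?thesis
  \<comment> \<open>A negative bound on moduli is possible only for empty \<open>K\<close>; a
    constant above 1 then separates. Otherwise \<open>f\<close> is divided by a number strictly
    between its bound on \<open>K\<close> and its modulus at \<open>y\<close>.\<close>
  proof (cases "c < 0")
    case True
    then have "K = {}" using f(2) by (metis all_not_in_conv norm_ge_zero not_le order_trans)
    moreover have "holomorphic_function M (\<lambda>x. (\<lambda>_. 2) (f x))"
      by (rule holomorphic_function_compose_entire[OF M f(1)]) (rule holomorphic_on_const)
    ultimately show ?thesis using that[of "\<lambda>x. 2" 0] by simp
  next
    case False
    obtain a where a: "c < a" "a < cmod (f y)" using dense[OF f(3)] by blast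
    have "holomorphic_function M (\<lambda>x. (\<lambda>w. w / complex_of_real a) (f x))"
      by (rule holomorphic_function_compose_entire[OF M f(1)]) (use a False in \<open>auto intro!: holomorphic_intros\<close>)
    then show ?thesis
      by (rule that[of _ "c / a"]) (use a False f(2) in \<open>auto simp: norm_divide divide_simps\<close>)
  qed
qed

text \<open>The set \<open>L - V\<close> is compact and misses the hull of \<open>K\<close>, so
  finitely many separating functions cover it. Outside \<open>L\<close> these functions may be small
  again; \<open>V\<close> is kept in order to discard those parts of the sublevel set.\<close>

lemma analytic_polyhedron_exists:
  assumes M: "complex_manifold M" and K: "holomorphically_convex_compact M K"
    and U: "openin (mtop M) U" "K \<subseteq> U"
  obtains V L m f \<rho> where "openin (mtop M) V" "closedin (mtop M) L" "K \<subseteq> V" "V \<subseteq> L" "L \<subseteq> U"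
    "\<And>i. i < (m::nat) \<Longrightarrow> holomorphic_function M (f i)" "\<rho> < 1" "\<And>i x. i < m \<Longrightarrow> x \<in> K \<Longrightarrow> cmod (f i x) \<le> \<rho>"
    "\<And>x. x \<in> L \<Longrightarrow> x \<notin> V \<Longrightarrow> \<exists>i<m. cmod (f i x) > 1"
proof -
  have Kc: "compactin (mtop M) K" and hull: "holomorphic_hull M K = K"
    using K by (auto simp: holomorphically_convex_compact_def)
  have HM: "Hausdorff_space (mtop M)" using complex_manifoldD(1)[OF M] .
  have "locally_compact_space (subtopology (mtop M) U)"
    by (rule locally_compact_space_open_subset) (use HM complex_manifold_locally_compact[OF M] U in auto)
  moreover have "Hausdorff_space (subtopology (mtop M) U)" using HM by (rule Hausdorff_space_subtopology)
  moreover have "compactin (subtopology (mtop M) U) K" using Kc U by (simp add: compactin_subtopology)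
  ultimately obtain V L where VL: "openin (subtopology (mtop M) U) V" "compactin (subtopology (mtop M) U) L" "K \<subseteq> V" "V \<subseteq> L"
    by (metis locally_compact_space_compact_closed_compact)
  have V: "openin (mtop M) V" using VL(1) U(1) openin_trans_full by blast
  have L: "compactin (mtop M) L" "L \<subseteq> U" using VL(2) by (auto simp: compactin_subtopology)
  have Lcl: "closedin (mtop M) L" using compactin_imp_closedin[OF HM L(1)] .
  have "compactin (mtop M) (L \<inter> (topspace (mtop M) - V))"
    by (rule compact_Int_closedin[OF L(1)]) (use V in auto)
  moreover have LM: "L \<subseteq> topspace (mtop M)" using L(1) by (rule compactin_subset_topspace)
  ultimately have bd: "compactin (mtop M) (L - V)" by (metis Diff_Int_distrib inf.absorb1 Int_Diff)
  define G where "G = {g. holomorphic_function M g \<and> (\<exists>\<rho><1. \<forall>x\<in>K. cmod (g x) \<le> \<rho>)}"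
  define W where "W g = {x \<in> topspace (mtop M). cmod (g x) \<in> {1<..}}" for g :: "'a \<Rightarrow> complex"
  have "openin (mtop M) (W g)" if "g \<in> G" for g
    unfolding W_def
  proof (rule openin_continuous_map_preimage)
    show "continuous_map (mtop M) euclideanreal (\<lambda>x. cmod (g x))"
      using that by (auto simp: G_def holomorphic_function_def intro: continuous_map_norm)
  qed simp
  moreover have "L - V \<subseteq> \<Union> (W ` G)"
  proof
    fix y assume y: "y \<in> L - V"
    then have "y \<in> topspace (mtop M)" "y \<notin> holomorphic_hull M K" using LM VL(3) hull by auto
    then obtain g \<rho> where "holomorphic_function M g" "cmod (g y) > 1" "\<rho> < 1" "\<And>x. x \<in> K \<Longrightarrow> cmod (g x) \<le> \<rho>"
      using separating_function_off_hull[OF M] by metis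
    then have "g \<in> G" "y \<in> W g" using \<open>y \<in> topspace (mtop M)\<close> by (auto simp: G_def W_def)
    then show "y \<in> \<Union> (W ` G)" by blast
  qed
  ultimately obtain \<F> where F: "finite \<F>" "\<F> \<subseteq> W ` G" "L - V \<subseteq> \<Union> \<F>"
    using bd unfolding compactin_def by (metis (no_types, lifting) imageE)
  obtain G' where G': "G' \<subseteq> G" "finite G'" "\<F> = W ` G'" using F(1,2) finite_subset_image by metis
  obtain gs where gs: "set gs = G'" using finite_list[OF G'(2)] by blast
  have "\<forall>g\<in>G'. \<exists>\<rho><1. \<forall>x\<in>K. cmod (g x) \<le> \<rho>" using G'(1) by (auto simp: G_def)
  then obtain \<rho> where \<rho>: "\<And>g. g \<in> G' \<Longrightarrow> \<rho> g < 1" "\<And>g x. g \<in> G' \<Longrightarrow> x \<in> K \<Longrightarrow> cmod (g x) \<le> \<rho> g" by metis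
  \<comment> \<open>The inserted 0 keeps the maximum defined when no separating function is
    required.\<close>
  define r where "r = Max (insert 0 (\<rho> ` G'))"
  have r: "r < 1" "\<And>g. g \<in> G' \<Longrightarrow> \<rho> g \<le> r" using \<rho>(1) G'(2) by (auto simp: r_def)
  show ?thesis
  proof (rule that[of V L "length gs" "\<lambda>i. gs ! i" r, OF V Lcl VL(3,4) L(2)])
    show "holomorphic_function M (gs ! i)" if "i < length gs" for i
      using that gs G'(1) nth_mem[OF that] by (auto simp: G_def)
    show "r < 1" by (rule r)
    show "cmod ((gs ! i) x) \<le> r" if "i < length gs" "x \<in> K" for i x
      using \<rho>(2)[of "gs ! i" x] r(2)[of "gs ! i"] that gs nth_mem[OF that(1)] by auto
    show "\<exists>i<length gs. cmod ((gs ! i) x) > 1" if xLV: "x \<in> L" "x \<notin> V" for x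
    proof -
      obtain g where "g \<in> G'" "x \<in> W g" using F(3) xLV G'(3) by blast
      then show ?thesis using gs by (auto simp: W_def in_set_conv_nth)
    qed
  qed
qed

text \<open>Over \<open>U\<close> the graph is closed by continuity. Over a point outside
  \<open>U\<close>, nearby graph points have a large fibre coordinate, hence stay away from any
  given point of the fibre.\<close>

lemma (in stein_times_Cn) closedin_graph:
  assumes U: "openin (mtop S) U" and f: "\<And>j. j < n \<Longrightarrow> hol_fun_on S U (f j)"
    and blowup: "\<And>x c. x \<in> topspace (mtop S) \<Longrightarrow> x \<notin> U \<Longrightarrow>
      \<exists>B. openin (mtop S) B \<and> x \<in> B \<and> (\<forall>x'\<in>B \<inter> U. \<exists>j<n. cmod (f j x') > c)"
  shows "closedin R (graph_map f ` U)"
  unfolding closedin_def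
proof
  let ?T = "graph_map f ` U"
  have US: "U \<subseteq> topspace (mtop S)" using U by (rule openin_subset)
  show "?T \<subseteq> topspace R" using US graph_map_in by blast
  have "\<exists>A. openin R A \<and> y \<in> A \<and> A \<subseteq> topspace R - ?T" if y: "y \<in> topspace R" "y \<notin> ?T" for y
  proof (cases "p1 y \<in> U")
    case True
    have "\<exists>j<n. p2 y j \<noteq> f j (p1 y)"
      using graph_map_eqI[OF y(1), of f] y(2) True by auto
    then obtain j where j: "j < n" "p2 y j \<noteq> f j (p1 y)" by blast
    let ?D = "subtopology R (pdom U)"
    have Dop: "openin R (pdom U)"
      unfolding pdom_def by (rule openin_continuous_map_preimage[OF cont_p1 U])
    have "continuous_map ?D (subtopology (mtop S) U) p1"
      using cont_p1 by (auto simp: continuous_map_in_subtopology continuous_map_from_subtopology pdom_def)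
    moreover have "continuous_map (subtopology (mtop S) U) euclidean (f j)"
      using f[OF j(1)] by (simp add: hol_fun_on_def)
    ultimately have "continuous_map ?D euclidean (f j \<circ> p1)" by (rule continuous_map_compose)
    then have c: "continuous_map ?D euclidean (\<lambda>y. p2 y j - f j (p1 y))"
      using continuous_map_from_subtopology[OF cont_p2_coordinate]
      by (intro continuous_map_diff) (auto simp: o_def)
    have "openin ?D {y \<in> topspace ?D. p2 y j - f j (p1 y) \<in> - {0}}"
      by (rule openin_continuous_map_preimage[OF c]) auto
    then have "openin R {y \<in> topspace ?D. p2 y j - f j (p1 y) \<in> - {0}}"
      using Dop openin_trans_full by blast
    moreover have "y \<in> {y \<in> topspace ?D. p2 y j - f j (p1 y) \<in> - {0}}"
      using y True j by (auto simp: pdom_def)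
    moreover have "{y \<in> topspace ?D. p2 y j - f j (p1 y) \<in> - {0}} \<subseteq> topspace R - ?T"
      using j(1) US by (auto simp: p1_graph_map p2_graph_map subsetD)
    ultimately show ?thesis by blast
  next
    case False
    \<comment> \<open>This exceeds every fibre coordinate of \<open>y\<close> in modulus, so the
      bounds |p2| < c define a neighbourhood of \<open>y\<close>.\<close>
    define c where "c = (\<Sum>j<n. cmod (p2 y j)) + 1"
    obtain B where B: "openin (mtop S) B" "p1 y \<in> B" "\<And>x'. x' \<in> B \<Longrightarrow> x' \<in> U \<Longrightarrow> \<exists>j<n. cmod (f j x') > c"
      using blowup[OF p1_in[OF y(1)] False, of c] by blast
    define A where "A j = {y' \<in> topspace R. p2 y' j \<in> ball 0 c}" for j
    have "openin R (A j)" for j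
      unfolding A_def by (rule openin_continuous_map_preimage[OF cont_p2_coordinate]) auto
    moreover have "openin R (pdom B)"
      unfolding pdom_def by (rule openin_continuous_map_preimage[OF cont_p1 B(1)])
    ultimately have "openin R (\<Inter> (insert (pdom B) (A ` {..<n})))"
      by (intro openin_Inter) auto
    moreover have "y \<in> \<Inter> (insert (pdom B) (A ` {..<n}))"
    proof -
      have "cmod (p2 y j) < c" if "j < n" for j
        using member_le_sum[of j "{..<n}" "\<lambda>j. cmod (p2 y j)"] that by (auto simp: c_def)
      then show ?thesis using y B by (auto simp: A_def pdom_def)
    qed
    moreover have "\<Inter> (insert (pdom B) (A ` {..<n})) \<subseteq> topspace R - ?T"
    proof
      fix y' assume y': "y' \<in> \<Inter> (insert (pdom B) (A ` {..<n}))"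
      have "y' \<noteq> graph_map f x" if x: "x \<in> U" for x
      proof
        assume eq: "y' = graph_map f x"
        have xS: "x \<in> topspace (mtop S)" using x US by blast
        have "x \<in> B" using y' xS by (auto simp: eq pdom_def p1_graph_map)
        then obtain j where j: "j < n" "cmod (f j x) > c" using B(3) x by blast
        have "y' \<in> A j" using y' j(1) by blast
        then show False using j xS by (simp add: A_def eq p2_graph_map)
      qed
      then show "y' \<in> topspace R - ?T" using y' by (auto simp: pdom_def)
    qed
    ultimately show ?thesis by blast
  qed
  then show "openin R (topspace R - ?T)" by (subst openin_subopen) blast
qed

section \<open>Passage from interpolation to approximation\<close>

theorem theorem1:
  fixes X :: "'x cmanifold" and Y :: "'y cmanifold" and k :: "'x \<Rightarrow> 'y"
  assumes "complex_manifold X" and "complex_manifold Y" and "holomorphic_map X Y k"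
    and "POPI TYPE(real) X Y k"
  shows "POPA TYPE('s) X Y k"
  unfolding POPA_def
proof (intro allI impI, elim conjE)
  fix S :: "'s cmanifold" and K U C D and h :: "'s \<times> (nat \<Rightarrow> real) \<Rightarrow> 'x" and d and \<epsilon> :: real
  assume stein: "stein_manifold S" and K: "holomorphically_convex_compact S K"
    and U: "openin (mtop S) U" "K \<subseteq> U"
    and C: "finite_simplicial_complex C" and D: "finite_simplicial_complex D" "D \<subseteq> C"
    and h: "continuous_map (prod_topology (mtop S) (polyhedron_top C)) (mtop X) h"
    and hU: "\<forall>p\<in>realization C. holomorphic_map_on S U X (\<lambda>x. h (x, p))"
    and hD: "\<forall>q\<in>realization D. holomorphic_map S X (\<lambda>x. h (x, q))"
    and kh: "\<forall>p\<in>realization C. holomorphic_map S Y (\<lambda>x. k (h (x, p)))"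
    and d: "Metric_space (topspace (mtop X)) d" "Metric_space.mtopology (topspace (mtop X)) d = mtop X"
    and \<epsilon>: "\<epsilon> > 0"
  have S: "complex_manifold S" using stein by (simp add: stein_manifold_def)
  have Kc: "compactin (mtop S) K" using K by (simp add: holomorphically_convex_compact_def)
  obtain V L m f \<rho> where V: "openin (mtop S) V" and L: "closedin (mtop S) L" "K \<subseteq> V" "V \<subseteq> L" "L \<subseteq> U"
    and f: "\<And>i. i < (m::nat) \<Longrightarrow> holomorphic_function S (f i)"
    and \<rho>: "\<rho> < 1" "\<And>i x. i < m \<Longrightarrow> x \<in> K \<Longrightarrow> cmod (f i x) \<le> \<rho>"
    and bd: "\<And>x. x \<in> L \<Longrightarrow> x \<notin> V \<Longrightarrow> \<exists>i<m. cmod (f i x) > 1"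
    using analytic_polyhedron_exists[OF S K U] by metis
  have fcont: "continuous_map (mtop S) euclideanreal (\<lambda>x. cmod (f i x))" if "i < m" for i
    using f[OF that] by (auto simp: holomorphic_function_def intro: continuous_map_norm)
  define n where "n = 2 * m"
  define U' where "U' = \<Inter> (insert V ((\<lambda>i. {x \<in> topspace (mtop S). cmod (f i x) \<in> {..<1}}) ` {..<m}))"
  have U': "openin (mtop S) U'" unfolding U'_def
  proof (rule openin_Inter)
    show "openin (mtop S) A"
      if A: "A \<in> insert V ((\<lambda>i. {x \<in> topspace (mtop S). cmod (f i x) \<in> {..<1}}) ` {..<m})" for A
    proof (cases "A = V")
      case False
      then obtain i where "i < m" "A = {x \<in> topspace (mtop S). cmod (f i x) \<in> {..<1}}" using A by blast
      then show ?thesis using openin_continuous_map_preimage[OF fcont, of i "{..<1}"] by simp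
    qed (use V in simp)
  qed auto
  have U'V: "U' \<subseteq> V" and U'f: "\<And>x i. x \<in> U' \<Longrightarrow> i < m \<Longrightarrow> cmod (f i x) < 1"
    and U'I: "\<And>x. x \<in> V \<Longrightarrow> (\<And>i. i < m \<Longrightarrow> cmod (f i x) < 1) \<Longrightarrow> x \<in> U'"
    using openin_subset[OF V] by (auto simp: U'_def)
  have KU': "K \<subseteq> U'"
  proof
    fix x assume "x \<in> K"
    then show "x \<in> U'" using \<rho> L(2) by (intro U'I) (blast, meson le_less_trans)
  qed
  \<comment> \<open>Coordinate \<open>2 * i + b\<close> is \<open>gap_series b\<close> applied to
    \<open>f i\<close>; this accounts for \<open>n = 2 * m\<close>.\<close>
  define \<phi> where "\<phi> j x = gap_series (j mod 2) (f (j div 2) x)" for j x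
  define \<psi> where "\<psi> N j x = (\<Sum>i<N. gap_term (j mod 2) (f (j div 2) x) i)" for N j x
  have jdiv: "j div 2 < m" if "j < n" for j using that by (auto simp: n_def)
  have \<phi>: "hol_fun_on S U' (\<phi> j)" if "j < n" for j
    unfolding \<phi>_def[abs_def]
    by (rule hol_fun_on_compose_holomorphic[OF holomorphic_function_imp_hol_fun_on[OF S f[OF jdiv[OF that]]]
          holomorphic_gap_series open_ball]) (use U'f jdiv[OF that] in auto)
  have \<psi>: "holomorphic_function S (\<psi> N j)" if "j < n" for N j
    unfolding \<psi>_def[abs_def]
    by (rule holomorphic_function_compose_entire[OF S f[OF jdiv[OF that]] holomorphic_gap_partial_sum])
  \<comment> \<open>On \<open>K\<close> all \<open>f i\<close> take values in the fixed disc of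
    radius \<open>\<rho>\<close> below 1, where both series converge uniformly.\<close>
  have \<psi>\<phi>: "\<exists>N0. \<forall>N\<ge>N0. \<forall>j<n. \<forall>x\<in>K. cmod (\<psi> N j x - \<phi> j x) < \<delta>" if "\<delta> > 0" for \<delta>
  proof -
    have "\<forall>\<^sub>F N in sequentially. \<forall>b\<in>{..<2}. \<forall>z\<in>{z. norm z \<le> \<rho>}. dist (\<Sum>i<N. gap_term b z i) (gap_series b z) < \<delta>"
      using gap_series_uniform_limit[OF \<rho>(1)] \<open>\<delta> > 0\<close>
      by (intro eventually_ball_finite) (auto simp: uniform_limit_iff)
    then obtain N0 where N0: "\<And>N b z. N \<ge> N0 \<Longrightarrow> b < 2 \<Longrightarrow> norm z \<le> \<rho> \<Longrightarrow>
        dist (\<Sum>i<N. gap_term b z i) (gap_series b z) < \<delta>"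
      unfolding eventually_sequentially by auto
    show ?thesis
      using N0 \<rho>(2) jdiv by (intro exI[of _ N0]) (auto simp: \<psi>_def \<phi>_def dist_norm)
  qed
  have blowup: "\<exists>B. openin (mtop S) B \<and> x \<in> B \<and> (\<forall>x'\<in>B \<inter> U'. \<exists>j<n. cmod (\<phi> j x') > c)"
    if x: "x \<in> topspace (mtop S)" "x \<notin> U'" for x c
  proof (cases "x \<in> L")
    case False
    have "openin (mtop S) (topspace (mtop S) - L)" using L(1) by blast
    then show ?thesis using x False U'V L(3) by (intro exI[of _ "topspace (mtop S) - L"]) auto
  next
    case True
    \<comment> \<open>A point of \<open>L\<close> outside \<open>U'\<close> either lies in
      \<open>V\<close> and violates one of the defining inequalities, or lies in
      \<open>L - V\<close>, where some |f i| exceeds 1.\<close>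
    have "\<exists>i<m. cmod (f i x) \<ge> 1"
    proof (cases "x \<in> V")
      case True
      then show ?thesis using U'I x by (meson not_le)
    next
      case False
      then show ?thesis using bd[OF \<open>x \<in> L\<close>] by (meson less_imp_le)
    qed
    then obtain i where i: "i < m" "cmod (f i x) \<ge> 1" by blast
    obtain r where r: "r < 1" "\<And>z. r < norm z \<Longrightarrow> norm z < 1 \<Longrightarrow> \<exists>b<2. norm (gap_series b z) > c"
      using gap_series_proper[of c] by blast
    let ?B = "{x' \<in> topspace (mtop S). cmod (f i x') \<in> {r<..}}"
    have "openin (mtop S) ?B" by (rule openin_continuous_map_preimage[OF fcont[OF i(1)]]) simp
    moreover have "x \<in> ?B" using x i r(1) by simp
    moreover have "\<exists>j<n. cmod (\<phi> j x') > c" if x': "x' \<in> ?B \<inter> U'" for x'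
    proof -
      obtain b where "b < 2" "cmod (gap_series b (f i x')) > c"
        using r(2)[of "f i x'"] x' U'f[of x' i] i(1) by auto
      moreover from this have "(2 * i + b) div 2 = i" "(2 * i + b) mod 2 = b" by auto
      ultimately show ?thesis
        using i(1) by (intro exI[of _ "2 * i + b"]) (auto simp: \<phi>_def n_def)
    qed
    ultimately show ?thesis by blast
  qed
  \<comment> \<open>POPI is assumed for Stein manifolds on the type of reals only, so the product is
    carried over to a set of reals.\<close>
  obtain e :: "'s \<times> (nat \<Rightarrow> complex) \<Rightarrow> real" where "inj_on e (topspace (prod_topology (mtop S) (complex_space n)))"
  proof (rule second_countable_Hausdorff_lepoll_real)
    show "second_countable (prod_topology (mtop S) (complex_space n))"
      by (rule second_countable_prod_topology[OF complex_manifoldD(2)[OF S] second_countable_complex_space])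
    show "Hausdorff_space (prod_topology (mtop S) (complex_space n))"
      using complex_manifoldD(1)[OF S] Hausdorff_complex_space by (simp add: Hausdorff_space_prod_topology)
  qed
  then obtain R q where homeo: "homeomorphic_maps (prod_topology (mtop S) (complex_space n)) R e q"
    using homeomorphic_copy by blast
  interpret P: stein_times_Cn S n R e q
    by unfold_locales fact+
  define T where "T = P.graph_map \<phi> ` U'"
  have T: "closed_submanifold P.M T"
    unfolding T_def by (rule P.closed_submanifold_graph[OF U' \<phi> P.closedin_graph[OF U' \<phi> blowup]])
  have U'S: "U' \<subseteq> topspace (mtop S)" using U' by (rule openin_subset)
  \<comment> \<open>Pulling back along the holomorphic projection preserves holomorphy for
    parameters in \<open>D\<close> and after composing with \<open>k\<close>, on the whole
    product.\<close>
  define h' where "h' = (\<lambda>z. h (P.p1 (fst z), snd z))"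
  let ?C = "polyhedron_top C"
  have h'cont: "continuous_map (prod_topology (mtop P.M) ?C) (mtop X) h'"
  proof -
    have "continuous_map (prod_topology R ?C) (prod_topology (mtop S) ?C) (\<lambda>z. (P.p1 (fst z), snd z))"
      using continuous_map_compose[OF continuous_map_fst P.cont_p1, of ?C] continuous_map_snd[of R ?C]
      by (simp add: continuous_map_paired o_def)
    from continuous_map_compose[OF this h] show ?thesis by (simp add: h'_def o_def)
  qed
  note Mch = complex_manifoldD[OF P.complex_manifold_M] and Sch = complex_manifoldD[OF S]
  have h'T: "holomorphic_map_on P.M T X (\<lambda>y. h' (y, p))" if "p \<in> realization C" for p
  proof -
    \<comment> \<open>\<open>T\<close> lies over \<open>U'\<close>, which is inside
      \<open>U\<close>; so on \<open>T\<close> the map \<open>h'\<close> factors through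
      \<open>U\<close>, where \<open>h\<close> is holomorphic.\<close>
    have 1: "holomorphic_map (induced P.M T) (induced S U) P.p1"
    proof (rule holomorphic_map_induced[OF P.complex_manifold_M S P.holomorphic_map_p1])
      fix y assume "y \<in> T"
      then show "P.p1 y \<in> U" using U'S U'V L by (auto simp: T_def P.p1_graph_map subsetD)
    qed
    have 2: "holomorphic_map (induced S U) X (\<lambda>x. h (x, p))" using hU that by blast
    have "holomorphic_map (induced P.M T) X (\<lambda>y. h (P.p1 y, p))"
      by (rule holomorphic_map_compose[OF _ _ induced_open_cover[OF S U(1)] 1 2]) (erule is_chart_induced)+
    then show ?thesis by (simp add: h'_def)
  qed
  have h'D: "holomorphic_map P.M X (\<lambda>y. h' (y, p))" if "p \<in> realization D" for p
    using holomorphic_map_compose[OF Mch(3) Sch(3) _ P.holomorphic_map_p1 hD[rule_format, OF that]]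
    by (simp add: h'_def Sch(4))
  have kh': "holomorphic_map P.M Y (\<lambda>y. k (h' (y, p)))" if "p \<in> realization C" for p
    using holomorphic_map_compose[OF Mch(3) Sch(3) _ P.holomorphic_map_p1 kh[rule_format, OF that]]
    by (simp add: h'_def Sch(4))
  have "\<exists>H :: real \<times> (nat \<Rightarrow> real) \<times> real \<Rightarrow> 'x.
        continuous_map (prod_topology (mtop P.M) (prod_topology ?C unit_interval_top)) (mtop X) H \<and>
        (\<forall>x\<in>topspace (mtop P.M). \<forall>p\<in>realization C. H (x, p, 0) = h' (x, p)) \<and>
        (\<forall>p\<in>realization C. holomorphic_map P.M X (\<lambda>x. H (x, p, 1))) \<and>
        (\<forall>x\<in>topspace (mtop P.M). \<forall>q\<in>realization D. \<forall>t\<in>{0..1}. H (x, q, t) = h' (x, q)) \<and>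
        (\<forall>x\<in>topspace (mtop P.M). \<forall>p\<in>realization C. \<forall>t\<in>{0..1}. k (H (x, p, t)) = k (h' (x, p))) \<and>
        (\<forall>x\<in>T. \<forall>p\<in>realization C. \<forall>t\<in>{0..1}. H (x, p, t) = h' (x, p))"
  proof (rule assms(4)[unfolded POPI_def, rule_format], intro conjI ballI)
  qed (use P.stein_manifold_M T C D h'cont h'T h'D kh' in auto)
  then obtain H :: "real \<times> (nat \<Rightarrow> real) \<times> real \<Rightarrow> 'x" where
        H: "continuous_map (prod_topology R (prod_topology ?C unit_interval_top)) (mtop X) H"
    and H0: "\<forall>x\<in>topspace R. \<forall>p\<in>realization C. H (x, p, 0) = h' (x, p)"
    and H1: "\<forall>p\<in>realization C. holomorphic_map P.M X (\<lambda>x. H (x, p, 1))"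
    and HD: "\<forall>x\<in>topspace R. \<forall>q\<in>realization D. \<forall>t\<in>{0..1}. H (x, q, t) = h' (x, q)"
    and kH: "\<forall>x\<in>topspace R. \<forall>p\<in>realization C. \<forall>t\<in>{0..1}. k (H (x, p, t)) = k (h' (x, p))"
    and HT: "\<forall>x\<in>T. \<forall>p\<in>realization C. \<forall>t\<in>{0..1}. H (x, p, t) = h' (x, p)"
    unfolding P.mtop_M by (elim exE conjE)
  have gm: "P.graph_map (\<psi> N) x \<in> topspace R" "h' (P.graph_map (\<psi> N) x, p) = h (x, p)"
    if "x \<in> topspace (mtop S)" for N x p
    using P.graph_map_in[OF that] P.p1_graph_map[OF that] by (auto simp: h'_def)
  define W where "W = prod_topology (mtop S) (prod_topology ?C unit_interval_top)"
  interpret X: Metric_space "topspace (mtop X)" d by (rule d(1))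
  define close where "close N = (\<lambda>(x, p, t). d (H (P.graph_map (\<psi> N) x, p, t)) (h (x, p)) < \<epsilon>)" for N
  \<comment> \<open>At the point of \<open>T\<close> over \<open>x\<close> the value of
    \<open>H\<close> is \<open>h (x, p)\<close>. Near it, \<open>H\<close> on the graph of
    \<open>\<psi> N\<close> and \<open>h\<close> on the base are both within \<epsilon>/2 of that
    value, with one bound on \<open>N\<close> for the whole neighbourhood.\<close>
  have local_close: "\<exists>A. openin W A \<and> (x, p, t) \<in> A \<and>
      (\<exists>N0. \<forall>N\<ge>N0. \<forall>x' p' t'. (x', p', t') \<in> A \<and> x' \<in> K \<longrightarrow> close N (x', p', t'))"
    if x: "x \<in> K" and p: "p \<in> realization C" and t: "t \<in> {0..1}" for x p t
  proof -
    have xS: "x \<in> topspace (mtop S)" using x Kc compactin_subset_topspace by blast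
    have xU': "x \<in> U'" using x KU' by blast
    define a where "a = h (x, p)"
    have aX: "a \<in> topspace (mtop X)"
      using h xS p unfolding a_def continuous_map_def by auto
    have ballX: "openin (mtop X) (X.mball a (\<epsilon>/2))" using X.openin_mball d(2) by simp
    have aball: "a \<in> X.mball a (\<epsilon>/2)" using aX \<epsilon> by simp
    let ?R = "prod_topology R (prod_topology ?C unit_interval_top)"
    have "openin ?R {z \<in> topspace ?R. H z \<in> X.mball a (\<epsilon>/2)}"
      by (rule openin_continuous_map_preimage[OF H ballX])
    moreover have "(P.graph_map \<phi> x, (p, t)) \<in> {z \<in> topspace ?R. H z \<in> X.mball a (\<epsilon>/2)}"
    proof -
      have "H (P.graph_map \<phi> x, p, t) = a"
        using HT p t xU' P.p1_graph_map[OF xS] by (auto simp: T_def h'_def a_def)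
      then show ?thesis using P.graph_map_in[OF xS] p t aball by auto
    qed
    ultimately have "\<exists>A1 A2. openin R A1 \<and> openin (prod_topology ?C unit_interval_top) A2 \<and>
        P.graph_map \<phi> x \<in> A1 \<and> (p, t) \<in> A2 \<and> A1 \<times> A2 \<subseteq> {z \<in> topspace ?R. H z \<in> X.mball a (\<epsilon>/2)}"
      unfolding openin_prod_topology_alt[of R] by (elim allE impE)
    then obtain A1 A2 where A: "openin R A1" "openin (prod_topology ?C unit_interval_top) A2"
        "P.graph_map \<phi> x \<in> A1" "(p, t) \<in> A2" "A1 \<times> A2 \<subseteq> {z \<in> topspace ?R. H z \<in> X.mball a (\<epsilon>/2)}"
      by (elim exE conjE)
    obtain B N0 where B: "openin (mtop S) B" "x \<in> B"
      and BN: "\<And>N x'. N \<ge> N0 \<Longrightarrow> x' \<in> B \<Longrightarrow> x' \<in> K \<Longrightarrow> P.graph_map (\<psi> N) x' \<in> A1"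
      by (rule P.graph_map_nearby[OF U' xU' \<phi> \<psi>\<phi> A(1,3)]) auto
    have "continuous_map W (prod_topology (mtop S) ?C) (\<lambda>z. (fst z, fst (snd z)))"
      using continuous_map_compose[OF continuous_map_snd continuous_map_fst, of "mtop S" ?C unit_interval_top]
      by (simp add: W_def continuous_map_paired continuous_map_fst o_def)
    from continuous_map_compose[OF this h]
    have hW: "continuous_map W (mtop X) (\<lambda>z. h (fst z, fst (snd z)))" by (simp add: o_def)
    define A' where "A' = B \<times> A2 \<inter> {z \<in> topspace W. h (fst z, fst (snd z)) \<in> X.mball a (\<epsilon>/2)}"
    have "openin W {z \<in> topspace W. h (fst z, fst (snd z)) \<in> X.mball a (\<epsilon>/2)}"
      by (rule openin_continuous_map_preimage[OF hW ballX])
    moreover have "openin W (B \<times> A2)" using B(1) A(2) by (simp add: W_def openin_prod_Times_iff)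
    ultimately have A': "openin W A'" unfolding A'_def by blast
    have xA': "(x, p, t) \<in> A'"
      using B(2) A(4) xS p t aball by (auto simp: A'_def W_def a_def)
    have closeA': "close N (x', p', t')" if "N \<ge> N0" "x' \<in> K" and z: "(x', p', t') \<in> A'"
      for N x' p' t'
    proof -
      have "(P.graph_map (\<psi> N) x', (p', t')) \<in> A1 \<times> A2" using BN[OF that(1)] that(2) z unfolding A'_def by blast
      then have "H (P.graph_map (\<psi> N) x', p', t') \<in> X.mball a (\<epsilon>/2)" using A(5) by blast
      moreover have "h (x', p') \<in> X.mball a (\<epsilon>/2)" using z by (simp add: A'_def)
      ultimately have 1: "H (P.graph_map (\<psi> N) x', p', t') \<in> topspace (mtop X)" "h (x', p') \<in> topspace (mtop X)"
        "d a (H (P.graph_map (\<psi> N) x', p', t')) < \<epsilon>/2" "d a (h (x', p')) < \<epsilon>/2" by (auto simp: X.in_mball)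
      have "d (H (P.graph_map (\<psi> N) x', p', t')) (h (x', p')) \<le> d (H (P.graph_map (\<psi> N) x', p', t')) a + d a (h (x', p'))"
        using 1 aX by (intro X.triangle)
      also have "\<dots> < \<epsilon>" using 1 X.commute[of a "H (P.graph_map (\<psi> N) x', p', t')"] by simp
      finally show ?thesis by (simp add: close_def)
    qed
    show ?thesis
      by (intro exI[of _ A'] conjI A' xA' exI[of _ N0] allI impI) (elim conjE, rule closeA')
  qed
  define Q where "Q = K \<times> realization C \<times> {0..1::real}"
  have "compactin ?C (realization C)"
    using compactin_realization[OF C] by (simp add: compactin_subtopology)
  moreover have "compactin unit_interval_top {0..1::real}" by (simp add: compactin_subtopology)
  \<comment> \<open>Compactness of the space of points and parameters turns the local bounds on
    \<open>N\<close> into a single one.\<close>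
  ultimately have Qc: "compactin W Q" using Kc by (simp add: W_def Q_def compactin_Times)
  define \<A> where "\<A> = {A. openin W A \<and> (\<exists>N0. \<forall>N\<ge>N0. \<forall>x p t. (x, p, t) \<in> A \<and> x \<in> K \<longrightarrow> close N (x, p, t))}"
  have "Q \<subseteq> \<Union> \<A>"
  proof
    fix z assume "z \<in> Q"
    then obtain x p t where z: "z = (x, p, t)" "x \<in> K" "p \<in> realization C" "t \<in> {0..1}" by (auto simp: Q_def)
    obtain A N0 where A: "openin W A" "(x, p, t) \<in> A"
      "\<forall>N\<ge>N0. \<forall>x' p' t'. (x', p', t') \<in> A \<and> x' \<in> K \<longrightarrow> close N (x', p', t')"
      using local_close[OF z(2-4)] by (elim exE conjE)
    have "A \<in> \<A>" unfolding \<A>_def by (intro CollectI conjI exI[of _ N0] A(1,3))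
    then show "z \<in> \<Union> \<A>" using A(2) z(1) by blast
  qed
  moreover have "\<forall>A\<in>\<A>. openin W A" by (simp add: \<A>_def)
  ultimately obtain \<F> where \<F>: "finite \<F>" "\<F> \<subseteq> \<A>" "Q \<subseteq> \<Union> \<F>"
    using compactinD[OF Qc, of \<A>] by blast
  have "\<forall>A\<in>\<F>. \<exists>N0. \<forall>N\<ge>N0. \<forall>x p t. (x, p, t) \<in> A \<and> x \<in> K \<longrightarrow> close N (x, p, t)"
    using \<F>(2) by (auto simp: \<A>_def)
  from bchoice[OF this] obtain N0 where N0: "\<forall>A\<in>\<F>. \<forall>N\<ge>N0 A. \<forall>x p t. (x, p, t) \<in> A \<and> x \<in> K \<longrightarrow> close N (x, p, t)" ..
  \<comment> \<open>The inserted 0 handles an empty subcover, which occurs when \<open>Q\<close> is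
    empty.\<close>
  define N where "N = Max (insert 0 (N0 ` \<F>))"
  have N: "N0 A \<le> N" if "A \<in> \<F>" for A using that \<F>(1) by (auto simp: N_def)
  have closeN: "close N (x, p, t)" if xpt: "x \<in> K" "p \<in> realization C" "t \<in> {0..1}" for x p t
  proof -
    have "(x, p, t) \<in> Q" using xpt by (simp add: Q_def)
    then obtain A where "A \<in> \<F>" "(x, p, t) \<in> A" using \<F>(3) by blast
    then show ?thesis using N0 N xpt(1) by blast
  qed
  \<comment> \<open>For this fixed \<open>N\<close> the graph map is holomorphic on all of
    \<open>S\<close>, so \<open>G\<close> at time 1 is a composition of holomorphic maps.\<close>
  define G where "G = (\<lambda>z. H (P.graph_map (\<psi> N) (fst z), snd z))"
  have gmap: "holomorphic_map S P.M (P.graph_map (\<psi> N))" by (rule P.holomorphic_map_graph_map[OF \<psi>])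
  show "\<exists>H. continuous_map (prod_topology (mtop S) (prod_topology ?C unit_interval_top)) (mtop X) H \<and>
        (\<forall>x\<in>topspace (mtop S). \<forall>p\<in>realization C. H (x, p, 0) = h (x, p)) \<and>
        (\<forall>p\<in>realization C. holomorphic_map S X (\<lambda>x. H (x, p, 1))) \<and>
        (\<forall>x\<in>topspace (mtop S). \<forall>q\<in>realization D. \<forall>t\<in>{0..1}. H (x, q, t) = h (x, q)) \<and>
        (\<forall>x\<in>topspace (mtop S). \<forall>p\<in>realization C. \<forall>t\<in>{0..1}. k (H (x, p, t)) = k (h (x, p))) \<and>
        (\<forall>x\<in>K. \<forall>p\<in>realization C. \<forall>t\<in>{0..1}. d (H (x, p, t)) (h (x, p)) < \<epsilon>)"
  proof (intro exI[of _ G] conjI ballI)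
    have "continuous_map (mtop S) R (P.graph_map (\<psi> N))" using holomorphic_mapD(1)[OF gmap] by simp
    from continuous_map_compose[OF continuous_map_fst this, of "prod_topology ?C unit_interval_top"]
    have "continuous_map (prod_topology (mtop S) (prod_topology ?C unit_interval_top))
      (prod_topology R (prod_topology ?C unit_interval_top)) (\<lambda>z. (P.graph_map (\<psi> N) (fst z), snd z))"
      by (simp add: continuous_map_paired continuous_map_snd o_def)
    from continuous_map_compose[OF this H]
    show "continuous_map (prod_topology (mtop S) (prod_topology ?C unit_interval_top)) (mtop X) G"
      by (simp add: G_def o_def)
    show "G (x, p, 0) = h (x, p)" if "x \<in> topspace (mtop S)" "p \<in> realization C" for x p
      using H0 gm[OF that(1)] that(2) by (simp add: G_def)
    show "holomorphic_map S X (\<lambda>x. G (x, p, 1))" if "p \<in> realization C" for p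
      using holomorphic_map_compose[OF Sch(3) Mch(3) _ gmap H1[rule_format, OF that]]
      by (simp add: G_def Mch(4)[unfolded P.mtop_M])
    show "G (x, q, t) = h (x, q)" if "x \<in> topspace (mtop S)" "q \<in> realization D" "t \<in> {0..1}" for x q t
      using HD gm[OF that(1)] that(2,3) by (simp add: G_def)
    show "k (G (x, p, t)) = k (h (x, p))" if "x \<in> topspace (mtop S)" "p \<in> realization C" "t \<in> {0..1}" for x p t
      using kH gm[OF that(1)] that(2,3) by (simp add: G_def)
    show "d (G (x, p, t)) (h (x, p)) < \<epsilon>" if "x \<in> K" "p \<in> realization C" "t \<in> {0..1}" for x p t
      using closeN[OF that] by (simp add: G_def close_def)
  qed
qed

end
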